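(* Consider a sequence of linear models $Y=X\beta+\varepsilon$ indexed by $n$, where $X\in\mathbb{R}^{n\times p}$ has rows $X_1^\top,\dots,X_n^\top$ drawn i.i.d. from $N(0,\Sigma)$, with $X$ independent of $\varepsilon$. Suppose that $F_0$ has a finite fourth moment and that: (a) there are absolute constants $\theta,\gamma>0$ such that $\varrho/n=n^{-\theta}$ and $\rho/n=n^{-\gamma}$ for every $n\ge1$; (b) $\|\beta\|_2\lesssim1$; (c) $\|\Sigma\|_{\mathrm{op}}\lesssim1$; (d) there are a number $\eta>0$ and absolute constants $k_1,k_2>0$ such that $k_1i^{-\eta}\le\lambda_i(\Sigma)\le k_2i^{-\eta}$ for all $i=1,\dots,p$; (e) there are absolute constants $k_3,k_4\in(0,1)$ such that for all $n\ge3$, $k_3\le\frac pn\le k_4$ and $p\le n-2$. Suppose that $\gamma$ is chosen so that $\frac{\eta}{1+\eta}<\gamma<\min\{\eta,1\}$, and that $\theta$ is chosen as $\theta=2\eta/3$ when $\eta\in(0,\frac12)$ and $\theta=\frac{\eta}{\eta+1}$ when $\eta>\frac12$. Then there is a sequence of positive numbers $\delta_n$ with $\lim_{n\to\infty}\delta_n=0$ such that the event $$\mathbb{E}\Big[\max_{1\le i\le n}d_2^2\Big(\tfrac{1}{\sqrt{v_\rho}}\Psi_\rho(F_0;X_i),\ \tfrac1{\sqrt{v_\rho}}\Phi_\rho(\widehat F_\varrho;X_i)\Big)\,\Big|\,X\Big]\le\delta_n,$$ where $v_\rho=v_\rho(X;X_i)$ in the $i$th term, has $\mathbb{P}_X$-probability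 tending to $1$ as $n\to\infty$.
   Context: Model: $Y=X\beta+\varepsilon\in\mathbb{R}^n$, $\beta\in\mathbb{R}^p$, and $\varepsilon_1,\dots,\varepsilon_n$ i.i.d. from a distribution $F_0$ on $\mathbb{R}$ with mean $0$ and variance $0<\sigma^2<\infty$. $X,\beta,p,\Sigma$ may vary with $n$; $F_0$ is fixed. $\mathbb{P}_X$ is the distribution of $X$. Ridge estimator: for $r>0$, $\widehat\beta_r=(X^\top X+rI_{p\times p})^{-1}X^\top Y$; it is used with two parameters, $\rho$ and the "pilot" parameter $\varrho$. For $c\in\mathbb{R}^p$ (possibly a row of $X$, conditionally on $X$): $\Psi_\rho(F_0;c)=\mathcal{L}\big(c^\top(\widehat\beta_\rho-\beta)\,|\,X\big)$. For a distribution $F$ on $\mathbb{R}$, $\Phi_\rho(F;c)$ is the law, conditionally on $X$ (and with $F$ held fixed), of $c^\top(X^\top X+\rho I_{p\times p})^{-1}X^\top\varepsilon^*$, where $\varepsilon^*\in\mathbb{R}^n$ has i.i.d. entries drawn from $F$. $v_\rho(X;c)=\sigma^2\|c^\top(X^\top X+\rho I_{p\times p})^{-1}X^\top\|_2^2$. For a scalar $a$, $a\,\mathcal{L}(U)$ denotes $\mathcal{L}(aU)$. $\widehat F_\varrho$: with $\widehat e(\varrho)=Y-X\widehat\beta_\varrho$ and $\bar e(\varrho)=\frac1n\sum_{i=1}^n\widehat e_i(\varrho)$, $\widehat F_\varrho$ places mass $1/n$ at each value $\widehat e_i(\varrho)-\bar e(\varrho)$, $i=1,\dots,n$. Mallows-$\ell_2$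 metric: $d_2^2(\mathcal{L}(U),\mathcal{L}(V))=\inf_{\pi}\mathbb{E}\|U-V\|_2^2$, the infimum being over all joint distributions $\pi$ of $(U,V)$ with marginals $\mathcal{L}(U)$ and $\mathcal{L}(V)$. Notation: $\lambda_1(A)\ge\lambda_2(A)\ge\cdots$ are the ordered eigenvalues of $A$; $\|\cdot\|_{\mathrm{op}}$ is the operator norm. "Absolute constant" means a constant not depending on $n$. $a_n\lesssim b_n$ means there are an absolute constant $\kappa_0>0$ and an integer $n_0\ge1$ with $a_n\le\kappa_0b_n$ for all $n\ge n_0$. *)

theory Defs
  imports
    "HOL-Probability.Probability"
    "Jordan_Normal_Form.Gauss_Jordan_Elimination"
    "Jordan_Normal_Form.Char_Poly"
begin

(* Matrices and vectors are those of Jordan_Normal_Form, because the dimensions vary along the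
   sequence of models. Rows and coordinates are indexed from 0. *)

subsection \<open>Linear algebra\<close>

definition l2_norm :: "real Matrix.vec \<Rightarrow> real" where
  "l2_norm v = sqrt (scalar_prod v v)"

definition op_norm :: "real mat \<Rightarrow> real" where
  "op_norm A = (SUP v \<in> {v \<in> carrier_vec (dim_col A). l2_norm v \<le> 1}. l2_norm (A *\<^sub>v v))"

(* Ordered eigenvalues with algebraic multiplicity, i = 1 being the largest. For a symmetric
   matrix all roots of the characteristic polynomial are real, so the list of real roots is
   complete; this is the only use made of the definition. *)
definition ord_eigenvalue :: "nat \<Rightarrow> real mat \<Rightarrow> real" where
  "ord_eigenvalue i A = rev (sorted_list_of_multiset (proots (char_poly A))) ! (i - 1)"

definition covariance_mat :: "nat \<Rightarrow> real mat \<Rightarrow> bool" where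
  "covariance_mat d S \<longleftrightarrow> S \<in> carrier_mat d d \<and> transpose_mat S = S \<and>
     (\<forall>a \<in> carrier_vec d. 0 \<le> scalar_prod a (S *\<^sub>v a))"

definition lesssim :: "(nat \<Rightarrow> real) \<Rightarrow> (nat \<Rightarrow> real) \<Rightarrow> bool" (infix "\<lesssim>" 50) where
  "a \<lesssim> b \<longleftrightarrow> (\<exists>\<kappa>\<^sub>0>0. \<exists>n\<^sub>0\<ge>1. \<forall>n\<ge>n\<^sub>0. a n \<le> \<kappa>\<^sub>0 * b n)"

subsection \<open>Random vectors and matrices\<close>

definition vec_borel :: "nat \<Rightarrow> real Matrix.vec measure" where
  "vec_borel d = vimage_algebra (carrier_vec d)
     (\<lambda>v. \<lambda>i\<in>{..<d}. vec_index v i) (PiM {..<d} (\<lambda>_. borel))"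

definition mat_borel :: "nat \<Rightarrow> nat \<Rightarrow> real mat measure" where
  "mat_borel n d = vimage_algebra (carrier_mat n d)
     (\<lambda>A. \<lambda>ij\<in>{..<n} \<times> {..<d}. A $$ ij) (PiM ({..<n} \<times> {..<d}) (\<lambda>_. borel))"

definition univ_normal :: "real \<Rightarrow> real \<Rightarrow> real measure" where
  "univ_normal m s2 =
     (if s2 = 0 then return borel m else density lborel (normal_density m (sqrt s2)))"

(* The law N(0, S): every linear functional is univariate normal with the matching variance. *)
definition centered_gaussian :: "nat \<Rightarrow> real mat \<Rightarrow> real Matrix.vec measure \<Rightarrow> bool" where
  "centered_gaussian d S \<mu> \<longleftrightarrow>
     covariance_mat d S \<and> prob_space \<mu> \<and> sets \<mu> = sets (vec_borel d) \<and>
     (\<forall>a \<in> carrier_vec d.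
        distr \<mu> borel (\<lambda>x. scalar_prod a x) = univ_normal 0 (scalar_prod a (S *\<^sub>v a)))"

(* The sub-sigma-algebra generated by Z, as a measure; only its sets matter. *)
definition sigma_gen :: "'w measure \<Rightarrow> 'b measure \<Rightarrow> ('w \<Rightarrow> 'b) \<Rightarrow> 'w measure" where
  "sigma_gen M N Z = vimage_algebra (space M) Z N"

(* K is a regular conditional distribution, given the sub-sigma-algebra F, of the real random
   variable U: a probability kernel from F whose value at each Borel set A is a version of
   P(U in A | F). *)
definition cond_law ::
    "'w measure \<Rightarrow> 'w measure \<Rightarrow> ('w \<Rightarrow> real) \<Rightarrow> ('w \<Rightarrow> real measure) \<Rightarrow> bool" where
  "cond_law M F U K \<longleftrightarrow>
     K \<in> measurable F (prob_algebra borel) \<and>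
     (\<forall>A \<in> sets borel. AE w in M.
        emeasure (K w) A = nn_cond_exp M F (indicator (U -` A \<inter> space M)) w)"

definition scale_law :: "real \<Rightarrow> real measure \<Rightarrow> real measure" where
  "scale_law a \<mu> = distr \<mu> borel (\<lambda>u. a * u)"

(* Squared Mallows metric, with values in [0, infinity]. It is lower semicontinuous for weak
   convergence, so composing it with probability kernels gives a measurable function; hence
   nn_cond_exp, which returns 0 for non-measurable arguments, is meaningful on it. *)
definition d2_sq :: "'a::euclidean_space measure \<Rightarrow> 'a measure \<Rightarrow> ennreal" where
  "d2_sq \<mu> \<nu> =
     (INF \<pi> \<in> {\<pi>. sets \<pi> = sets (borel \<Otimes>\<^sub>M borel) \<and> distr \<pi> borel fst = \<mu> \<and> distr \<pi> borel snd = \<nu>}.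
        \<integral>\<^sup>+ z. ennreal ((norm (fst z - snd z))\<^sup>2) \<partial>\<pi>)"

subsection \<open>Ridge regression and the residual bootstrap\<close>

(* (X^T X + r I)^(-1) X^T; the inverse exists whenever r > 0. *)
definition ridge_mat :: "real \<Rightarrow> real mat \<Rightarrow> real mat" where
  "ridge_mat r X =
     the (mat_inverse (transpose_mat X * X + r \<cdot>\<^sub>m 1\<^sub>m (dim_col X))) * transpose_mat X"

definition ridge_est :: "real \<Rightarrow> real mat \<Rightarrow> real Matrix.vec \<Rightarrow> real Matrix.vec" where
  "ridge_est r X Y = ridge_mat r X *\<^sub>v Y"

definition ridge_resid :: "real \<Rightarrow> real mat \<Rightarrow> real Matrix.vec \<Rightarrow> real Matrix.vec" where
  "ridge_resid r X Y = Y - X *\<^sub>v ridge_est r X Y"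

definition resid_law :: "real \<Rightarrow> real mat \<Rightarrow> real Matrix.vec \<Rightarrow> real measure" where
  "resid_law r X Y =
     (let n = dim_vec Y; e = ridge_resid r X Y; ebar = (\<Sum>i<n. vec_index e i) / real n
      in distr (uniform_count_measure {..<n}) borel (\<lambda>i. vec_index e i - ebar))"

(* Bootstrap law for a fixed design X and a fixed error distribution F. *)
definition Phi :: "real \<Rightarrow> real mat \<Rightarrow> real measure \<Rightarrow> real Matrix.vec \<Rightarrow> real measure" where
  "Phi r X F c =
     distr (PiM {..<dim_row X} (\<lambda>_. F)) borel
       (\<lambda>e. scalar_prod c (ridge_mat r X *\<^sub>v Matrix.vec (dim_row X) e))"

definition ridge_var :: "real \<Rightarrow> real \<Rightarrow> real mat \<Rightarrow> real Matrix.vec \<Rightarrow> real" where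
  "ridge_var sigma2 r X c = sigma2 * (l2_norm (transpose_mat (ridge_mat r X) *\<^sub>v c))\<^sup>2"

end

theory Submission
  imports Defs
    "Jordan_Normal_Form.Schur_Decomposition"
    "HOL-Real_Asymp.Real_Asymp"
begin

text \<open>Fix the sample size, let R be the inverse of X^T X + \<rho> I, and put w_ij = X_j \<bullet> R X_i. Along
the i-th row the ridge estimate errs by b_i + (\<Sum>j. w_ij \<epsilon>_j), where
b_i = - \<rho> (X_i \<bullet> R \<beta>) is the bias, and v_i = \<sigma>^2 (\<Sum>j. w_ij^2). The
bootstrap drops the bias and draws the \<epsilon>_j from the centred residuals. If every error is
coupled with a residual draw, independently over the coordinates, the second moments of the centred
differences add up, so the i-th rescaled squared distance is at most d^2 / \<sigma>^2 + b_i^2 / v_i,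
where d is the Mallows distance between F0 and the residual law (\<open>d2_sq_linear_statistic\<close>,
\<open>scaled_distance_le\<close>). The first term is the same for all i; the maximum concerns the
second one only.

The first term. On the line, the substitution of x \<bar>x\<bar> for x turns squared differences into
differences, and for those the quantile coupling costs the area between the two distribution functions
(\<open>d2_sq_le_cdf\<close>). The empirical distribution function of the true errors is within n^{-1/2}
of its limit in the mean at every point, and the fourth moment controls the area far out
(\<open>expected_cdf_distance\<close>). Passing from errors to residuals costs c times the mean square
of the errors and about 1 / c times the mean square of X (\<beta>' - \<beta>), for any small c, where
\<beta>' is the pilot estimate. The latter mean square is what the energy identity of the normal
equations bounds by \<sigma>^2 tr \<Sigma> / \<rho>' + \<rho>' \<parallel>\<beta>\<parallel>^2 / n in
the mean, \<rho>' being the pilot parameter (\<open>ridge_fit_error\<close>,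
\<open>resid_law_distance\<close>).

The second term is a property of the design alone. Let R_i be the inverse with the i-th row left out and
g = X_i \<bullet> R_i X_i. By the Sherman-Morrison formula (\<open>leave_one_out\<close>),
b_i = - \<rho> (X_i \<bullet> R_i \<beta>) / (1 + g) and w_ij = (X_j \<bullet> R_i X_i) / (1 + g), so
that 1 + g cancels in b_i^2 / v_i. Since X_i is Gaussian and independent of R_i, its projection on R_i
\<beta> is of the order of the \<Sigma>-norm of R_i \<beta>, up to a small power of n, for all i at
once. These norms are small on average: in the mean, the sum of their squares is at most
\<parallel>\<beta>\<parallel>^2 / \<rho>, because the fitted values X R \<beta> satisfy such a bound for
every design and the mean square of each entry is at least half of the corresponding mean
(\<open>loo_average\<close>). They are also all comparable with the \<Sigma>-norm of R \<beta>, since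
the removal of one row is a small perturbation as long as tr \<Sigma> is much smaller than \<rho>
(\<open>quad_leave_one_out\<close>). So each of them is of the order of the average.

The denominator \<parallel>X R_i X_i\<parallel>^2 is bounded from below by the Cauchy-Schwarz inequality
against X Q X_i, where Q is the inverse of \<Sigma> on the span of its first k eigenvectors. In the
inner product with X Q X_i, the normal equations produce q = X_i \<bullet> Q X_i, a chi-square variable
with k degrees of freedom, minus a ridge term that the leave-one-out estimates keep below q / 2; and the
squared length of X Q X_i, without its i-th entry, is at most of the order n q, up to a small power of
n. This gives b_i^2 / v_i a bound of the order \<rho> \<parallel>\<beta>\<parallel>^2 / k, up to a small
power of n (\<open>bias_le_fit_of_typical_design\<close>, \<open>bias_le_fit_prob\<close>). With
k = n^\<kappa> this tends to 0 if \<kappa> > 1 - \<gamma>, and the ridge term is negligible if \<kappa>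
\<eta> < \<gamma>. Both are possible exactly when \<gamma> > \<eta> / (1 + \<eta>).

The bound on the mean distance over the good designs becomes a bound in probability on the conditional
expectation by Markov's inequality, because the good designs form an event of the conditioning
\<sigma>-algebra (\<open>good_design_distance\<close>, \<open>nn_cond_exp_le_prob\<close>).\<close>

no_notation Finite_Cartesian_Product.vec_nth (infixl "$" 90)
no_notation inner (infix "\<bullet>" 70)

section \<open>Regularised normal equations and leaving out one row\<close>

definition dot :: "nat \<Rightarrow> (nat \<Rightarrow> real) \<Rightarrow> (nat \<Rightarrow> real) \<Rightarrow> real" where
  "dot p a b = (\<Sum>c<p. a c * b c)"

lemma dot_commute: "dot p a b = dot p b a"
  by (simp add: dot_def mult.commute)

lemma dot_diff_scaled: "dot p a (\<lambda>c. f c - k * g c) = dot p a f - k * dot p a g"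
  by (simp add: dot_def right_diff_distrib sum_subtractf sum_distrib_left mult_ac)

lemma dot_diff_scaled': "dot p (\<lambda>c. f c - k * g c) a = dot p f a - k * dot p g a"
  by (simp add: dot_commute[of p _ a] dot_diff_scaled)

lemma dot_diff: "dot p (\<lambda>c. f c - g c) a = dot p f a - dot p g a"
  using dot_diff_scaled'[of p f 1 g a] by simp

lemma dot_sum: "dot p (\<lambda>c. \<Sum>j\<in>J. k j * g j c) a = (\<Sum>j\<in>J. k j * dot p (g j) a)"
  unfolding dot_def sum_distrib_right sum_distrib_left
  by (subst sum.swap) (simp add: mult_ac)

lemma dot_self_nonneg: "0 \<le> dot p a a"
  by (auto simp: dot_def intro!: sum_nonneg)

lemma dot_cong: "(\<And>c. c < p \<Longrightarrow> a c = a' c) \<Longrightarrow> (\<And>c. c < p \<Longrightarrow> b c = b' c) \<Longrightarrow> dot p a b = dot p a' b'"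
  by (simp add: dot_def)

lemma dot_le_weighted:
  assumes "0 < r" shows "2 * dot p b y \<le> dot p b b / r + r * dot p y y"
proof -
  have "0 \<le> dot p (\<lambda>c. b c - r * y c) (\<lambda>c. b c - r * y c)" by (rule dot_self_nonneg)
  also have "\<dots> = dot p b b - 2 * r * dot p b y + r\<^sup>2 * dot p y y"
    by (simp add: dot_diff_scaled dot_diff_scaled' dot_commute[of p y b] power2_eq_square algebra_simps)
  finally have "2 * r * dot p b y \<le> dot p b b + r\<^sup>2 * dot p y y" by simp
  then show ?thesis using assms by (simp add: field_simps power2_eq_square)
qed

text \<open>The equations (\<Sum>j\<in>J. x_j x_j^T + r I) y = b in weak form, tested against every vector. Vectors
are functions on the indices, of which only the first p matter; the dimension varies with the sample
size, and carriers would be needed everywhere otherwise. Testing against a well-chosen vector is also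
how the equations are used.\<close>

definition solves ::
    "nat \<Rightarrow> real \<Rightarrow> (nat \<Rightarrow> nat \<Rightarrow> real) \<Rightarrow> nat set \<Rightarrow> (nat \<Rightarrow> real) \<Rightarrow> (nat \<Rightarrow> real) \<Rightarrow> bool" where
  "solves p r x J b y \<longleftrightarrow>
     (\<forall>a. (\<Sum>j\<in>J. dot p (x j) y * dot p (x j) a) + r * dot p y a = dot p b a)"

lemma solvesD: "solves p r x J b y \<Longrightarrow> (\<Sum>j\<in>J. dot p (x j) y * dot p (x j) a) + r * dot p y a = dot p b a"
  by (simp add: solves_def)

lemma solves_energy:
  assumes "solves p r x J b y"
  shows "(\<Sum>j\<in>J. (dot p (x j) y)\<^sup>2) + r * dot p y y = dot p b y"
  using solvesD[OF assms, of y] by (simp add: power2_eq_square)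

lemma solves_nonneg:
  assumes "solves p r x J b y" "0 < r" shows "0 \<le> dot p b y"
  by (metis solves_energy[OF assms(1)] add_nonneg_nonneg dot_self_nonneg assms(2) less_imp_le
      mult_nonneg_nonneg sum_nonneg zero_le_power2)

text \<open>The equations tested against y itself balance the energy of the fit against the product of b and y;
Young's inequality absorbs the penalty. There is no condition on the design.\<close>

lemma solves_fit_le:
  assumes "solves p r x J b y" "0 < r"
  shows "(\<Sum>j\<in>J. (dot p (x j) y)\<^sup>2) \<le> dot p b b / (2 * r)"
proof -
  have "2 * (\<Sum>j\<in>J. (dot p (x j) y)\<^sup>2) + r * dot p y y \<le> dot p b b / r"
    using solves_energy[OF assms(1)] dot_le_weighted[OF assms(2), of p b y] by linarith
  moreover have "0 \<le> r * dot p y y" using assms(2) dot_self_nonneg[of p y] by simp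
  ultimately have "2 * (\<Sum>j\<in>J. (dot p (x j) y)\<^sup>2) \<le> dot p b b / r" by linarith
  then show ?thesis by simp
qed

lemma solves_norm_le:
  assumes "solves p r x J b y" "0 < r"
  shows "dot p y y \<le> dot p b b / r\<^sup>2"
proof -
  have "0 \<le> (\<Sum>j\<in>J. (dot p (x j) y)\<^sup>2)" by (intro sum_nonneg) auto
  then have "r * dot p y y \<le> dot p b b / r"
    using solves_energy[OF assms(1)] dot_le_weighted[OF assms(2), of p b y] by linarith
  then show ?thesis using assms(2) by (simp add: field_simps power2_eq_square)
qed

text \<open>The solution operator is self-adjoint: each system is tested against the other's solution.\<close>

lemma solves_sym:
  assumes "solves p r x J b y" "solves p r x J b' y'"
  shows "dot p b y' = dot p b' y"
  using solvesD[OF assms(1), of y'] solvesD[OF assms(2), of y]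
  by (simp add: mult.commute dot_commute[of p y y'])

lemma solves_unique:
  assumes "solves p r x J b y" "solves p r x J b y'" "0 < r" "c < p"
  shows "y c = y' c"
proof -
  define d where "d = (\<lambda>c. y c - y' c)"
  have dd: "dot p a d = dot p a y - dot p a y'" for a
    using dot_diff_scaled[of p a y 1 y'] by (simp add: d_def)
  have dd': "dot p d a = dot p y a - dot p y' a" for a
    by (simp add: d_def dot_diff)
  have "(\<Sum>j\<in>J. (dot p (x j) d)\<^sup>2) + r * dot p d d = 0"
    using solvesD[OF assms(1), of d] solvesD[OF assms(2), of d]
    by (simp add: dd dd' power2_eq_square algebra_simps sum_subtractf sum.distrib dot_commute[of p y' y]
        flip: sum_distrib_left)
  moreover have "0 \<le> (\<Sum>j\<in>J. (dot p (x j) d)\<^sup>2)" by (intro sum_nonneg) auto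
  moreover have "0 \<le> r * dot p d d" using assms(3) dot_self_nonneg[of p d] by simp
  ultimately have "r * dot p d d = 0" by linarith
  then have "dot p d d = 0" using assms(3) by simp
  then have "d c * d c = 0" using assms(4) unfolding dot_def
    by (subst (asm) sum_nonneg_eq_0_iff) auto
  then show ?thesis by (simp add: d_def)
qed

text \<open>The solution operator, built by adding one row at a time with the Sherman-Morrison formula. This form
needs no inverse matrix and shows that solutions exist and depend measurably on the rows.\<close>

primrec resolvent ::
    "nat \<Rightarrow> real \<Rightarrow> (nat \<Rightarrow> nat \<Rightarrow> real) \<Rightarrow> nat list \<Rightarrow> (nat \<Rightarrow> real) \<Rightarrow> nat \<Rightarrow> real" where
  "resolvent p r x [] b = (\<lambda>c. b c / r)"
| "resolvent p r x (j # J) b = (\<lambda>c. resolvent p r x J b c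
     - dot p (x j) (resolvent p r x J b) / (1 + dot p (x j) (resolvent p r x J (x j)))
       * resolvent p r x J (x j) c)"

lemma resolvent_solves:
  assumes "distinct J" "0 < r"
  shows "solves p r x (set J) b (resolvent p r x J b)"
  using assms(1)
proof (induction J arbitrary: b)
  case Nil
  then show ?case using assms(2) by (simp add: solves_def dot_def sum_distrib_left)
next
  case (Cons j J)
  define y where "y = resolvent p r x J b"
  define z where "z = resolvent p r x J (x j)"
  define g where "g = dot p (x j) z"
  define t where "t = dot p (x j) y / (1 + g)"
  have y: "solves p r x (set J) b y" and z: "solves p r x (set J) (x j) z"
    using Cons by (auto simp: y_def z_def)
  have g: "0 \<le> g" unfolding g_def by (rule solves_nonneg[OF z assms(2)])
  have t: "dot p (x j) y - t * g = t" using g by (simp add: t_def field_simps)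
  have Y: "resolvent p r x (j # J) b = (\<lambda>c. y c - t * z c)"
    by (simp add: y_def z_def t_def g_def)
  show ?case unfolding solves_def
  proof
    fix a
    have "(\<Sum>i\<in>set J. dot p (x i) (\<lambda>c. y c - t * z c) * dot p (x i) a) + r * dot p (\<lambda>c. y c - t * z c) a
       = ((\<Sum>i\<in>set J. dot p (x i) y * dot p (x i) a) + r * dot p y a)
         - t * ((\<Sum>i\<in>set J. dot p (x i) z * dot p (x i) a) + r * dot p z a)"
      by (simp add: dot_diff_scaled dot_diff_scaled' algebra_simps sum_subtractf sum_distrib_left)
    also have "\<dots> = dot p b a - t * dot p (x j) a"
      by (simp only: solvesD[OF y] solvesD[OF z])
    finally have *: "(\<Sum>i\<in>set J. dot p (x i) (\<lambda>c. y c - t * z c) * dot p (x i) a)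
      + r * dot p (\<lambda>c. y c - t * z c) a = dot p b a - t * dot p (x j) a" .
    have "dot p (x j) (\<lambda>c. y c - t * z c) = t" using t by (simp add: dot_diff_scaled g_def)
    then show "(\<Sum>i\<in>set (j # J). dot p (x i) (resolvent p r x (j # J) b) * dot p (x i) a)
        + r * dot p (resolvent p r x (j # J) b) a = dot p b a"
      using * Cons.prems unfolding Y by simp
  qed
qed

lemma resolvent_cong:
  assumes "\<And>j c. j \<in> set J \<Longrightarrow> c < p \<Longrightarrow> x j c = x' j c" "\<And>c. c < p \<Longrightarrow> b c = b' c" "c < p"
  shows "resolvent p r x J b c = resolvent p r x' J b' c"
  using assms
proof (induction J arbitrary: b b' c)
  case (Cons j J)
  have 1: "resolvent p r x J b c = resolvent p r x' J b' c" if "c < p" for c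
    using Cons.prems that by (intro Cons.IH) auto
  have 2: "resolvent p r x J (x j) c = resolvent p r x' J (x' j) c" if "c < p" for c
    using Cons.prems that by (intro Cons.IH) auto
  have 3: "dot p (x j) (resolvent p r x J b) = dot p (x' j) (resolvent p r x' J b')"
    "dot p (x j) (resolvent p r x J (x j)) = dot p (x' j) (resolvent p r x' J (x' j))"
    using Cons.prems by (auto intro!: dot_cong 1 2)
  show ?case using Cons.prems by (simp add: 1 2 3)
qed auto

lemma measurable_dot [measurable (raw)]:
  assumes "\<And>c. c < p \<Longrightarrow> (\<lambda>w. a w c) \<in> borel_measurable N" "\<And>c. c < p \<Longrightarrow> (\<lambda>w. b w c) \<in> borel_measurable N"
  shows "(\<lambda>w. dot p (a w) (b w)) \<in> borel_measurable N"
  using assms unfolding dot_def by (intro borel_measurable_sum borel_measurable_times) auto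

lemma measurable_resolvent:
  assumes "\<And>j c. j \<in> set J \<Longrightarrow> c < p \<Longrightarrow> (\<lambda>w. x w j c) \<in> borel_measurable N"
    and "\<And>c. c < p \<Longrightarrow> (\<lambda>w. b w c) \<in> borel_measurable N" "c < p"
  shows "(\<lambda>w. resolvent p r (x w) J (b w) c) \<in> borel_measurable N"
  using assms
proof (induction J arbitrary: b c)
  case (Cons j J)
  have 1: "(\<lambda>w. resolvent p r (x w) J (b w) c) \<in> borel_measurable N" if "c < p" for c
    using Cons.prems that by (intro Cons.IH) auto
  have 2: "(\<lambda>w. resolvent p r (x w) J (x w j) c) \<in> borel_measurable N" if "c < p" for c
    using Cons.prems that by (intro Cons.IH) auto
  have 3: "(\<lambda>w. dot p (x w j) (resolvent p r (x w) J (b w))) \<in> borel_measurable N"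
    "(\<lambda>w. dot p (x w j) (resolvent p r (x w) J (x w j))) \<in> borel_measurable N"
    using Cons.prems by (auto intro!: measurable_dot 1 2)
  show ?case using 1[OF Cons.prems(3)] 2[OF Cons.prems(3)] 3 by simp
qed auto

text \<open>The Sherman-Morrison formula for solutions. In particular the fit at the row that has been left out is
only rescaled, by the factor 1 / (1 + g) with the leverage g = x_i \<bullet> z.\<close>

lemma leave_one_out:
  assumes Y: "solves p r x (insert i J) b Y" and y: "solves p r x J b y" and z: "solves p r x J (x i) z"
    and fin: "finite J" "i \<notin> J" and r: "0 < r"
  shows "dot p Y a = dot p y a - dot p (x i) y / (1 + dot p (x i) z) * dot p z a"
    and "dot p (x i) Y = dot p (x i) y / (1 + dot p (x i) z)"
    and "\<And>c. c < p \<Longrightarrow> Y c = y c - dot p (x i) y / (1 + dot p (x i) z) * z c"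
proof -
  define t where "t = dot p (x i) y / (1 + dot p (x i) z)"
  have g: "0 \<le> dot p (x i) z" by (rule solves_nonneg[OF z r])
  have t: "dot p (x i) y - t * dot p (x i) z = t" using g by (simp add: t_def field_simps)
  have "solves p r x (insert i J) b (\<lambda>c. y c - t * z c)" unfolding solves_def
  proof
    fix a
    have "(\<Sum>i\<in>J. dot p (x i) (\<lambda>c. y c - t * z c) * dot p (x i) a) + r * dot p (\<lambda>c. y c - t * z c) a
       = ((\<Sum>i\<in>J. dot p (x i) y * dot p (x i) a) + r * dot p y a)
         - t * ((\<Sum>i\<in>J. dot p (x i) z * dot p (x i) a) + r * dot p z a)"
      by (simp add: dot_diff_scaled dot_diff_scaled' algebra_simps sum_subtractf sum_distrib_left)
    also have "\<dots> = dot p b a - t * dot p (x i) a"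
      by (simp only: solvesD[OF y] solvesD[OF z])
    finally show "(\<Sum>i\<in>insert i J. dot p (x i) (\<lambda>c. y c - t * z c) * dot p (x i) a)
      + r * dot p (\<lambda>c. y c - t * z c) a = dot p b a"
      using fin t by (simp add: dot_diff_scaled)
  qed
  from solves_unique[OF Y this r] show *: "Y c = y c - t * z c" if "c < p" for c using that by blast
  have "dot p Y a = dot p (\<lambda>c. y c - t * z c) a" for a by (rule dot_cong) (auto simp: *)
  then show 1: "dot p Y a = dot p y a - t * dot p z a" for a by (simp add: dot_diff_scaled')
  show "dot p (x i) Y = t" using t 1[of "x i"] by (simp add: dot_commute)
qed

section \<open>Quadratic forms and typical designs\<close>

definition quad :: "nat \<Rightarrow> (nat \<Rightarrow> nat \<Rightarrow> real) \<Rightarrow> (nat \<Rightarrow> real) \<Rightarrow> real" where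
  "quad p S a = (\<Sum>c<p. \<Sum>d<p. a c * S c d * a d)"

lemma quad_cong: "(\<And>c. c < p \<Longrightarrow> a c = a' c) \<Longrightarrow> quad p S a = quad p S a'"
  by (simp add: quad_def)

lemma quad_scale: "quad p S (\<lambda>c. k * a c) = k\<^sup>2 * quad p S a"
  by (simp add: quad_def sum_distrib_left power2_eq_square mult_ac)

lemma quad_parallelogram:
  "quad p S (\<lambda>c. a c - b c) + quad p S (\<lambda>c. a c + b c) = 2 * quad p S a + 2 * quad p S b"
  unfolding quad_def sum_distrib_left sum.distrib[symmetric]
  by (intro sum.cong refl) (simp add: algebra_simps)

text \<open>The form on the plane of the coordinates c and d, evaluated at the vector (z_d, - z_c), bounds the
(c, d) term of the double sum by diagonal entries.\<close>

lemma quad_le_trace: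
  assumes psd: "\<And>a. 0 \<le> quad p S a" and sym: "\<And>c d. c < p \<Longrightarrow> d < p \<Longrightarrow> S c d = S d c"
  shows "quad p S z \<le> (\<Sum>c<p. S c c) * dot p z z"
proof -
  have pair: "2 * (z c * S c d * z d) \<le> (z d)\<^sup>2 * S c c + (z c)\<^sup>2 * S d d" if "c < p" "d < p" for c d
  proof (cases "c = d")
    case True then show ?thesis by (simp add: power2_eq_square mult_ac)
  next
    case False
    define a where "a = (\<lambda>i. if i = c then z d else if i = d then - z c else 0)"
    have "quad p S a = (\<Sum>i\<in>{c,d}. \<Sum>j\<in>{c,d}. a i * S i j * a j)"
      unfolding quad_def
      by (intro sum.mono_neutral_cong_right sum.mono_neutral_right) (use that in \<open>auto simp: a_def\<close>)
    also have "\<dots> = (z d)\<^sup>2 * S c c + (z c)\<^sup>2 * S d d - 2 * (z c * S c d * z d)"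
      using False sym[OF that] by (simp add: a_def power2_eq_square algebra_simps)
    finally show ?thesis using psd[of a] by simp
  qed
  have "2 * quad p S z = (\<Sum>c<p. \<Sum>d<p. 2 * (z c * S c d * z d))"
    by (simp add: quad_def sum_distrib_left)
  also have "\<dots> \<le> (\<Sum>c<p. \<Sum>d<p. (z d)\<^sup>2 * S c c + (z c)\<^sup>2 * S d d)"
    by (intro sum_mono pair) auto
  also have "\<dots> = 2 * ((\<Sum>c<p. S c c) * dot p z z)"
    unfolding sum.distrib dot_def sum_product
    by (subst (2) sum.swap) (simp add: power2_eq_square mult_ac)
  finally show ?thesis by simp
qed

text \<open>Restoring row i moves the solution by t z, where t is at most L times the S-norm of y, and the S-norm of
z is at most L tr S / r, because \<parallel>z\<parallel> \<le> \<parallel>x_i\<parallel> / r. So the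
displacement is at most half of y in the S-norm.\<close>

lemma quad_leave_one_out:
  assumes psd: "\<And>a. 0 \<le> quad p S a" and sym: "\<And>c d. c < p \<Longrightarrow> d < p \<Longrightarrow> S c d = S d c"
    and Y: "solves p r x (insert i J) b Y" and y: "solves p r x J b y" and z: "solves p r x J (x i) z"
    and fin: "finite J" "i \<notin> J" and r: "0 < r"
    and xx: "dot p (x i) (x i) \<le> L\<^sup>2 * (\<Sum>c<p. S c c)"
    and N: "(dot p (x i) y)\<^sup>2 \<le> L\<^sup>2 * quad p S y"
    and small: "L\<^sup>2 * (\<Sum>c<p. S c c) / r \<le> 1 / 2"
  shows "quad p S Y \<le> 3 * quad p S y" "quad p S y \<le> 4 * quad p S Y"
proof -
  define T where "T = (\<Sum>c<p. S c c)"
  define t where "t = dot p (x i) y / (1 + dot p (x i) z)"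
  have g: "0 \<le> dot p (x i) z" by (rule solves_nonneg[OF z r])
  have LT: "0 \<le> L\<^sup>2 * T" using xx dot_self_nonneg[of p "x i"] by (simp add: T_def)
  have "(L\<^sup>2 * T / r)\<^sup>2 \<le> (1/2)\<^sup>2"
    using small LT r by (intro power_mono) (simp_all add: T_def)
  then have half: "(L\<^sup>2 * T / r)\<^sup>2 \<le> 1/4" by (simp add: power2_eq_square)
  have t: "t\<^sup>2 \<le> L\<^sup>2 * quad p S y"
  proof -
    have "1 \<le> (1 + dot p (x i) z)\<^sup>2" using g by (intro one_le_power) auto
    then have "(dot p (x i) y)\<^sup>2 / (1 + dot p (x i) z)\<^sup>2 \<le> (dot p (x i) y)\<^sup>2 / 1"
      by (intro divide_left_mono) auto
    then have "t\<^sup>2 \<le> (dot p (x i) y)\<^sup>2" by (simp add: t_def power_divide)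
    then show ?thesis using N by simp
  qed
  have "quad p S z \<le> T * dot p z z" unfolding T_def by (rule quad_le_trace[OF psd sym])
  have "quad p S (\<lambda>c. t * z c) \<le> 1/4 * quad p S y"
  proof (cases "L = 0")
    case True
    then have "t\<^sup>2 = 0" using t by (simp add: order_antisym)
    then show ?thesis using psd[of y] by (simp add: quad_def)
  next
    case False
    then have T: "0 \<le> T" using LT by (simp add: zero_le_mult_iff)
    have "quad p S z \<le> T * (L\<^sup>2 * T / r\<^sup>2)"
    proof -
      have "dot p z z \<le> dot p (x i) (x i) / r\<^sup>2" by (rule solves_norm_le[OF z r])
      also have "\<dots> \<le> L\<^sup>2 * T / r\<^sup>2" using xx unfolding T_def by (intro divide_right_mono) auto
      finally have "T * dot p z z \<le> T * (L\<^sup>2 * T / r\<^sup>2)" using T by (intro mult_left_mono)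
      with \<open>quad p S z \<le> T * dot p z z\<close> show ?thesis by simp
    qed
    then have "t\<^sup>2 * quad p S z \<le> (L\<^sup>2 * quad p S y) * (T * (L\<^sup>2 * T / r\<^sup>2))"
      using t psd by (intro mult_mono) auto
    also have "\<dots> = (L\<^sup>2 * T / r)\<^sup>2 * quad p S y"
      by (simp add: power2_eq_square)
    also have "\<dots> \<le> 1/4 * quad p S y" using half psd by (intro mult_right_mono)
    finally show ?thesis by (simp add: quad_scale)
  qed
  note tz = this
  have Yc: "quad p S Y = quad p S (\<lambda>c. y c - t * z c)"
    using leave_one_out(3)[OF Y y z fin r] by (intro quad_cong) (simp add: t_def)
  have "quad p S Y \<le> 2 * quad p S y + 2 * quad p S (\<lambda>c. t * z c)"
    using quad_parallelogram[of p S y "\<lambda>c. t * z c"] psd[of "\<lambda>c. y c + t * z c"] Yc by simp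
  then show "quad p S Y \<le> 3 * quad p S y" using tz psd[of y] by linarith
  have "quad p S y = quad p S (\<lambda>c. (y c - t * z c) + t * z c)" by simp
  also have "\<dots> \<le> 2 * quad p S Y + 2 * quad p S (\<lambda>c. t * z c)"
    using quad_parallelogram[of p S "\<lambda>c. y c - t * z c" "\<lambda>c. t * z c"]
      psd[of "\<lambda>c. (y c - t * z c) - t * z c"] Yc by simp
  finally show "quad p S y \<le> 4 * quad p S Y" using tz by linarith
qed

text \<open>The deterministic part of the bound on the bias. The hypotheses list what holds for most Gaussian
designs: no row is too large, each row has moderate projections on vectors that do not depend on it, the
first k whitened coordinates of each row have total energy at least k / 4, and the leave-one-out
solutions are small on average over the rows. The vectors v_j span the whitened directions and Q i is
the fitted direction against which the denominator is tested. The constant 192 is 12 * 16: the factor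
12 = 3 * 4 comes from comparing one leave-one-out solution with the average of all, and 16 from q / 2
and k / 4 in the denominator.\<close>

lemma bias_le_fit_of_typical_design:
  fixes n p k :: nat and x :: "nat \<Rightarrow> nat \<Rightarrow> real" and v :: "nat \<Rightarrow> nat \<Rightarrow> real"
  defines "q \<equiv> \<lambda>i. \<Sum>j<k. (dot p (v j) (x i))\<^sup>2"
    and "Q \<equiv> \<lambda>i c. \<Sum>j<k. dot p (v j) (x i) * v j c"
  assumes psd: "\<And>a. 0 \<le> quad p S a" and sym: "\<And>c d. c < p \<Longrightarrow> d < p \<Longrightarrow> S c d = S d c"
    and r: "0 < r" and L: "0 < L" and k: "0 < k"
    and Y: "\<And>b. solves p r x {..<n} b (Y b)"
    and y: "\<And>i b. i < n \<Longrightarrow> solves p r x ({..<n} - {i}) b (y i b)"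
    and norm: "\<And>i. i < n \<Longrightarrow> dot p (x i) (x i) \<le> L\<^sup>2 * (\<Sum>c<p. S c c)"
    and loo: "\<And>i b. i < n \<Longrightarrow> b \<in> insert \<beta> (v ` {..<k}) \<Longrightarrow> (dot p (x i) (y i b))\<^sup>2 \<le> L\<^sup>2 * quad p S (y i b)"
    and cross: "\<And>i l. i < n \<Longrightarrow> l < n \<Longrightarrow> l \<noteq> i \<Longrightarrow> (dot p (x l) (Q i))\<^sup>2 \<le> L\<^sup>2 * q i"
    and chi: "\<And>i. i < n \<Longrightarrow> real k / 4 \<le> q i"
    and avg0: "(\<Sum>i<n. quad p S (y i \<beta>)) \<le> real n * B0"
    and avg1: "(\<Sum>i<n. \<Sum>j<k. quad p S (y i (v j))) \<le> real n * B1"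
    and small: "L\<^sup>2 * (\<Sum>c<p. S c c) / r \<le> 1 / 2" "48 * L\<^sup>2 * r\<^sup>2 * B1 \<le> real k / 4"
    and i: "i < n"
  shows "0 < (\<Sum>l<n. (dot p (x l) (Y (x i)))\<^sup>2)"
    and "(r * dot p (x i) (Y \<beta>))\<^sup>2 \<le> 192 * real n * L^4 * r\<^sup>2 * B0 / real k * (\<Sum>l<n. (dot p (x l) (Y (x i)))\<^sup>2)"
proof -
  have ins: "insert l ({..<n} - {l}) = {..<n}" if "l < n" for l using that by auto
  have fin: "finite ({..<n} - {l})" "l \<notin> {..<n} - {l}" for l by auto
  have n: "0 < real n" using i by simp
  have cmp: "quad p S (Y b) \<le> 3 * quad p S (y l b)" "quad p S (y l b) \<le> 4 * quad p S (Y b)"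
    if "l < n" "b \<in> insert \<beta> (v ` {..<k})" for l b
    using quad_leave_one_out[OF psd sym _ y[OF that(1)] y[OF that(1)] fin r norm[OF that(1)] loo[OF that] small(1),
        unfolded ins[OF that(1)], OF _ _ Y] by simp_all
  have avg: "real n * quad p S (y i b) \<le> 12 * (\<Sum>l<n. quad p S (y l b))" if b: "b \<in> insert \<beta> (v ` {..<k})" for b
  proof -
    have "real n * quad p S (y i b) \<le> real n * (4 * quad p S (Y b))"
      using cmp(2)[OF i b] by (intro mult_left_mono) auto
    also have "\<dots> = 4 * (\<Sum>l<n. quad p S (Y b))" by simp
    also have "\<dots> \<le> 4 * (\<Sum>l<n. 3 * quad p S (y l b))"
      using b by (intro mult_left_mono sum_mono cmp(1)) auto
    finally show ?thesis by (simp add: sum_distrib_left)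
  qed
  define g where "g = dot p (x i) (y i (x i))"
  define z where "z = y i (x i)"
  have g: "0 \<le> g" unfolding g_def by (rule solves_nonneg[OF y[OF i] r])
  note loo1 = leave_one_out[OF _ y[OF i] y[OF i] fin r, unfolded ins[OF i], OF Y, folded g_def]
  \<comment> \<open>All leave-one-out forms are comparable with the full one, so the bound on their average holds for each.\<close>
  have num: "(dot p (x i) (y i \<beta>))\<^sup>2 \<le> 12 * L\<^sup>2 * B0"
  proof -
    have "real n * quad p S (y i \<beta>) \<le> real n * (12 * B0)" using avg[of \<beta>] avg0 by simp
    then have "quad p S (y i \<beta>) \<le> 12 * B0" using n by (simp add: mult_le_cancel_left)
    then have "L\<^sup>2 * quad p S (y i \<beta>) \<le> L\<^sup>2 * (12 * B0)" by (intro mult_left_mono) auto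
    with loo[OF i, of \<beta>] show ?thesis by simp
  qed
  \<comment> \<open>The ridge term of the denominator. By symmetry of the solution operator it involves the solutions for v j.\<close>
  define s where "s = r * (\<Sum>j<k. dot p (v j) (x i) * dot p (x i) (y i (v j)))"
  have k4: "0 < real k / 4" using k by simp
  have qi: "0 < q i" using chi[OF i] k4 by linarith
  have V: "(\<Sum>j<k. (dot p (x i) (y i (v j)))\<^sup>2) \<le> 12 * L\<^sup>2 * B1"
  proof -
    have "real n * (\<Sum>j<k. quad p S (y i (v j))) \<le> 12 * (\<Sum>j<k. \<Sum>l<n. quad p S (y l (v j)))"
      unfolding sum_distrib_left using avg by (intro sum_mono) (auto simp: sum_distrib_left)
    also have "(\<Sum>j<k. \<Sum>l<n. quad p S (y l (v j))) = (\<Sum>l<n. \<Sum>j<k. quad p S (y l (v j)))" by (rule sum.swap)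
    finally have "real n * (\<Sum>j<k. quad p S (y i (v j))) \<le> real n * (12 * B1)" using avg1 by simp
    then have "(\<Sum>j<k. quad p S (y i (v j))) \<le> 12 * B1" using n by (simp add: mult_le_cancel_left)
    then have "L\<^sup>2 * (\<Sum>j<k. quad p S (y i (v j))) \<le> L\<^sup>2 * (12 * B1)" by (intro mult_left_mono) auto
    moreover have "(\<Sum>j<k. (dot p (x i) (y i (v j)))\<^sup>2) \<le> (\<Sum>j<k. L\<^sup>2 * quad p S (y i (v j)))"
      using loo[OF i] by (intro sum_mono) auto
    ultimately show ?thesis by (simp add: sum_distrib_left)
  qed
  have "s\<^sup>2 \<le> (q i / 2)\<^sup>2"
  proof -
    have "s\<^sup>2 = r\<^sup>2 * (\<Sum>j<k. dot p (v j) (x i) * dot p (x i) (y i (v j)))\<^sup>2" by (simp add: s_def power_mult_distrib)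
    also have "\<dots> \<le> r\<^sup>2 * (q i * (\<Sum>j<k. (dot p (x i) (y i (v j)))\<^sup>2))"
      unfolding q_def by (intro mult_left_mono Cauchy_Schwarz_ineq_sum) auto
    also have "\<dots> \<le> r\<^sup>2 * (q i * (12 * L\<^sup>2 * B1))"
      using V qi by (intro mult_left_mono) auto
    also have "\<dots> = q i * (48 * L\<^sup>2 * r\<^sup>2 * B1) / 4" by simp
    also have "\<dots> \<le> q i * q i / 4"
      using small(2) chi[OF i] qi by (intro divide_right_mono mult_left_mono) auto
    finally show ?thesis by (simp add: power2_eq_square)
  qed
  then have s: "s \<le> q i / 2" by (rule power2_le_imp_le) (use qi in auto)
  \<comment> \<open>The leave-one-out equations tested against Q i: the energy q i, less the ridge term s.\<close>
  have u: "(\<Sum>l\<in>{..<n}-{i}. dot p (x l) z * dot p (x l) (Q i)) = q i - s"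
  proof -
    have "(\<Sum>l\<in>{..<n}-{i}. dot p (x l) z * dot p (x l) (Q i)) + r * dot p z (Q i) = dot p (x i) (Q i)"
      unfolding z_def by (rule solvesD[OF y[OF i]])
    moreover have "dot p (x i) (Q i) = q i"
      unfolding Q_def by (subst dot_commute) (simp add: dot_sum q_def power2_eq_square)
    moreover have "r * dot p z (Q i) = s"
      unfolding Q_def s_def z_def
      by (subst dot_commute) (simp add: dot_sum solves_sym[OF y[OF i] y[OF i]])
    ultimately show ?thesis by linarith
  qed
  define D where "D = (\<Sum>l<n. (dot p (x l) z)\<^sup>2)"
  have D: "q i / (4 * real n * L\<^sup>2) \<le> D"
  proof -
    have "(q i / 2)\<^sup>2 \<le> (q i - s)\<^sup>2" using s qi by (intro power_mono) auto
    also have "\<dots> \<le> (\<Sum>l\<in>{..<n}-{i}. (dot p (x l) z)\<^sup>2) * (\<Sum>l\<in>{..<n}-{i}. (dot p (x l) (Q i))\<^sup>2)"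
      unfolding u[symmetric] by (rule Cauchy_Schwarz_ineq_sum)
    also have "\<dots> \<le> D * (\<Sum>l<n. L\<^sup>2 * q i)"
    proof (rule mult_mono)
      show "(\<Sum>l\<in>{..<n}-{i}. (dot p (x l) z)\<^sup>2) \<le> D" unfolding D_def by (rule sum_mono2) auto
      have "(\<Sum>l\<in>{..<n}-{i}. (dot p (x l) (Q i))\<^sup>2) \<le> (\<Sum>l\<in>{..<n}-{i}. L\<^sup>2 * q i)"
        using cross[OF i] by (intro sum_mono) auto
      also have "\<dots> \<le> (\<Sum>l<n. L\<^sup>2 * q i)" using qi by (intro sum_mono2) auto
      finally show "(\<Sum>l\<in>{..<n}-{i}. (dot p (x l) (Q i))\<^sup>2) \<le> (\<Sum>l<n. L\<^sup>2 * q i)" .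
    qed (auto simp: D_def intro!: sum_nonneg)
    finally have "q i * q i \<le> q i * (D * (4 * real n * L\<^sup>2))" by (simp add: power2_eq_square algebra_simps)
    then have "q i \<le> D * (4 * real n * L\<^sup>2)" using qi by (simp add: mult_le_cancel_left)
    then show ?thesis using n L by (simp add: divide_le_eq)
  qed
  have Dk: "real k \<le> D * (16 * real n * L\<^sup>2)"
    using D chi[OF i] n L by (simp add: divide_le_eq)
  \<comment> \<open>Restoring row i divides both the fit and the bias by 1 + g, which cancels in their quotient.\<close>
  have fit: "(\<Sum>l<n. (dot p (x l) (Y (x i)))\<^sup>2) = D / (1 + g)\<^sup>2"
  proof -
    have "dot p (x l) (Y (x i)) = dot p (x l) z / (1 + g)" for l
    proof -
      have "dot p (Y (x i)) (x l) = dot p z (x l) - g / (1 + g) * dot p z (x l)"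
        using loo1(1)[of "x i" "x l"] by (simp add: z_def g_def)
      also have "\<dots> = dot p z (x l) / (1 + g)" using g by (simp add: field_simps)
      finally show ?thesis by (simp add: dot_commute)
    qed
    then show ?thesis unfolding D_def by (simp add: power_divide sum_divide_distrib)
  qed
  have bias: "(r * dot p (x i) (Y \<beta>))\<^sup>2 = r\<^sup>2 * (dot p (x i) (y i \<beta>))\<^sup>2 / (1 + g)\<^sup>2"
    using loo1(2)[of \<beta>] by (simp add: power_divide power_mult_distrib)
  have "0 < D" by (rule less_le_trans[OF _ D]) (use qi n L in simp)
  then show "0 < (\<Sum>l<n. (dot p (x l) (Y (x i)))\<^sup>2)" unfolding fit using g by simp
  have B0: "0 \<le> 12 * L\<^sup>2 * B0" by (rule order_trans[OF zero_le_power2 num])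
  have B0': "0 \<le> r\<^sup>2 * (12 * L\<^sup>2 * B0) / real k"
    by (rule divide_nonneg_nonneg[OF mult_nonneg_nonneg[OF zero_le_power2 B0]]) simp
  have "r\<^sup>2 * (dot p (x i) (y i \<beta>))\<^sup>2 \<le> r\<^sup>2 * (12 * L\<^sup>2 * B0)"
    using num by (intro mult_left_mono) auto
  also have "\<dots> = r\<^sup>2 * (12 * L\<^sup>2 * B0) / real k * real k" using k by simp
  also have "\<dots> \<le> r\<^sup>2 * (12 * L\<^sup>2 * B0) / real k * (D * (16 * real n * L\<^sup>2))"
    by (rule mult_left_mono[OF Dk B0'])
  also have "\<dots> = 192 * real n * L^4 * r\<^sup>2 * B0 / real k * D"
    by (simp add: power4_eq_xxxx power2_eq_square)
  finally have "r\<^sup>2 * (dot p (x i) (y i \<beta>))\<^sup>2 / (1+g)\<^sup>2 \<le> 192 * real n * L^4 * r\<^sup>2 * B0 / real k * D / (1+g)\<^sup>2"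
    by (intro divide_right_mono) auto
  then show "(r * dot p (x i) (Y \<beta>))\<^sup>2 \<le> 192 * real n * L^4 * r\<^sup>2 * B0 / real k * (\<Sum>l<n. (dot p (x l) (Y (x i)))\<^sup>2)"
    unfolding bias fit by simp
qed

section \<open>Symmetric real matrices\<close>

text \<open>Over the complex numbers the polynomial splits. For an eigenvector v the number v* A v is its own
conjugate, since A is real and symmetric, and it equals the eigenvalue times \<parallel>v\<parallel>^2;
so all roots are real.\<close>

lemma real_symmetric_char_poly_splits:
  fixes A :: "real mat"
  assumes A: "A \<in> carrier_mat n n" and sym: "transpose_mat A = A"
  shows "\<exists>es. char_poly A = (\<Prod>e\<leftarrow>es. [:- e, 1:]) \<and> length es = n"
proof -
  define C where "C = map_mat complex_of_real A"
  have C: "C \<in> carrier_mat n n" using A by (simp add: C_def)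
  obtain as where as: "char_poly C = (\<Prod>a\<leftarrow>as. [:- a, 1:])" "length as = n"
    using char_poly_factorized[OF C] by blast
  have real: "a = complex_of_real (Re a)" if "a \<in> set as" for a
  proof -
    have "poly (char_poly C) a = 0"
      using that by (auto simp: as poly_prod_list prod_list_zero_iff)
    then have "eigenvalue C a" using eigenvalue_root_char_poly[OF C] by simp
    then obtain v where v: "v \<in> carrier_vec n" "v \<noteq> 0\<^sub>v n" "C *\<^sub>v v = a \<cdot>\<^sub>v v"
      using C unfolding eigenvalue_def eigenvector_def by auto
    define s where "s = (\<Sum>i<n. \<Sum>j<n. cnj (v$i) * of_real (A $$ (i,j)) * v$j)"
    have Aij: "A $$ (i,j) = A $$ (j,i)" if "i < n" "j < n" for i j
      using sym A that by (metis carrier_matD index_transpose_mat(1))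
    have "cnj s = (\<Sum>i<n. \<Sum>j<n. v$i * of_real (A $$ (i,j)) * cnj (v$j))"
      by (simp add: s_def)
    also have "\<dots> = (\<Sum>j<n. \<Sum>i<n. v$i * of_real (A $$ (i,j)) * cnj (v$j))"
      by (rule sum.swap)
    also have "\<dots> = s" unfolding s_def
      by (intro sum.cong refl) (auto simp: Aij mult_ac)
    finally have s_real: "cnj s = s" .
    have row: "(\<Sum>j<n. of_real (A $$ (i,j)) * v$j) = a * v$i" if "i < n" for i
    proof -
      have "(\<Sum>j<n. of_real (A $$ (i,j)) * v$j) = (C *\<^sub>v v) $ i"
        using that C v(1) A unfolding C_def
        by (auto simp: scalar_prod_def intro!: sum.cong)
      then show ?thesis using v that by simp
    qed
    have "s = (\<Sum>i<n. cnj (v$i) * (\<Sum>j<n. of_real (A $$ (i,j)) * v$j))"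
      by (simp add: s_def sum_distrib_left mult_ac)
    also have "\<dots> = (\<Sum>i<n. cnj (v$i) * (a * v$i))" by (intro sum.cong) (auto simp: row)
    also have "\<dots> = a * of_real (\<Sum>i<n. (cmod (v$i))^2)"
      by (simp add: sum_distrib_left complex_norm_square mult_ac del: of_real_power)
    finally have s: "s = a * of_real (\<Sum>i<n. (cmod (v$i))^2)" .
    have "(\<Sum>i<n. (cmod (v$i))^2) \<noteq> 0"
    proof
      assume "(\<Sum>i<n. (cmod (v$i))^2) = 0"
      then have "\<And>i. i < n \<Longrightarrow> v$i = 0" by (subst (asm) sum_nonneg_eq_0_iff) auto
      then have "v = 0\<^sub>v n" using v by (intro eq_vecI) auto
      with v show False by simp
    qed
    then have "complex_of_real (\<Sum>i<n. (cmod (v$i))^2) \<noteq> 0" by (simp only: of_real_eq_0_iff not_False_eq_True)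
    then have "cnj a = a" using s_real unfolding s by (simp del: of_real_sum)
    then show ?thesis by (metis Reals_cnj_iff of_real_Re)
  qed
  define es where "es = map Re as"
  have as_es: "as = map complex_of_real es"
    using real by (simp add: es_def list_eq_iff_nth_eq)
  interpret mp: map_poly_inj_idom_hom complex_of_real ..
  have "map_poly complex_of_real (char_poly A) = char_poly C"
    unfolding C_def by (rule of_real_hom.char_poly_hom[OF A, symmetric])
  also have "\<dots> = map_poly complex_of_real (\<Prod>e\<leftarrow>es. [:- e, 1:])"
    by (simp add: as as_es mp.hom_prod_list o_def)
  finally have "char_poly A = (\<Prod>e\<leftarrow>es. [:- e, 1:])" by (rule mp.injectivity)
  then show ?thesis using as by (auto simp: es_def intro!: exI[of _ es])
qed

text \<open>Deflation: complete an eigenvector to an orthonormal basis; by symmetry the first row and column of the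
conjugated matrix vanish off the diagonal, and the remaining block has the remaining roots.\<close>

lemma orthogonal_diagonalization:
  fixes A :: "real mat"
  assumes "A \<in> carrier_mat n n" "transpose_mat A = A" "char_poly A = (\<Prod>e\<leftarrow>es. [:- e, 1:])"
  shows "\<exists>U\<in>carrier_mat n n. transpose_mat U * U = 1\<^sub>m n
           \<and> transpose_mat U * A * U = mat_diag n (\<lambda>i. es ! i)"
  using assms
proof (induction es arbitrary: n A)
  case Nil
  with degree_monic_char_poly[of A n] have "n = 0" by auto
  then show ?case using Nil by (intro bexI[of _ "1\<^sub>m n"]) (auto simp: mat_diag_def)
next
  case (Cons e es n A)
  have cp: "char_poly A = [:-e,1:] * (\<Prod>e\<leftarrow>es. [:- e, 1:])" using Cons by simp
  have mon: "monic (\<Prod>e\<leftarrow> es. [:- e, 1:])" by (rule monic_prod_list) auto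
  then have "(\<Prod>e\<leftarrow> es. [:- e, 1:]) \<noteq> 0" by auto
  then have "degree (char_poly A) = Suc (degree (\<Prod>e\<leftarrow>es. [:- e, 1:]))"
    unfolding cp by (subst degree_mult_eq) auto
  then obtain m where n: "n = Suc m" using degree_monic_char_poly[OF Cons.prems(1)] by (cases n) auto
  have A: "A \<in> carrier_mat n n" by fact
  have "eigenvalue A e" unfolding eigenvalue_root_char_poly[OF A] cp by simp
  then obtain v where v: "v \<in> carrier_vec n" "v \<noteq> 0\<^sub>v n" "A *\<^sub>v v = e \<cdot>\<^sub>v v"
    using A unfolding eigenvalue_def eigenvector_def by auto
  interpret cof_vec_space n "TYPE(real)" .
  define b where "b = basis_completion v"
  define ws where "ws = gram_schmidt n b"
  note bc = basis_completion[OF v(1,2), folded b_def]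
  obtain vs where bv: "b = v # vs" using bc(6,7) n by (cases b) auto
  note gs = gram_schmidt_result[OF bc(2,4,5) ws_def]
  have len: "length ws = n" using gs(4) bc(6) by simp
  have hd: "ws ! 0 = v"
    using gram_schmidt_hd[OF v(1), of vs, folded bv] len n unfolding ws_def[symmetric]
    by (simp add: hd_conv_nth[symmetric] flip: length_greater_0_conv)
  have wc: "ws ! i \<in> carrier_vec n" if "i < n" for i using gs(3) len that by auto
  have orth: "ws ! i \<bullet> ws ! j = 0 \<longleftrightarrow> i \<noteq> j" if "i < n" "j < n" for i j
    using corthogonalD[OF gs(2)] that len by simp
  have pos: "0 < ws ! i \<bullet> ws ! i" if "i < n" for i
  proof -
    have "0 \<le> ws ! i \<bullet> ws ! i" by (auto simp: scalar_prod_def intro!: sum_nonneg)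
    then show ?thesis using orth[OF that that] by (simp add: less_le)
  qed
  \<comment> \<open>An orthonormal basis whose first vector is the normalised eigenvector.\<close>
  define W where "W = mat n n (\<lambda>(i,j). ws ! j $ i / sqrt (ws ! j \<bullet> ws ! j))"
  have W: "W \<in> carrier_mat n n" by (simp add: W_def)
  have colW: "col W j = (1 / sqrt (ws ! j \<bullet> ws ! j)) \<cdot>\<^sub>v (ws ! j)" if "j < n" for j
    using that wc[OF that] by (intro eq_vecI) (auto simp: W_def)
  have WtW: "transpose_mat W * W = 1\<^sub>m n"
  proof (rule eq_matI)
    fix i j assume "i < dim_row (1\<^sub>m n :: real mat)" "j < dim_col (1\<^sub>m n :: real mat)"
    then have ij: "i < n" "j < n" by auto
    have "(transpose_mat W * W) $$ (i,j) = col W i \<bullet> col W j" using ij W by simp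
    also have "\<dots> = (ws!i \<bullet> ws!j) / (sqrt (ws ! i \<bullet> ws ! i) * sqrt (ws ! j \<bullet> ws ! j))"
      using wc[OF ij(1)] wc[OF ij(2)] by (simp add: colW ij)
    also have "\<dots> = 1\<^sub>m n $$ (i,j)"
      using ij orth[OF ij] pos[OF ij(1)] by (cases "i = j") auto
    finally show "(transpose_mat W * W) $$ (i,j) = 1\<^sub>m n $$ (i,j)" .
  qed (use W in auto)
  have Wt: "transpose_mat W \<in> carrier_mat n n" using W by simp
  have WWt: "W * transpose_mat W = 1\<^sub>m n" by (rule mat_mult_left_right_inverse[OF Wt W WtW])
  define A' where "A' = transpose_mat W * A * W"
  have A': "A' \<in> carrier_mat n n" using W A by (simp add: A'_def)
  have symA': "transpose_mat A' = A'"
  proof -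
    have "transpose_mat A' = transpose_mat W * (transpose_mat A * W)"
      using W A unfolding A'_def
      by (subst transpose_mult[of _ n n _ n], auto) (subst transpose_mult[of _ n n _ n], auto)
    then show ?thesis using W A Cons.prems(2) unfolding A'_def by (simp add: assoc_mult_mat[of _ n n _ n _ n])
  qed
  have A'0: "A' $$ (i,0) = (if i = 0 then e else 0)" if "i < n" for i
  proof -
    have "A' = transpose_mat W * (A * W)" using W A unfolding A'_def by (simp add: assoc_mult_mat[of _ n n _ n _ n])
    then have "A' $$ (i,0) = col W i \<bullet> (A *\<^sub>v col W 0)"
      using that W A n by (simp add: mult_mat_vec_def col_mult2[of A n n W n])
    also have "A *\<^sub>v col W 0 = e \<cdot>\<^sub>v col W 0"
      using v A n hd by (simp add: colW mult_mat_vec smult_smult_assoc mult.commute)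
    also have "col W i \<bullet> (e \<cdot>\<^sub>v col W 0) = e * (transpose_mat W * W) $$ (i,0)"
      using W that n by simp
    finally show ?thesis using that n by (simp add: WtW)
  qed
  define A3 where "A3 = mat m m (\<lambda>(i,j). A' $$ (Suc i, Suc j))"
  have A3: "A3 \<in> carrier_mat m m" by (simp add: A3_def)
  have A'sym: "A' $$ (i,j) = A' $$ (j,i)" if "i < n" "j < n" for i j
    using symA' A' that by (metis carrier_matD index_transpose_mat(1))
  have block: "A' = four_block_mat (mat 1 1 (\<lambda>_. e)) (0\<^sub>m 1 m) (0\<^sub>m m 1) A3"
  proof (rule eq_matI)
    fix i j assume "i < dim_row (four_block_mat (mat 1 1 (\<lambda>_. e)) (0\<^sub>m 1 m) (0\<^sub>m m 1) A3)"
      "j < dim_col (four_block_mat (mat 1 1 (\<lambda>_. e)) (0\<^sub>m 1 m) (0\<^sub>m m 1) A3)"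
    then have ij: "i < n" "j < n" using n A3 by auto
    show "A' $$ (i, j) = four_block_mat (mat 1 1 (\<lambda>_. e)) (0\<^sub>m 1 m) (0\<^sub>m m 1) A3 $$ (i, j)"
      using ij A'0[of i] A'0[of j] A'sym[of 0 j] n A3
      by (cases i; cases j) (auto simp: A3_def)
  qed (use A' A3 n in auto)
  have "similar_mat_wit A' A (transpose_mat W) W"
    using W A A' WtW WWt by (intro similar_mat_witI[of _ _ n]) (auto simp: A'_def)
  then have "char_poly A' = char_poly A"
    using char_poly_similar unfolding similar_mat_def by blast
  moreover have "char_poly A' = char_poly (mat 1 1 (\<lambda>_. e)) * char_poly A3"
    unfolding block by (rule char_poly_four_block_zeros_col[OF _ _ A3]) auto
  moreover have "char_poly (mat 1 1 (\<lambda>_. e)) = [:-e,1:]"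
    by (simp add: char_poly_defs det_def sign_def)
  ultimately have "[:-e,1:] * char_poly A3 = [:-e,1:] * (\<Prod>e\<leftarrow>es. [:- e, 1:])" using cp by simp
  then have cp3: "char_poly A3 = (\<Prod>e\<leftarrow>es. [:- e, 1:])"
    by (metis mult_cancel_left pCons_eq_0_iff zero_neq_one)
  have sym3: "transpose_mat A3 = A3" using A'sym n by (intro eq_matI) (auto simp: A3_def)
  obtain U3 where U3: "U3 \<in> carrier_mat m m" "transpose_mat U3 * U3 = 1\<^sub>m m"
      "transpose_mat U3 * A3 * U3 = mat_diag m (\<lambda>i. es ! i)"
    using Cons.IH[OF A3 sym3 cp3] by blast
  define P where "P = four_block_mat (1\<^sub>m 1) (0\<^sub>m 1 m) (0\<^sub>m m 1) U3"
  have P: "P \<in> carrier_mat n n" using U3 n unfolding P_def by auto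
  have Pt: "transpose_mat P = four_block_mat (1\<^sub>m 1) (0\<^sub>m 1 m) (0\<^sub>m m 1) (transpose_mat U3)"
    unfolding P_def using U3 by (subst transpose_four_block_mat[of _ 1 1 _ m _ m]) auto
  have PtP: "transpose_mat P * P = 1\<^sub>m n"
    unfolding Pt unfolding P_def n using U3
    by (subst mult_four_block_mat[of _ 1 1 _ m _ m _ _ 1 _ m]) (auto intro!: eq_matI)
  have PAP: "transpose_mat P * A' * P = mat_diag n (\<lambda>i. (e # es) ! i)"
  proof -
    have "transpose_mat P * A' = four_block_mat (mat 1 1 (\<lambda>_. e)) (0\<^sub>m 1 m) (0\<^sub>m m 1) (transpose_mat U3 * A3)"
      unfolding Pt block using U3 A3
      by (subst mult_four_block_mat[of _ 1 1 _ m _ m _ _ 1 _ m]) auto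
    then have "transpose_mat P * A' * P = four_block_mat (mat 1 1 (\<lambda>_. e)) (0\<^sub>m 1 m) (0\<^sub>m m 1) (transpose_mat U3 * A3 * U3)"
      unfolding P_def using U3 A3
      by (simp, subst mult_four_block_mat[of _ 1 1 _ m _ m _ _ 1 _ m]) auto
    also have "\<dots> = mat_diag n (\<lambda>i. (e # es) ! i)"
      unfolding U3(3) n
      by (rule eq_matI) (auto simp: mat_diag_def nth_Cons split: nat.splits)
    finally show ?thesis .
  qed
  have PT: "transpose_mat P \<in> carrier_mat n n" using P by simp
  show ?case
  proof (intro bexI[of _ "W * P"] conjI)
    have t: "transpose_mat (W * P) = transpose_mat P * transpose_mat W" by (rule transpose_mult[OF W P])
    show "transpose_mat (W * P) * (W * P) = 1\<^sub>m n"
    proof -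
      have "transpose_mat (W * P) * (W * P) = transpose_mat P * ((transpose_mat W * W) * P)"
        unfolding t using P W PT Wt by (simp add: assoc_mult_mat[of _ n n _ n _ n])
      then show ?thesis using P PtP WtW by simp
    qed
    have "transpose_mat (W * P) * A * (W * P) = transpose_mat P * A' * P"
      unfolding t A'_def using P W PT Wt A by (simp add: assoc_mult_mat[of _ n n _ n _ n])
    then show "transpose_mat (W * P) * A * (W * P) = mat_diag n (\<lambda>i. (e # es) ! i)" using PAP by simp
  qed (use W P in auto)
qed

text \<open>The eigenvalues come in the order of \<open>ord_eigenvalue\<close>, with multiplicities. Since the
characteristic polynomial has only real roots, the list of these is complete, and the trace is its sum.\<close>

lemma spectral_theorem:
  assumes S: "S \<in> carrier_mat n n" "transpose_mat S = S"
  obtains u :: "nat \<Rightarrow> nat \<Rightarrow> real"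
  where "\<And>j l. j < n \<Longrightarrow> l < n \<Longrightarrow> (\<Sum>c<n. u j c * u l c) = (if j = l then 1 else 0)"
    and "\<And>j c. j < n \<Longrightarrow> c < n \<Longrightarrow> (\<Sum>d<n. S $$ (c,d) * u j d) = ord_eigenvalue (Suc j) S * u j c"
    and "(\<Sum>c<n. S $$ (c,c)) = (\<Sum>j<n. ord_eigenvalue (Suc j) S)"
proof -
  obtain es0 where es0: "char_poly S = (\<Prod>e\<leftarrow>es0. [:- e, 1:])" "length es0 = n"
    using real_symmetric_char_poly_splits[OF S] by blast
  define es where "es = rev (sorted_list_of_multiset (proots (char_poly S)))"
  have "proots (char_poly S) = mset es0"
  proof -
    have "proots (\<Prod>e\<leftarrow>xs. [:- e, 1:]) = mset xs" for xs :: "real list"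
    proof (induction xs)
      case (Cons x xs)
      have "(\<Prod>e\<leftarrow>xs. [:- e, 1:]) \<noteq> 0" by (auto simp: prod_list_zero_iff)
      then show ?case using Cons by (simp add: proots_mult del: mult_pCons_left mult_pCons_right)
    qed simp
    then show ?thesis by (simp add: es0)
  qed
  then have mset: "mset es = mset es0" by (simp add: es_def)
  then have len: "length es = n" using es0 by (metis size_mset)
  have "(\<Prod>e\<leftarrow>es. [:- e, 1:]) = (\<Prod>e\<leftarrow>es0. [:- e, 1:])"
    by (metis mset mset_map prod_mset_prod_list)
  then have cp: "char_poly S = (\<Prod>e\<leftarrow>es. [:- e, 1:])" using es0 by simp
  have ord: "ord_eigenvalue (Suc j) S = es ! j" for j by (simp add: ord_eigenvalue_def es_def)
  obtain U where U: "U \<in> carrier_mat n n" "transpose_mat U * U = 1\<^sub>m n"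
      "transpose_mat U * S * U = mat_diag n (\<lambda>i. es ! i)"
    using orthogonal_diagonalization[OF S cp] by blast
  have Ut: "transpose_mat U \<in> carrier_mat n n" using U by simp
  have UUt: "U * transpose_mat U = 1\<^sub>m n" by (rule mat_mult_left_right_inverse[OF Ut U(1) U(2)])
  have D: "mat_diag n (\<lambda>i. es ! i) \<in> carrier_mat n n" by simp
  have SU: "S * U = U * mat_diag n (\<lambda>i. es ! i)"
  proof -
    have "U * (transpose_mat U * S * U) = (U * transpose_mat U) * (S * U)"
      using U(1) Ut S by (simp add: assoc_mult_mat[of _ n n _ n _ n])
    then show ?thesis using U UUt S by simp
  qed
  have 1: "(\<Sum>c<n. U $$ (c,j) * U $$ (c,l)) = (if j = l then 1 else 0)" if "j < n" "l < n" for j l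
  proof -
    have "(transpose_mat U * U) $$ (j,l) = (\<Sum>c<n. U $$ (c,j) * U $$ (c,l))"
      using U(1) that by (simp add: scalar_prod_def lessThan_atLeast0)
    then show ?thesis using that by (simp add: U)
  qed
  have one': "(\<Sum>j<n. U $$ (c,j) * U $$ (d,j)) = (if c = d then 1 else 0)" if "c < n" "d < n" for c d
  proof -
    have "(U * transpose_mat U) $$ (c,d) = (\<Sum>j<n. U $$ (c,j) * U $$ (d,j))"
      using U(1) that by (simp add: scalar_prod_def lessThan_atLeast0)
    then show ?thesis using that by (simp add: UUt)
  qed
  have 2: "(\<Sum>d<n. S $$ (c,d) * U $$ (d,j)) = es ! j * U $$ (c,j)" if "j < n" "c < n" for j c
  proof -
    have "(S * U) $$ (c,j) = (\<Sum>d<n. S $$ (c,d) * U $$ (d,j))"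
      using U(1) S that by (simp add: scalar_prod_def lessThan_atLeast0)
    moreover have "(U * mat_diag n (\<lambda>i. es ! i)) $$ (c,j) = es ! j * U $$ (c,j)"
      using U(1) that by (subst mat_diag_mult_right[of _ n]) auto
    ultimately show ?thesis using SU by simp
  qed
  have 3: "(\<Sum>c<n. S $$ (c,c)) = (\<Sum>j<n. es ! j)"
  proof -
    have "(\<Sum>j<n. es ! j) = (\<Sum>j<n. \<Sum>c<n. es ! j * U $$ (c,j) * U $$ (c,j))"
      by (intro sum.cong refl) (simp add: 1 mult.assoc flip: sum_distrib_left)
    also have "\<dots> = (\<Sum>j<n. \<Sum>c<n. \<Sum>d<n. S $$ (c,d) * U $$ (d,j) * U $$ (c,j))"
      by (intro sum.cong refl) (simp add: 2[symmetric] sum_distrib_right)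
    also have "\<dots> = (\<Sum>c<n. \<Sum>j<n. \<Sum>d<n. S $$ (c,d) * U $$ (d,j) * U $$ (c,j))"
      by (rule sum.swap)
    also have "\<dots> = (\<Sum>c<n. \<Sum>d<n. \<Sum>j<n. S $$ (c,d) * U $$ (d,j) * U $$ (c,j))"
      by (rule sum.cong[OF refl], rule sum.swap)
    also have "\<dots> = (\<Sum>c<n. \<Sum>d<n. S $$ (c,d) * (if d = c then 1 else 0))"
      by (intro sum.cong refl) (simp add: one'[symmetric] sum_distrib_left mult.assoc)
    also have "\<dots> = (\<Sum>c<n. S $$ (c,c))" by (simp add: if_distrib sum.delta cong: if_cong)
    finally show ?thesis by simp
  qed
  show ?thesis
    by (rule that[of "\<lambda>j c. U $$ (c,j)"]) (simp_all add: 1 2 3 ord)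
qed

text \<open>The vectors v_j = u_j / sqrt \<lambda>_j, with u_j the eigenvectors of the k largest eigenvalues. If y
has covariance S, the variables v_j \<bullet> y are uncorrelated with variance 1.\<close>

lemma whitening_vectors:
  fixes S :: "real mat"
  assumes S: "S \<in> carrier_mat p p" "transpose_mat S = S" and k: "k \<le> p"
    and low: "\<And>j. j < k \<Longrightarrow> lo \<le> ord_eigenvalue (Suc j) S" and l: "0 < lo"
  obtains v :: "nat \<Rightarrow> nat \<Rightarrow> real"
  where "\<And>g. quad p (\<lambda>c d. S $$ (c, d)) (\<lambda>c. \<Sum>j<k. g j * v j c) = (\<Sum>j<k. (g j)\<^sup>2)"
    and "(\<Sum>j<k. dot p (v j) (v j)) \<le> real k / lo"
proof (rule spectral_theorem[OF S])
  fix u :: "nat \<Rightarrow> nat \<Rightarrow> real"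
  assume u: "\<And>j l. j < p \<Longrightarrow> l < p \<Longrightarrow> (\<Sum>c<p. u j c * u l c) = (if j = l then 1 else 0)"
    "\<And>j c. j < p \<Longrightarrow> c < p \<Longrightarrow> (\<Sum>d<p. S $$ (c,d) * u j d) = ord_eigenvalue (Suc j) S * u j c"
  define lam where "lam = (\<lambda>j. ord_eigenvalue (Suc j) S)"
  define v where "v = (\<lambda>j c. u j c / sqrt (lam j))"
  have lam: "lo \<le> lam j" "0 < lam j" if "j < k" for j using low[OF that] l by (auto simp: lam_def)
  have uu: "dot p (u j) (u l) = (if j = l then 1 else 0)" if "j < k" "l < k" for j l
    unfolding dot_def using u(1)[of j l] that k by simp
  have vv: "dot p (v j) (v l) = dot p (u j) (u l) / (sqrt (lam j) * sqrt (lam l))" for j l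
    by (simp add: dot_def v_def sum_divide_distrib)
  have q: "quad p (\<lambda>c d. S $$ (c, d)) (\<lambda>c. \<Sum>j<k. g j * v j c) = (\<Sum>j<k. (g j)\<^sup>2)" for g
  proof -
    define a where "a = (\<lambda>c. \<Sum>j<k. g j * v j c)"
    have Sa: "(\<Sum>d<p. S $$ (c,d) * a d) = (\<Sum>j<k. (g j * lam j) * v j c)" if "c < p" for c
    proof -
      have "(\<Sum>d<p. S $$ (c,d) * a d) = (\<Sum>d<p. \<Sum>j<k. g j / sqrt (lam j) * (S $$ (c,d) * u j d))"
        by (simp add: a_def v_def sum_distrib_left mult_ac)
      also have "\<dots> = (\<Sum>j<k. \<Sum>d<p. g j / sqrt (lam j) * (S $$ (c,d) * u j d))" by (rule sum.swap)
      also have "\<dots> = (\<Sum>j<k. g j / sqrt (lam j) * (lam j * u j c))"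
      proof (intro sum.cong refl)
        fix j assume "j \<in> {..<k}"
        then have "(\<Sum>d<p. S $$ (c,d) * u j d) = lam j * u j c" using u(2)[of j c] that k by (simp add: lam_def)
        then show "(\<Sum>d<p. g j / sqrt (lam j) * (S $$ (c,d) * u j d)) = g j / sqrt (lam j) * (lam j * u j c)"
          by (simp only: sum_distrib_left[symmetric])
      qed
      finally show ?thesis by (simp add: v_def mult_ac)
    qed
    have "quad p (\<lambda>c d. S $$ (c, d)) a = dot p a (\<lambda>c. \<Sum>d<p. S $$ (c,d) * a d)"
      by (simp add: quad_def dot_def sum_distrib_left mult_ac)
    also have "\<dots> = dot p (\<lambda>c. \<Sum>j<k. (g j * lam j) * v j c) a"
      by (subst dot_commute, rule dot_cong) (simp_all add: Sa)
    also have "\<dots> = (\<Sum>j<k. (g j * lam j) * dot p (v j) a)" by (rule dot_sum)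
    also have "\<dots> = (\<Sum>j<k. (g j)\<^sup>2)"
    proof (intro sum.cong refl)
      fix j assume "j \<in> {..<k}"
      then have j: "j < k" by simp
      have "dot p (v j) a = (\<Sum>l<k. g l * dot p (v l) (v j))"
        unfolding a_def by (subst dot_commute) (rule dot_sum)
      also have "\<dots> = (\<Sum>l<k. if l = j then g j / lam j else 0)"
        using lam(2)[OF j] j by (intro sum.cong refl) (auto simp: vv uu)
      also have "\<dots> = g j / lam j" using j by simp
      finally show "(g j * lam j) * dot p (v j) a = (g j)\<^sup>2" using lam(2)[OF j] by (simp add: power2_eq_square)
    qed
    finally show ?thesis by (simp add: a_def)
  qed
  have "(\<Sum>j<k. dot p (v j) (v j)) \<le> (\<Sum>j<k. 1 / lo)"
  proof (rule sum_mono)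
    fix j assume "j \<in> {..<k}"
    then have j: "j < k" by simp
    have "dot p (v j) (v j) = 1 / lam j" using lam(2)[OF j] uu[OF j j] by (simp add: vv)
    also have "\<dots> \<le> 1 / lo" using lam[OF j] l by (intro divide_left_mono) auto
    finally show "dot p (v j) (v j) \<le> 1 / lo" .
  qed
  then show ?thesis using that[OF q] by simp
qed

section \<open>Gaussian vectors given by their linear functionals\<close>

lemma univ_normal_scaled:
  assumes "0 \<le> s2"
  shows "univ_normal 0 s2 = distr std_normal_distribution borel (\<lambda>z. sqrt s2 * z)"
proof (cases "s2 = 0")
  case True
  interpret N: real_distribution std_normal_distribution by (rule real_dist_normal_dist)
  show ?thesis using True
    by (simp add: univ_normal_def N.distr_const)
next
  case False
  interpret N: prob_space std_normal_distribution using real_dist_normal_dist by (simp add: real_distribution_def)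
  have "distributed std_normal_distribution lborel (\<lambda>x. x) std_normal_density"
    unfolding distributed_def by (auto intro!: distr_id2)
  then have "distributed std_normal_distribution lborel (\<lambda>x. 0 + sqrt s2 * x) (normal_density (0 + sqrt s2 * 0) (\<bar>sqrt s2\<bar> * 1))"
    by (rule N.normal_density_affine) (use False in auto)
  then have "distr std_normal_distribution lborel (\<lambda>x. sqrt s2 * x) = density lborel (normal_density 0 (sqrt s2))"
    using assms by (simp add: distributed_def)
  moreover have "distr std_normal_distribution lborel (\<lambda>x. sqrt s2 * x) = distr std_normal_distribution borel (\<lambda>x. sqrt s2 * x)"
    by (intro distr_cong) auto
  ultimately show ?thesis using False by (simp add: univ_normal_def)
qed

abbreviation vecM :: "nat \<Rightarrow> (nat \<Rightarrow> real) measure" where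
  "vecM p \<equiv> PiM {..<p} (\<lambda>_. borel)"

text \<open>A Gaussian law is given by the laws of the linear functionals. S may be singular, and there is no
density to work with; all that follows is derived from these one-dimensional laws.\<close>

locale gaussian_law = prob_space \<mu> for \<mu> :: "(nat \<Rightarrow> real) measure" +
  fixes p :: nat and S :: "nat \<Rightarrow> nat \<Rightarrow> real"
  assumes sets_eq [measurable_cong]: "sets \<mu> = sets (vecM p)"
    and law: "\<And>a. distr \<mu> borel (dot p a) = univ_normal 0 (quad p S a)"
    and psd: "\<And>a. 0 \<le> quad p S a"
begin

lemma coord_measurable [measurable]: "c < p \<Longrightarrow> (\<lambda>y. y c) \<in> borel_measurable \<mu>"
  by (simp add: measurable_cong_sets[OF sets_eq refl])

lemma dot_measurable [measurable]: "dot p a \<in> borel_measurable \<mu>"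
  by (intro measurable_dot[of p "\<lambda>_. a" \<mu> "\<lambda>y. y"]) auto

lemma law_scaled: "distr \<mu> borel (dot p a) = distr std_normal_distribution borel (\<lambda>z. sqrt (quad p S a) * z)"
  by (simp add: law univ_normal_scaled[OF psd])

lemma transfer_integral:
  fixes f :: "real \<Rightarrow> real"
  assumes [measurable]: "f \<in> borel_measurable borel"
  shows "(\<integral>y. f (dot p a y) \<partial>\<mu>) = (\<integral>z. f (sqrt (quad p S a) * z) \<partial>std_normal_distribution)"
    and "integrable \<mu> (\<lambda>y. f (dot p a y)) \<longleftrightarrow> integrable std_normal_distribution (\<lambda>z. f (sqrt (quad p S a) * z))"
proof -
  have "(\<integral>y. f (dot p a y) \<partial>\<mu>) = (\<integral>t. f t \<partial>distr \<mu> borel (dot p a))"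
    by (rule integral_distr[symmetric]) auto
  also have "\<dots> = (\<integral>z. f (sqrt (quad p S a) * z) \<partial>std_normal_distribution)"
    unfolding law_scaled by (rule integral_distr) auto
  finally show "(\<integral>y. f (dot p a y) \<partial>\<mu>) = (\<integral>z. f (sqrt (quad p S a) * z) \<partial>std_normal_distribution)" .
  have "integrable \<mu> (\<lambda>y. f (dot p a y)) \<longleftrightarrow> integrable (distr \<mu> borel (dot p a)) f"
    by (rule integrable_distr_eq[symmetric]) auto
  also have "\<dots> \<longleftrightarrow> integrable std_normal_distribution (\<lambda>z. f (sqrt (quad p S a) * z))"
    unfolding law_scaled by (rule integrable_distr_eq) auto
  finally show "integrable \<mu> (\<lambda>y. f (dot p a y)) \<longleftrightarrow> integrable std_normal_distribution (\<lambda>z. f (sqrt (quad p S a) * z))" .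
qed

lemma even_moment:
  shows "(\<integral>y. dot p a y ^ (2 * m) \<partial>\<mu>) = quad p S a ^ m * (fact (2 * m) / (2 ^ m * fact m))"
    and "integrable \<mu> (\<lambda>y. dot p a y ^ (2 * m))"
proof -
  have s: "(sqrt (quad p S a) * z) ^ (2 * m) = quad p S a ^ m * z ^ (2 * m)" for z
    using psd[of a] by (simp add: power_mult_distrib power_mult)
  show "(\<integral>y. dot p a y ^ (2 * m) \<partial>\<mu>) = quad p S a ^ m * (fact (2 * m) / (2 ^ m * fact m))"
    by (subst transfer_integral(1)[of "\<lambda>t. t ^ (2 * m)"])
       (simp_all add: s std_normal_distribution_even_moments)
  show "integrable \<mu> (\<lambda>y. dot p a y ^ (2 * m))"
    by (subst transfer_integral(2)[of "\<lambda>t. t ^ (2 * m)"])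
       (simp_all add: s integrable_std_normal_distribution_moment)
qed

lemma second_moment: "(\<integral>y. (dot p a y)\<^sup>2 \<partial>\<mu>) = quad p S a" "integrable \<mu> (\<lambda>y. (dot p a y)\<^sup>2)"
  using even_moment[of a 1] by auto

lemma fourth_moment: "(\<integral>y. (dot p a y)^4 \<partial>\<mu>) = 3 * (quad p S a)\<^sup>2" "integrable \<mu> (\<lambda>y. (dot p a y)^4)"
  using even_moment[of a 2] by (auto simp: fact_numeral)

text \<open>Markov's inequality for the moment of order 2m. Polynomial decay in L of any order suffices to cover
polynomially many projections at once when L is a small power of n.\<close>

lemma tail_bound:
  assumes "0 < L"
  shows "measure \<mu> {y \<in> space \<mu>. L\<^sup>2 * quad p S a < (dot p a y)\<^sup>2} \<le> fact (2 * m) / (2 ^ m * fact m) / L ^ (2 * m)"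
proof (cases "quad p S a = 0")
  case True
  have "AE y in \<mu>. (dot p a y)\<^sup>2 = 0"
    by (subst integral_nonneg_eq_0_iff_AE[symmetric]) (auto simp: second_moment True)
  then have "measure \<mu> {y \<in> space \<mu>. L\<^sup>2 * quad p S a < (dot p a y)\<^sup>2} = 0"
    using True by (subst prob_eq_0) auto
  then show ?thesis using assms by simp
next
  case False
  then have q: "0 < quad p S a" using psd[of a] by simp
  have "measure \<mu> {y \<in> space \<mu>. L\<^sup>2 * quad p S a < (dot p a y)\<^sup>2}
      \<le> measure \<mu> {y \<in> space \<mu>. (L\<^sup>2 * quad p S a) ^ m \<le> dot p a y ^ (2 * m)}"
    using psd[of a] by (intro finite_measure_mono) (auto simp: power_mult intro!: power_mono mult_nonneg_nonneg)
  also have "\<dots> \<le> (\<integral>y. dot p a y ^ (2 * m) \<partial>\<mu>) / (L\<^sup>2 * quad p S a) ^ m"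
    using q assms by (intro integral_Markov_inequality_measure[where A = "{}"] even_moment)
      (auto simp: power_mult)
  also have "\<dots> = fact (2 * m) / (2 ^ m * fact m) / L ^ (2 * m)"
    unfolding even_moment(1) using q by (simp add: power_mult_distrib power_mult)
  finally show ?thesis .
qed

text \<open>The arithmetic-geometric mean inequality reduces the mixed moment to fourth moments of single
functionals; weighting it by the quotient of the variances makes the bound homogeneous in each factor.
The weight is not available when a variance vanishes, but then one factor is zero almost surely.\<close>

lemma mixed_fourth_moment:
  "(\<integral>y. (dot p a y)\<^sup>2 * (dot p b y)\<^sup>2 \<partial>\<mu>) \<le> 3 * quad p S a * quad p S b"
  "integrable \<mu> (\<lambda>y. (dot p a y)\<^sup>2 * (dot p b y)\<^sup>2)"
proof -
  have amgm: "(u::real)\<^sup>2 * v\<^sup>2 \<le> (s * u^4 + v^4 / s) / 2" if "0 < s" for u v s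
  proof -
    have "0 \<le> (s * u\<^sup>2 - v\<^sup>2)\<^sup>2 / (2 * s)" using that by simp
    also have "\<dots> = (s * u^4 + v^4 / s) / 2 - u\<^sup>2 * v\<^sup>2"
      using that by (simp add: power2_diff field_simps power2_eq_square power4_eq_xxxx)
    finally show ?thesis by simp
  qed
  show int: "integrable \<mu> (\<lambda>y. (dot p a y)\<^sup>2 * (dot p b y)\<^sup>2)"
  proof (rule Bochner_Integration.integrable_bound)
    show "integrable \<mu> (\<lambda>y. (1 * (dot p a y)^4 + (dot p b y)^4 / 1) / 2)"
      by (intro Bochner_Integration.integrable_add Bochner_Integration.integrable_divide fourth_moment integrable_mult_right)
    show "AE y in \<mu>. norm ((dot p a y)\<^sup>2 * (dot p b y)\<^sup>2) \<le> norm ((1 * (dot p a y)^4 + (dot p b y)^4 / 1) / 2)"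
      using amgm[of 1] by (intro AE_I2) (simp add: abs_mult)
  qed measurable
  have le: "(\<integral>y. (dot p a y)\<^sup>2 * (dot p b y)\<^sup>2 \<partial>\<mu>) \<le> (s * (3 * (quad p S a)\<^sup>2) + (3 * (quad p S b)\<^sup>2) / s) / 2"
    if "0 < s" for s
  proof -
    have "(\<integral>y. (dot p a y)\<^sup>2 * (dot p b y)\<^sup>2 \<partial>\<mu>) \<le> (\<integral>y. (s * (dot p a y)^4 + (dot p b y)^4 / s) / 2 \<partial>\<mu>)"
      by (intro integral_mono int amgm that Bochner_Integration.integrable_add
            Bochner_Integration.integrable_divide fourth_moment integrable_mult_right)
    then show ?thesis by (simp add: fourth_moment)
  qed
  consider "quad p S a = 0" | "quad p S b = 0" | "0 < quad p S a" "0 < quad p S b"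
    using psd[of a] psd[of b] by fastforce
  then show "(\<integral>y. (dot p a y)\<^sup>2 * (dot p b y)\<^sup>2 \<partial>\<mu>) \<le> 3 * quad p S a * quad p S b"
  proof cases
    case 1
    have "AE y in \<mu>. (dot p a y)\<^sup>2 = 0"
      by (subst integral_nonneg_eq_0_iff_AE[symmetric]) (auto simp: second_moment 1)
    then have "(\<integral>y. (dot p a y)\<^sup>2 * (dot p b y)\<^sup>2 \<partial>\<mu>) = (\<integral>y. 0 \<partial>\<mu>)" by (intro integral_cong_AE) auto
    then show ?thesis by (simp add: 1)
  next
    case 2
    have "AE y in \<mu>. (dot p b y)\<^sup>2 = 0"
      by (subst integral_nonneg_eq_0_iff_AE[symmetric]) (auto simp: second_moment 2)
    then have "(\<integral>y. (dot p a y)\<^sup>2 * (dot p b y)\<^sup>2 \<partial>\<mu>) = (\<integral>y. 0 \<partial>\<mu>)" by (intro integral_cong_AE) auto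
    then show ?thesis by (simp add: 2)
  next
    case 3
    then show ?thesis using le[of "quad p S b / quad p S a"] by (simp add: power2_eq_square field_simps)
  qed
qed

text \<open>The damping factor is the lower bound for the Sherman-Morrison denominator in terms of the row alone. It
costs at most half of the second moment: 1 / (1 + h)^2 \<ge> 1 - 2 h, and the loss has a mean of at most
6 tr S / r times the second moment.\<close>

lemma damped_second_moment:
  assumes r: "12 * (\<Sum>c<p. S c c) \<le> r" "0 < r"
  shows "ennreal (quad p S a / 2) \<le> (\<integral>\<^sup>+y. ennreal ((dot p a y)\<^sup>2 / (1 + dot p y y / r)\<^sup>2) \<partial>\<mu>)"
proof -
  define e :: "nat \<Rightarrow> nat \<Rightarrow> real" where "e = (\<lambda>c i. if i = c then 1 else 0)"
  have dot_e: "dot p (e c) y = y c" if "c < p" for c y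
    using that by (simp add: dot_def e_def if_distrib[of "\<lambda>t. t * _"] cong: if_cong)
  have quad_e: "quad p S (e c) = S c c" if "c < p" for c
    using that by (simp add: quad_def e_def if_distrib[of "\<lambda>t. t * _"] if_distrib[of "\<lambda>t. _ * t"] cong: if_cong)
  have yy: "dot p y y = (\<Sum>c<p. (dot p (e c) y)\<^sup>2)" for y
  proof -
    have "dot p y y = (\<Sum>c<p. (y c)\<^sup>2)" by (simp add: dot_def power2_eq_square)
    also have "\<dots> = (\<Sum>c<p. (dot p (e c) y)\<^sup>2)" by (intro sum.cong refl) (simp add: dot_e)
    finally show ?thesis .
  qed
  have pw: "(dot p a y)\<^sup>2 - 2 / r * (\<Sum>c<p. (dot p a y)\<^sup>2 * (dot p (e c) y)\<^sup>2) \<le> (dot p a y)\<^sup>2 / (1 + dot p y y / r)\<^sup>2" for y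
  proof -
    define h where "h = dot p y y / r"
    have h: "0 \<le> h" using r dot_self_nonneg by (simp add: h_def)
    have "(1 - 2 * h) * (1 + h)\<^sup>2 = 1 - h\<^sup>2 * 3 - 2 * h ^ 3"
      by (simp add: power2_eq_square power3_eq_cube algebra_simps)
    also have "\<dots> \<le> 1" using zero_le_power[OF h, of 3] zero_le_power2[of h] by linarith
    finally have "1 - 2 * h \<le> 1 / (1 + h)\<^sup>2" using h by (simp add: le_divide_eq)
    then have "(dot p a y)\<^sup>2 * (1 - 2 * h) \<le> (dot p a y)\<^sup>2 * (1 / (1 + h)\<^sup>2)" by (intro mult_left_mono) auto
    moreover have "2 / r * (\<Sum>c<p. (dot p a y)\<^sup>2 * (dot p (e c) y)\<^sup>2) = (dot p a y)\<^sup>2 * (2 * h)"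
      unfolding h_def yy by (simp add: sum_distrib_left sum_divide_distrib mult_ac)
    ultimately show ?thesis unfolding h_def[symmetric] by (simp add: algebra_simps)
  qed
  have i1: "integrable \<mu> (\<lambda>y. (dot p a y)\<^sup>2 - 2 / r * (\<Sum>c<p. (dot p a y)\<^sup>2 * (dot p (e c) y)\<^sup>2))"
    by (intro Bochner_Integration.integrable_diff integrable_mult_right Bochner_Integration.integrable_sum
        second_moment mixed_fourth_moment)
  have m1: "(\<lambda>y. (dot p a y)\<^sup>2 / (1 + dot p y y / r)\<^sup>2) \<in> borel_measurable \<mu>"
    unfolding yy by measurable
  have i2: "integrable \<mu> (\<lambda>y. (dot p a y)\<^sup>2 / (1 + dot p y y / r)\<^sup>2)"
  proof (rule Bochner_Integration.integrable_bound[OF second_moment(2)[of a] m1], intro AE_I2)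
    fix y
    have "1 \<le> (1 + dot p y y / r)\<^sup>2" using r dot_self_nonneg[of p y] by (intro one_le_power) auto
    then have "(dot p a y)\<^sup>2 / (1 + dot p y y / r)\<^sup>2 \<le> (dot p a y)\<^sup>2 / 1" by (intro divide_left_mono) auto
    then show "norm ((dot p a y)\<^sup>2 / (1 + dot p y y / r)\<^sup>2) \<le> norm ((dot p a y)\<^sup>2)" by simp
  qed
  have "quad p S a / 2 \<le> quad p S a - 2 / r * (\<Sum>c<p. 3 * quad p S a * S c c)"
  proof -
    have "2 / r * (\<Sum>c<p. 3 * quad p S a * S c c) = quad p S a * (6 * (\<Sum>c<p. S c c) / r)"
      by (simp add: sum_distrib_left sum_divide_distrib mult_ac)
    also have "\<dots> \<le> quad p S a * (1/2)" using r psd by (intro mult_left_mono) (auto simp: divide_le_eq)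
    finally show ?thesis by simp
  qed
  also have "\<dots> \<le> quad p S a - 2 / r * (\<Sum>c<p. \<integral>y. (dot p a y)\<^sup>2 * (dot p (e c) y)\<^sup>2 \<partial>\<mu>)"
  proof (intro diff_left_mono mult_left_mono sum_mono)
    fix c assume "c \<in> {..<p}"
    then show "(\<integral>y. (dot p a y)\<^sup>2 * (dot p (e c) y)\<^sup>2 \<partial>\<mu>) \<le> 3 * quad p S a * S c c"
      using mixed_fourth_moment(1)[of a "e c"] by (simp add: quad_e)
  qed (use r in auto)
  also have "\<dots> = (\<integral>y. (dot p a y)\<^sup>2 - 2 / r * (\<Sum>c<p. (dot p a y)\<^sup>2 * (dot p (e c) y)\<^sup>2) \<partial>\<mu>)"
    by (simp add: second_moment mixed_fourth_moment Bochner_Integration.integrable_sum)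
  also have "\<dots> \<le> (\<integral>y. (dot p a y)\<^sup>2 / (1 + dot p y y / r)\<^sup>2 \<partial>\<mu>)"
    by (intro integral_mono i1 i2 pw)
  finally have "ennreal (quad p S a / 2) \<le> ennreal (\<integral>y. (dot p a y)\<^sup>2 / (1 + dot p y y / r)\<^sup>2 \<partial>\<mu>)"
    by (rule ennreal_leI)
  also have "\<dots> = (\<integral>\<^sup>+y. ennreal ((dot p a y)\<^sup>2 / (1 + dot p y y / r)\<^sup>2) \<partial>\<mu>)"
    by (rule nn_integral_eq_integral[symmetric, OF i2]) auto
  finally show ?thesis .
qed

end

lemma gaussian_integral_cos: "(\<integral>g. cos (g * t) \<partial>std_normal_distribution) = exp (- (t\<^sup>2 / 2))"
proof -
  interpret N: real_distribution std_normal_distribution by (rule real_dist_normal_dist)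
  have "complex_of_real (exp (- (t\<^sup>2) / 2)) = char std_normal_distribution t"
    by (simp add: char_std_normal_distribution)
  then have "exp (- (t\<^sup>2) / 2) = Re (char std_normal_distribution t)" by (metis Re_complex_of_real)
  also have "\<dots> = (\<integral>g. Re (iexp (t * g)) \<partial>std_normal_distribution)"
    unfolding char_def by (rule integral_Re[symmetric]) (rule N.integrable_iexp; simp)
  also have "\<dots> = (\<integral>g. cos (g * t) \<partial>std_normal_distribution)" by (simp add: Re_exp mult.commute)
  finally show ?thesis by simp
qed

lemma gaussian_integral_exp_sq: "(\<integral>g. exp (- (g\<^sup>2 / 2)) \<partial>std_normal_distribution) = 1 / sqrt 2"
proof -
  have eq: "std_normal_density g * exp (- (g\<^sup>2 / 2)) = 1 / sqrt 2 * normal_density 0 (1 / sqrt 2) g" for g :: real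
    by (simp add: normal_density_def power_divide real_sqrt_mult real_sqrt_divide field_simps flip: exp_add)
  have "(\<integral>g. exp (- (g\<^sup>2 / 2)) \<partial>std_normal_distribution) = (\<integral>g. std_normal_density g * exp (- (g\<^sup>2 / 2)) \<partial>lborel)"
    by (subst integral_density) auto
  also have "\<dots> = 1 / sqrt 2" unfolding eq by (simp add: integral_normal_density)
  finally show ?thesis .
qed

context gaussian_law
begin

lemma integral_cos: "(\<integral>y. cos (dot p a y) \<partial>\<mu>) = exp (- (quad p S a / 2))"
  using transfer_integral(1)[of cos a] psd[of a]
  by (simp add: mult.commute[of "sqrt _"] gaussian_integral_cos)

text \<open>The joint law of the v_j \<bullet> y is not given, only the laws of linear functionals. But exp (-
t^2 / 2) is the average of cos (g t) over a standard normal g; this replaces one square in the exponent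
after the other by a cosine, and products of cosines are again cosines of linear functionals. The factor
cos (a \<bullet> y) is carried along for the induction.\<close>

lemma laplace_transform:
  fixes v :: "nat \<Rightarrow> nat \<Rightarrow> real"
  assumes "\<And>g. quad p S (\<lambda>c. a c + (\<Sum>j<k. g j * v j c)) = quad p S a + (\<Sum>j<k. (g j)\<^sup>2)"
  shows "(\<integral>y. exp (- ((\<Sum>j<k. (dot p (v j) y)\<^sup>2) / 2)) * cos (dot p a y) \<partial>\<mu>)
       = (1 / sqrt 2) ^ k * exp (- (quad p S a / 2))"
  using assms
proof (induction k arbitrary: a)
  case 0
  then show ?case by (simp add: integral_cos)
next
  case (Suc k)
  interpret N: real_distribution std_normal_distribution by (rule real_dist_normal_dist)
  interpret P: pair_prob_space \<mu> std_normal_distribution ..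
  define E where "E = (\<lambda>y. exp (- ((\<Sum>j<k. (dot p (v j) y)\<^sup>2) / 2)))"
  have E[measurable]: "E \<in> borel_measurable \<mu>" unfolding E_def by measurable
  have E1: "\<bar>E y\<bar> \<le> 1" for y by (auto simp: E_def intro!: sum_nonneg)
  \<comment> \<open>Replacing a by a + g v_k preserves the hypothesis, with quad a + g^2 for quad a.\<close>
  have ag: "(\<integral>y. E y * cos (dot p (\<lambda>c. a c + g * v k c) y) \<partial>\<mu>)
      = (1 / sqrt 2) ^ k * (exp (- (quad p S a / 2)) * exp (- (g\<^sup>2 / 2)))" for g
  proof -
    have sq: "quad p S (\<lambda>c. (a c + g * v k c) + (\<Sum>j<k. h j * v j c)) = quad p S a + g\<^sup>2 + (\<Sum>j<k. (h j)\<^sup>2)" for h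
    proof -
      have "(\<Sum>j<Suc k. (if j = k then g else h j) * v j c) = (\<Sum>j<k. h j * v j c) + g * v k c" for c
        by simp
      moreover have "(\<Sum>j<Suc k. (if j = k then g else h j)\<^sup>2) = (\<Sum>j<k. (h j)\<^sup>2) + g\<^sup>2" by simp
      ultimately show ?thesis using Suc.prems[of "\<lambda>j. if j = k then g else h j"] by (simp add: algebra_simps)
    qed
    have s0: "quad p S (\<lambda>c. a c + g * v k c) = quad p S a + g\<^sup>2" using sq[of "\<lambda>_. 0"] by simp
    show ?thesis using Suc.IH[of "\<lambda>c. a c + g * v k c"] sq s0
      by (simp add: E_def exp_add[symmetric] add_divide_distrib)
  qed
  have dotadd: "dot p (\<lambda>c. a c + g * v k c) y = dot p a y + g * dot p (v k) y" for g y
    using dot_diff_scaled'[of p a "- g" "v k" y] by simp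
  have int1: "integrable \<mu> (\<lambda>y. E y * cos (dot p b y))" for b
    by (intro integrable_const_bound[of _ 1]) (auto simp: abs_mult intro!: mult_le_one E1 AE_I2)
  have prod: "(\<integral>y. E y * (cos (g * dot p (v k) y) * cos (dot p a y)) \<partial>\<mu>)
      = (1 / sqrt 2) ^ k * (exp (- (quad p S a / 2)) * exp (- (g\<^sup>2 / 2)))" for g
  proof -
    have "(\<integral>y. E y * (cos (g * dot p (v k) y) * cos (dot p a y)) \<partial>\<mu>)
       = (\<integral>y. (E y * cos (dot p (\<lambda>c. a c + g * v k c) y) + E y * cos (dot p (\<lambda>c. a c + (- g) * v k c) y)) / 2 \<partial>\<mu>)"
      by (intro Bochner_Integration.integral_cong refl)
         (unfold dotadd, simp add: cos_add cos_diff algebra_simps)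
    also have "\<dots> = ((\<integral>y. E y * cos (dot p (\<lambda>c. a c + g * v k c) y) \<partial>\<mu>)
        + (\<integral>y. E y * cos (dot p (\<lambda>c. a c + (- g) * v k c) y) \<partial>\<mu>)) / 2"
      by (simp only: Bochner_Integration.integral_divide_zero Bochner_Integration.integral_add[OF int1 int1])
    also have "\<dots> = (1 / sqrt 2) ^ k * (exp (- (quad p S a / 2)) * exp (- (g\<^sup>2 / 2)))"
      unfolding ag by simp
    finally show ?thesis .
  qed
  have m[measurable]: "(\<lambda>z. E (fst z) * (cos (snd z * dot p (v k) (fst z)) * cos (dot p a (fst z)))) \<in> borel_measurable (\<mu> \<Otimes>\<^sub>M std_normal_distribution)"
    by measurable
  have int: "integrable (\<mu> \<Otimes>\<^sub>M std_normal_distribution) (\<lambda>(y, g). E y * (cos (g * dot p (v k) y) * cos (dot p a y)))"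
    using m by (intro P.integrable_const_bound[of _ 1])
      (auto simp: abs_mult split_beta' intro!: mult_le_one E1 AE_I2)
  have "(\<integral>y. exp (- ((\<Sum>j<Suc k. (dot p (v j) y)\<^sup>2) / 2)) * cos (dot p a y) \<partial>\<mu>)
     = (\<integral>y. (\<integral>g. E y * (cos (g * dot p (v k) y) * cos (dot p a y)) \<partial>std_normal_distribution) \<partial>\<mu>)"
    by (intro Bochner_Integration.integral_cong refl)
       (simp add: gaussian_integral_cos E_def exp_add[symmetric] add_divide_distrib)
  also have "\<dots> = (\<integral>g. (\<integral>y. E y * (cos (g * dot p (v k) y) * cos (dot p a y)) \<partial>\<mu>) \<partial>std_normal_distribution)"
    by (rule P.Fubini_integral[symmetric]) (rule int)
  also have "\<dots> = (1 / sqrt 2) ^ Suc k * exp (- (quad p S a / 2))"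
    unfolding prod by (simp add: gaussian_integral_exp_sq)
  finally show ?case .
qed

text \<open>The exponential Markov inequality with the Laplace transform 2^{- k / 2}; note exp (1 / 8) / sqrt
2 < 9 / 10.\<close>

lemma chi_square_lower_tail:
  fixes v :: "nat \<Rightarrow> nat \<Rightarrow> real"
  assumes "\<And>g. quad p S (\<lambda>c. \<Sum>j<k. g j * v j c) = (\<Sum>j<k. (g j)\<^sup>2)"
  shows "measure \<mu> {y \<in> space \<mu>. (\<Sum>j<k. (dot p (v j) y)\<^sup>2) < real k / 4} \<le> (9 / 10) ^ k"
proof -
  define E where "E = (\<lambda>y. exp (- ((\<Sum>j<k. (dot p (v j) y)\<^sup>2) / 2)))"
  have [measurable]: "E \<in> borel_measurable \<mu>" unfolding E_def by measurable
  have int: "integrable \<mu> E"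
    by (intro integrable_const_bound[of _ 1]) (auto simp: E_def intro!: AE_I2 sum_nonneg)
  have q0: "quad p S (\<lambda>c. 0) = 0" by (simp add: quad_def)
  have "(\<integral>y. E y \<partial>\<mu>) = (1 / sqrt 2) ^ k"
    using laplace_transform[where a = "\<lambda>_. 0" and k = k and v = v] assms by (simp add: E_def q0 dot_def)
  have "measure \<mu> {y \<in> space \<mu>. (\<Sum>j<k. (dot p (v j) y)\<^sup>2) < real k / 4}
     \<le> measure \<mu> {y \<in> space \<mu>. exp (- (real k / 8)) \<le> E y}"
    by (intro finite_measure_mono) (auto simp: E_def)
  also have "\<dots> \<le> (\<integral>y. E y \<partial>\<mu>) / exp (- (real k / 8))"
    by (intro integral_Markov_inequality_measure[where A = "{}"] int) (auto simp: E_def)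
  also have "\<dots> = (1 / sqrt 2) ^ k * exp (1 / 8) ^ k"
    using \<open>(\<integral>y. E y \<partial>\<mu>) = (1 / sqrt 2) ^ k\<close> by (simp add: exp_minus field_simps flip: exp_of_nat_mult)
  also have "\<dots> = (exp (1 / 8) / sqrt 2) ^ k" by (simp add: power_divide)
  also have "\<dots> \<le> (9 / 10) ^ k"
  proof (intro power_mono)
    have "exp (1 / 8 :: real) \<le> 1 + 1 / 8 + (1 / 8)\<^sup>2" by (rule exp_bound) auto
    also have "\<dots> \<le> 9 / 10 * 1.4" by (simp add: power2_eq_square)
    also have "\<dots> \<le> 9 / 10 * sqrt 2" by (intro mult_left_mono real_le_rsqrt) (auto simp: power2_eq_square)
    finally show "exp (1 / 8) / sqrt 2 \<le> 9 / 10" by (simp add: divide_le_eq)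
  qed auto
  finally show ?thesis .
qed

end

section \<open>Designs with independent Gaussian rows\<close>

definition others :: "nat \<Rightarrow> nat \<Rightarrow> nat list" where
  "others n i = filter (\<lambda>j. j \<noteq> i) [0..<n]"

lemma others: "set (others n i) = {..<n} - {i}" "distinct (others n i)"
  by (auto simp: others_def)

lemma measurable_quad:
  assumes "\<And>c. c < p \<Longrightarrow> (\<lambda>w. a w c) \<in> borel_measurable N"
  shows "(\<lambda>w. quad p S (a w)) \<in> borel_measurable N"
  using assms unfolding quad_def by (intro borel_measurable_sum borel_measurable_times) auto

locale gaussian_design = prob_space M for M :: "'w measure" +
  fixes n p :: nat and x :: "nat \<Rightarrow> 'w \<Rightarrow> nat \<Rightarrow> real" and S :: "nat \<Rightarrow> nat \<Rightarrow> real"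
  assumes indep: "indep_vars (\<lambda>_. vecM p) x {..<n}"
    and row_law: "\<And>i. i < n \<Longrightarrow> gaussian_law (distr M (vecM p) (x i)) p S"
    and sym: "\<And>c d. c < p \<Longrightarrow> d < p \<Longrightarrow> S c d = S d c"
    and psd: "\<And>a. 0 \<le> quad p S a"
begin

abbreviation rows :: "'w \<Rightarrow> nat \<Rightarrow> nat \<Rightarrow> real" where "rows w \<equiv> \<lambda>j. x j w"

abbreviation othersM :: "nat \<Rightarrow> (nat \<Rightarrow> nat \<Rightarrow> real) measure" where
  "othersM i \<equiv> PiM ({..<n} - {i}) (\<lambda>_. vecM p)"

abbreviation other_rows :: "nat \<Rightarrow> 'w \<Rightarrow> nat \<Rightarrow> nat \<Rightarrow> real" where
  "other_rows i w \<equiv> restrict (\<lambda>j. x j w) ({..<n} - {i})"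

abbreviation loo :: "real \<Rightarrow> nat \<Rightarrow> 'w \<Rightarrow> (nat \<Rightarrow> real) \<Rightarrow> nat \<Rightarrow> real" where
  "loo r i w b \<equiv> resolvent p r (rows w) (others n i) b"

abbreviation full :: "real \<Rightarrow> 'w \<Rightarrow> (nat \<Rightarrow> real) \<Rightarrow> nat \<Rightarrow> real" where
  "full r w b \<equiv> resolvent p r (rows w) [0..<n] b"

lemma row_measurable: "i < n \<Longrightarrow> x i \<in> measurable M (vecM p)"
  using indep by (auto simp: indep_vars_def)

lemma entry_measurable: "i < n \<Longrightarrow> c < p \<Longrightarrow> (\<lambda>w. x i w c) \<in> borel_measurable M"
  by (rule measurable_compose[OF row_measurable measurable_component_singleton]) auto

lemma loo_measurable: "c < p \<Longrightarrow> (\<lambda>w. loo r i w b c) \<in> borel_measurable M"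
  by (rule measurable_resolvent) (auto simp: others entry_measurable)

lemma full_measurable: "c < p \<Longrightarrow> (\<lambda>w. full r w b c) \<in> borel_measurable M"
  by (rule measurable_resolvent) (auto simp: entry_measurable)

lemma full_row_measurable: "i < n \<Longrightarrow> c < p \<Longrightarrow> (\<lambda>w. full r w (x i w) c) \<in> borel_measurable M"
  by (rule measurable_resolvent) (auto simp: entry_measurable)

text \<open>Independence of the rows, in the form in which it is used: one row may be averaged out first while all
others are held fixed.\<close>

lemma row_fubini:
  fixes f :: "(nat \<Rightarrow> nat \<Rightarrow> real) \<times> (nat \<Rightarrow> real) \<Rightarrow> ennreal"
  assumes i: "i < n" and f[measurable]: "f \<in> borel_measurable (othersM i \<Otimes>\<^sub>M vecM p)"
  shows "(\<integral>\<^sup>+w. f (other_rows i w, x i w) \<partial>M)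
       = (\<integral>\<^sup>+w. (\<integral>\<^sup>+y. f (other_rows i w, y) \<partial>distr M (vecM p) (x i)) \<partial>M)"
proof -
  interpret G: gaussian_law "distr M (vecM p) (x i)" p S by (rule row_law[OF i])
  let ?I = "PiM {i} (\<lambda>_. vecM p)" and ?x = "\<lambda>w. restrict (\<lambda>j. x j w) {i}"
  have iv: "indep_var (othersM i) (other_rows i) ?I ?x"
    by (rule indep_var_restrict[OF indep]) (use i in auto)
  have O: "other_rows i \<in> measurable M (othersM i)" and X': "?x \<in> measurable M ?I"
    using iv by (auto dest: indep_var_rv1 indep_var_rv2)
  have X: "x i \<in> measurable M (vecM p)" by (rule row_measurable[OF i])
  have eq: "distr M (othersM i) (other_rows i) \<Otimes>\<^sub>M distr M ?I ?x
     = distr M (othersM i \<Otimes>\<^sub>M ?I) (\<lambda>w. (other_rows i w, ?x w))"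
    using iv by (simp add: indep_var_distribution_eq)
  interpret I: prob_space "distr M ?I ?x" by (rule prob_space_distr[OF X'])
  have c: "(\<lambda>y. y i) \<in> measurable ?I (vecM p)" by (rule measurable_component_singleton) simp
  have f': "(\<lambda>zy. f (fst zy, snd zy i)) \<in> borel_measurable (othersM i \<Otimes>\<^sub>M ?I)"
    by (intro measurable_compose[OF _ f] measurable_Pair measurable_fst measurable_compose[OF measurable_snd c])
  have "(\<integral>\<^sup>+w. f (other_rows i w, x i w) \<partial>M)
      = (\<integral>\<^sup>+zy. f (fst zy, snd zy i) \<partial>distr M (othersM i \<Otimes>\<^sub>M ?I) (\<lambda>w. (other_rows i w, ?x w)))"
    using O X' f' by (subst nn_integral_distr) auto
  also have "\<dots> = (\<integral>\<^sup>+zy. f (fst zy, snd zy i) \<partial>(distr M (othersM i) (other_rows i) \<Otimes>\<^sub>M distr M ?I ?x))"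
    unfolding eq ..
  also have "\<dots> = (\<integral>\<^sup>+z. (\<integral>\<^sup>+y. f (z, y i) \<partial>distr M ?I ?x) \<partial>distr M (othersM i) (other_rows i))"
    using f' by (subst I.nn_integral_fst[symmetric]) auto
  also have "\<dots> = (\<integral>\<^sup>+z. (\<integral>\<^sup>+y. f (z, y) \<partial>distr M (vecM p) (x i)) \<partial>distr M (othersM i) (other_rows i))"
  proof (rule nn_integral_cong)
    fix z assume "z \<in> space (distr M (othersM i) (other_rows i))"
    then have z: "z \<in> space (othersM i)" by simp
    have fz: "(\<lambda>y. f (z, y)) \<in> borel_measurable (vecM p)"
      by (rule measurable_compose[OF measurable_Pair1'[OF z] f])
    have "(\<integral>\<^sup>+y. f (z, y i) \<partial>distr M ?I ?x) = (\<integral>\<^sup>+w. f (z, x i w) \<partial>M)"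
      using measurable_compose[OF c fz] X' by (subst nn_integral_distr) auto
    also have "\<dots> = (\<integral>\<^sup>+y. f (z, y) \<partial>distr M (vecM p) (x i))"
      using fz X by (subst nn_integral_distr) auto
    finally show "(\<integral>\<^sup>+y. f (z, y i) \<partial>distr M ?I ?x) = (\<integral>\<^sup>+y. f (z, y) \<partial>distr M (vecM p) (x i))" .
  qed
  also have "\<dots> = (\<integral>\<^sup>+w. (\<integral>\<^sup>+y. f (other_rows i w, y) \<partial>distr M (vecM p) (x i)) \<partial>M)"
    using O by (subst nn_integral_distr) (auto intro!: G.borel_measurable_nn_integral)
  finally show ?thesis .
qed

lemma loo_eq: "c < p \<Longrightarrow> resolvent p r (other_rows i w) (others n i) b c = loo r i w b c"
  by (rule resolvent_cong) (auto simp: others)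

lemma entry_othersM:
  "j < n \<Longrightarrow> j \<noteq> i \<Longrightarrow> c < p \<Longrightarrow> (\<lambda>z. z j c) \<in> borel_measurable (othersM i)"
  by (rule measurable_compose[of "\<lambda>z. z j" _ "vecM p" "\<lambda>y. y c"])
     (auto intro!: measurable_component_singleton)

lemma loo_othersM:
  "c < p \<Longrightarrow> (\<lambda>z. resolvent p r z (others n i) b c) \<in> borel_measurable (othersM i)"
  by (rule measurable_resolvent[where x = "\<lambda>z. z"]) (auto simp: others intro: entry_othersM)

text \<open>A is a function of the other rows, hence constant while row i is averaged out, and the Gaussian tail
applies to the projection of row i on it.\<close>

lemma independent_projection_tail:
  assumes i: "i < n" and L: "0 < L"
    and a: "\<And>c. c < p \<Longrightarrow> (\<lambda>z. a z c) \<in> borel_measurable (othersM i)"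
    and eq: "\<And>w c. c < p \<Longrightarrow> a (other_rows i w) c = A w c"
  shows "measure M {w \<in> space M. L\<^sup>2 * quad p S (A w) < (dot p (A w) (x i w))\<^sup>2}
       \<le> fact (2 * m) / (2 ^ m * fact m) / L ^ (2 * m)" (is "_ \<le> ?C")
    and "{w \<in> space M. L\<^sup>2 * quad p S (A w) < (dot p (A w) (x i w))\<^sup>2} \<in> events" (is "?E \<in> _")
proof -
  interpret G: gaussian_law "distr M (vecM p) (x i)" p S by (rule row_law[OF i])
  have "other_rows i \<in> measurable M (othersM i)" by (auto intro!: measurable_restrict row_measurable)
  from measurable_compose[OF this a] have A: "(\<lambda>w. A w c) \<in> borel_measurable M" if "c < p" for c
    using that by (simp add: eq)
  have q: "(\<lambda>w. quad p S (A w)) \<in> borel_measurable M" by (intro measurable_quad A)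
  have d: "(\<lambda>w. dot p (A w) (x i w)) \<in> borel_measurable M" by (intro measurable_dot A entry_measurable i)
  show E: "?E \<in> events" using q d by measurable
  define f :: "(nat \<Rightarrow> nat \<Rightarrow> real) \<times> (nat \<Rightarrow> real) \<Rightarrow> ennreal" where
    "f = (\<lambda>zy. if L\<^sup>2 * quad p S (a (fst zy)) < (dot p (a (fst zy)) (snd zy))\<^sup>2 then 1 else 0)"
  have aq: "(\<lambda>zy. quad p S (a (fst zy))) \<in> borel_measurable (othersM i \<Otimes>\<^sub>M vecM p)"
    by (intro measurable_quad measurable_compose[OF measurable_fst a])
  have ad: "(\<lambda>zy. dot p (a (fst zy)) (snd zy)) \<in> borel_measurable (othersM i \<Otimes>\<^sub>M vecM p)"
    by (intro measurable_dot measurable_compose[OF measurable_fst a]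
        measurable_compose[OF measurable_snd measurable_component_singleton]) auto
  have f: "f \<in> borel_measurable (othersM i \<Otimes>\<^sub>M vecM p)" unfolding f_def using aq ad by measurable
  have qA: "quad p S (a (other_rows i w)) = quad p S (A w)" for w by (rule quad_cong) (rule eq)
  have dA: "dot p (a (other_rows i w)) y = dot p (A w) y" for w y by (rule dot_cong) (auto simp: eq)
  have "emeasure M ?E = (\<integral>\<^sup>+w. indicator ?E w \<partial>M)" using E by simp
  also have "\<dots> = (\<integral>\<^sup>+w. f (other_rows i w, x i w) \<partial>M)"
    by (intro nn_integral_cong) (auto simp: f_def qA dA indicator_def)
  also have "\<dots> = (\<integral>\<^sup>+w. (\<integral>\<^sup>+y. f (other_rows i w, y) \<partial>distr M (vecM p) (x i)) \<partial>M)"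
    by (rule row_fubini[OF i f])
  also have "\<dots> \<le> (\<integral>\<^sup>+w. ennreal ?C \<partial>M)"
  proof (intro nn_integral_mono)
    fix w
    let ?B = "{y \<in> space (distr M (vecM p) (x i)). L\<^sup>2 * quad p S (A w) < (dot p (A w) y)\<^sup>2}"
    have B: "?B \<in> G.events" by measurable
    have "(\<integral>\<^sup>+y. f (other_rows i w, y) \<partial>distr M (vecM p) (x i)) = (\<integral>\<^sup>+y. indicator ?B y \<partial>distr M (vecM p) (x i))"
      by (intro nn_integral_cong) (auto simp: f_def qA dA indicator_def)
    also have "\<dots> = emeasure (distr M (vecM p) (x i)) ?B" by (rule nn_integral_indicator[OF B])
    also have "\<dots> \<le> ennreal ?C"
      unfolding G.emeasure_eq_measure by (intro ennreal_leI G.tail_bound L)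
    finally show "(\<integral>\<^sup>+y. f (other_rows i w, y) \<partial>distr M (vecM p) (x i)) \<le> ennreal ?C" .
  qed
  also have "\<dots> = ennreal ?C" by (simp add: emeasure_space_1)
  finally show "measure M ?E \<le> ?C" using L by (simp add: emeasure_eq_measure)
qed

lemma solves_full: "0 < r \<Longrightarrow> solves p r (rows w) {..<n} b (full r w b)"
  using resolvent_solves[of "[0..<n]" r p "rows w" b] by (simp add: lessThan_atLeast0)

lemma solves_loo: "0 < r \<Longrightarrow> solves p r (rows w) ({..<n} - {i}) b (loo r i w b)"
  using resolvent_solves[OF others(2), of r p "rows w" n i b] by (simp add: others)

text \<open>By \<open>solves_fit_le\<close> the squared fits x_i \<bullet> R b add up to at most
\<parallel>b\<parallel>^2 / (2 r). Each of them is the squared projection of row i on the leave-one-out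
solution, damped by the leverage; averaged over row i alone it is at least half of the quadratic form of
that solution.\<close>

lemma loo_average:
  assumes r: "0 < r" "12 * (\<Sum>c<p. S c c) \<le> r"
  shows "(\<integral>\<^sup>+w. ennreal (\<Sum>i<n. quad p S (loo r i w b)) \<partial>M) \<le> ennreal (dot p b b / r)"
proof -
  have mq: "(\<lambda>w. quad p S (loo r i w b)) \<in> borel_measurable M" for i
    by (intro measurable_quad loo_measurable)
  have mf: "(\<lambda>w. dot p (x i w) (full r w b)) \<in> borel_measurable M" if "i < n" for i
    by (intro measurable_dot full_measurable entry_measurable that)
  have one: "(\<integral>\<^sup>+w. ennreal (quad p S (loo r i w b) / 2) \<partial>M) \<le> (\<integral>\<^sup>+w. ennreal ((dot p (x i w) (full r w b))\<^sup>2) \<partial>M)"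
    if i: "i < n" for i
  proof -
    interpret G: gaussian_law "distr M (vecM p) (x i)" p S by (rule row_law[OF i])
    define a where "a = (\<lambda>z. resolvent p r z (others n i) b)"
    define f :: "(nat \<Rightarrow> nat \<Rightarrow> real) \<times> (nat \<Rightarrow> real) \<Rightarrow> ennreal" where
      "f = (\<lambda>zy. ennreal ((dot p (a (fst zy)) (snd zy))\<^sup>2 / (1 + dot p (snd zy) (snd zy) / r)\<^sup>2))"
    have sy: "(\<lambda>zy. snd zy c) \<in> borel_measurable (othersM i \<Otimes>\<^sub>M vecM p)" if "c < p" for c
      using that by (intro measurable_compose[OF measurable_snd measurable_component_singleton]) auto
    have ad: "(\<lambda>zy. dot p (a (fst zy)) (snd zy)) \<in> borel_measurable (othersM i \<Otimes>\<^sub>M vecM p)"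
      unfolding a_def by (intro measurable_dot measurable_compose[OF measurable_fst loo_othersM] sy)
    have yy: "(\<lambda>zy. dot p (snd zy) (snd zy)) \<in> borel_measurable (othersM i \<Otimes>\<^sub>M vecM p)"
      by (intro measurable_dot sy)
    have f: "f \<in> borel_measurable (othersM i \<Otimes>\<^sub>M vecM p)"
      unfolding f_def using ad yy by measurable
    have dA: "dot p (a (other_rows i w)) y = dot p (loo r i w b) y" for w y
      unfolding a_def by (rule dot_cong) (auto simp: loo_eq)
    have "(\<integral>\<^sup>+w. ennreal (quad p S (loo r i w b) / 2) \<partial>M)
        \<le> (\<integral>\<^sup>+w. (\<integral>\<^sup>+y. f (other_rows i w, y) \<partial>distr M (vecM p) (x i)) \<partial>M)"
      by (intro nn_integral_mono) (simp add: f_def dA G.damped_second_moment[OF r(2,1)])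
    also have "\<dots> = (\<integral>\<^sup>+w. f (other_rows i w, x i w) \<partial>M)" by (rule row_fubini[OF i f, symmetric])
    also have "\<dots> \<le> (\<integral>\<^sup>+w. ennreal ((dot p (x i w) (full r w b))\<^sup>2) \<partial>M)"
    proof (intro nn_integral_mono)
      fix w
      let ?z = "loo r i w (x i w)"
      have ins: "insert i ({..<n} - {i}) = {..<n}" using i by auto
      have z: "solves p r (rows w) ({..<n} - {i}) (x i w) ?z" by (rule solves_loo[OF r(1)])
      have g: "0 \<le> dot p (x i w) ?z" by (rule solves_nonneg[OF z r(1)])
      \<comment> \<open>The leverage is at most the squared norm of the row over r, which does not involve the other rows.\<close>
      have "r * dot p ?z ?z \<le> dot p (x i w) ?z"
        using solves_energy[OF z] sum_nonneg[of "{..<n}-{i}" "\<lambda>j. (dot p (x j w) ?z)\<^sup>2"] by simp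
      then have g': "dot p (x i w) ?z \<le> dot p (x i w) (x i w) / r"
        using dot_le_weighted[OF r(1), of p "x i w" ?z] by linarith
      have "dot p (x i w) (full r w b) = dot p (x i w) (loo r i w b) / (1 + dot p (x i w) ?z)"
        using leave_one_out(2)[OF _ solves_loo[OF r(1), of w i b] z _ _ r(1)] solves_full[OF r(1)] ins by simp
      then have eq: "(dot p (x i w) (full r w b))\<^sup>2 = (dot p (x i w) (loo r i w b))\<^sup>2 / (1 + dot p (x i w) ?z)\<^sup>2"
        by (simp add: power_divide)
      have "(dot p (x i w) (loo r i w b))\<^sup>2 / (1 + dot p (x i w) (x i w) / r)\<^sup>2
          \<le> (dot p (x i w) (loo r i w b))\<^sup>2 / (1 + dot p (x i w) ?z)\<^sup>2"
        using g g' by (intro divide_left_mono power_mono) auto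
      then show "f (other_rows i w, x i w) \<le> ennreal ((dot p (x i w) (full r w b))\<^sup>2)"
        unfolding eq by (simp add: f_def dA dot_commute[of p "loo r i w b"])
    qed
    finally show ?thesis .
  qed
  have "(\<integral>\<^sup>+w. ennreal (\<Sum>i<n. quad p S (loo r i w b)) \<partial>M)
      = (\<integral>\<^sup>+w. 2 * (\<Sum>i<n. ennreal (quad p S (loo r i w b) / 2)) \<partial>M)"
  proof (intro nn_integral_cong)
    fix w
    have "2 * (\<Sum>i<n. ennreal (quad p S (loo r i w b) / 2)) = ennreal 2 * ennreal (\<Sum>i<n. quad p S (loo r i w b) / 2)"
      using psd by (simp add: sum_ennreal)
    also have "\<dots> = ennreal (2 * (\<Sum>i<n. quad p S (loo r i w b) / 2))" by (rule ennreal_mult'[symmetric]) simp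
    finally show "ennreal (\<Sum>i<n. quad p S (loo r i w b)) = 2 * (\<Sum>i<n. ennreal (quad p S (loo r i w b) / 2))"
      by (simp flip: sum_divide_distrib)
  qed
  also have "\<dots> = 2 * (\<Sum>i<n. \<integral>\<^sup>+w. ennreal (quad p S (loo r i w b) / 2) \<partial>M)"
    using mq by (subst nn_integral_cmult) (auto simp: nn_integral_sum intro!: borel_measurable_sum)
  also have "\<dots> \<le> 2 * (\<Sum>i<n. \<integral>\<^sup>+w. ennreal ((dot p (x i w) (full r w b))\<^sup>2) \<partial>M)"
    by (intro mult_left_mono sum_mono one) auto
  also have "\<dots> = 2 * (\<integral>\<^sup>+w. (\<Sum>i<n. ennreal ((dot p (x i w) (full r w b))\<^sup>2)) \<partial>M)"
    using mf by (subst nn_integral_sum) auto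
  also have "\<dots> \<le> 2 * (\<integral>\<^sup>+w. ennreal (dot p b b / (2 * r)) \<partial>M)"
  proof (intro mult_left_mono nn_integral_mono)
    fix w
    have "(\<Sum>i<n. ennreal ((dot p (x i w) (full r w b))\<^sup>2)) = ennreal (\<Sum>i<n. (dot p (x i w) (full r w b))\<^sup>2)"
      by (simp add: sum_ennreal)
    also have "\<dots> \<le> ennreal (dot p b b / (2 * r))"
      by (intro ennreal_leI solves_fit_le[OF solves_full r(1)] r(1))
    finally show "(\<Sum>i<n. ennreal ((dot p (x i w) (full r w b))\<^sup>2)) \<le> ennreal (dot p b b / (2 * r))" .
  qed auto
  also have "\<dots> = ennreal 2 * ennreal (dot p b b / (2 * r))" by (simp add: emeasure_space_1)
  also have "\<dots> = ennreal (dot p b b / r)"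
    by (subst ennreal_mult'[symmetric]) (simp_all)
  finally show ?thesis .
qed

end

lemma finite_union_bound:
  assumes "prob_space M" "finite I" "\<And>i. i \<in> I \<Longrightarrow> A i \<in> sets M" "\<And>i. i \<in> I \<Longrightarrow> measure M (A i) \<le> e"
  shows "measure M (\<Union>i\<in>I. A i) \<le> real (card I) * e"
proof -
  interpret prob_space M by fact
  have "measure M (\<Union>i\<in>I. A i) \<le> (\<Sum>i\<in>I. measure M (A i))"
    using assms by (intro finite_measure_subadditive_finite) auto
  also have "\<dots> \<le> (\<Sum>i\<in>I. e)" using assms by (intro sum_mono) auto
  finally show ?thesis by simp
qed

context gaussian_design
begin

text \<open>Markov's inequality for \<open>loo_average\<close>, summed over finitely many right-hand sides.\<close>

lemma loo_average_tail:
  assumes r: "0 < r" "12 * (\<Sum>c<p. S c c) \<le> r" and t: "0 < t"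
    and b: "(\<Sum>j\<in>J. dot p (b j) (b j)) \<le> B" "0 < B" and fin: "finite J"
  shows "measure M {w \<in> space M. t * B / r < (\<Sum>i<n. \<Sum>j\<in>J. quad p S (loo r i w (b j)))} \<le> 1 / t" (is "measure M ?E \<le> _")
    and "{w \<in> space M. t * B / r < (\<Sum>i<n. \<Sum>j\<in>J. quad p S (loo r i w (b j)))} \<in> events"
proof -
  have mq: "(\<lambda>w. quad p S (loo r i w a)) \<in> borel_measurable M" for i a
    by (intro measurable_quad loo_measurable)
  define Z where "Z = (\<lambda>w. \<Sum>i<n. \<Sum>j\<in>J. quad p S (loo r i w (b j)))"
  have Z[measurable]: "Z \<in> borel_measurable M"
    unfolding Z_def by (intro borel_measurable_sum mq)
  have Z0: "0 \<le> Z w" for w unfolding Z_def by (intro sum_nonneg psd)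
  have "{w \<in> space M. t * B / r < Z w} \<in> events" by measurable
  then show "?E \<in> events" by (simp add: Z_def)
  have EZ: "(\<integral>\<^sup>+w. ennreal (Z w) \<partial>M) \<le> ennreal (B / r)"
  proof -
    have "(\<integral>\<^sup>+w. ennreal (Z w) \<partial>M) = (\<integral>\<^sup>+w. (\<Sum>j\<in>J. ennreal (\<Sum>i<n. quad p S (loo r i w (b j)))) \<partial>M)"
      unfolding Z_def by (subst sum.swap) (simp add: sum_ennreal sum_nonneg psd)
    also have "\<dots> = (\<Sum>j\<in>J. \<integral>\<^sup>+w. ennreal (\<Sum>i<n. quad p S (loo r i w (b j))) \<partial>M)"
      by (intro nn_integral_sum measurable_compose[OF _ measurable_ennreal] borel_measurable_sum mq)
    also have "\<dots> \<le> (\<Sum>j\<in>J. ennreal (dot p (b j) (b j) / r))"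
      by (intro sum_mono loo_average r)
    also have "\<dots> = ennreal ((\<Sum>j\<in>J. dot p (b j) (b j)) / r)"
      using r by (simp add: sum_ennreal dot_self_nonneg sum_divide_distrib)
    also have "\<dots> \<le> ennreal (B / r)" using b r by (intro ennreal_leI divide_right_mono) auto
    finally show ?thesis .
  qed
  have "emeasure M ?E \<le> emeasure M {w \<in> space M. 1 \<le> ennreal (r / (t * B)) * ennreal (Z w)}"
  proof (intro emeasure_mono subsetI)
    fix w assume w: "w \<in> ?E"
    then have "1 \<le> r / (t * B) * Z w" using r t b by (auto simp: Z_def field_simps)
    then have "ennreal 1 \<le> ennreal (r / (t * B) * Z w)" by (rule ennreal_leI)
    also have "\<dots> = ennreal (r / (t * B)) * ennreal (Z w)" using r t b Z0 by (intro ennreal_mult) auto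
    finally show "w \<in> {w \<in> space M. 1 \<le> ennreal (r / (t * B)) * ennreal (Z w)}" using w by simp
  qed measurable
  also have "\<dots> \<le> ennreal (r / (t * B)) * (\<integral>\<^sup>+w. ennreal (Z w) * indicator (space M) w \<partial>M)"
    using nn_integral_Markov_inequality[of "\<lambda>w. ennreal (Z w)" "space M" M "ennreal (r / (t * B))"] by simp
  also have "(\<integral>\<^sup>+w. ennreal (Z w) * indicator (space M) w \<partial>M) = (\<integral>\<^sup>+w. ennreal (Z w) \<partial>M)"
    by (intro nn_integral_cong) auto
  also have "ennreal (r / (t * B)) * \<dots> \<le> ennreal (r / (t * B)) * ennreal (B / r)"
    using EZ by (intro mult_left_mono) auto
  also have "\<dots> = ennreal (1 / t)" using r t b by (subst ennreal_mult[symmetric]) (auto simp: field_simps)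
  finally show "measure M ?E \<le> 1 / t" using t by (simp add: emeasure_eq_measure)
qed

text \<open>A union bound over the events that make a design untypical. K bounds the quotient of squared bias and
variance, and Cm is the tail of one Gaussian projection at level L; there are np coordinates, n (1 + k)
leave-one-out projections and n^2 cross terms. The two averages over the rows exceed t times the bounds
on their means with probability at most 1 / t each.\<close>

theorem bias_le_fit_prob:
  fixes \<beta> :: "nat \<Rightarrow> real" and v :: "nat \<Rightarrow> nat \<Rightarrow> real"
  defines "K \<equiv> \<lambda>L r t bb k. 192 * L^4 * r * t * bb / real k"
    and "Cm \<equiv> \<lambda>m L. fact (2 * m) / (2 ^ m * fact m) / L ^ (2 * m)"
  assumes n: "0 < n" and r: "0 < r" "12 * (\<Sum>c<p. S c c) \<le> r" and L: "0 < L" and t: "0 < t" and k: "0 < k"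
    and small: "L\<^sup>2 * (\<Sum>c<p. S c c) / r \<le> 1 / 2" "48 * L\<^sup>2 * r * t * bv / real n \<le> real k / 4"
    and v: "\<And>g. quad p S (\<lambda>c. \<Sum>j<k. g j * v j c) = (\<Sum>j<k. (g j)\<^sup>2)"
    and bb: "dot p \<beta> \<beta> \<le> bb" "0 < bb" and bv: "(\<Sum>j<k. dot p (v j) (v j)) \<le> bv" "0 < bv"
  shows "1 - (real (n * p + n + n * k + n * n) * Cm m L + real n * (9/10) ^ k + 2 / t)
      \<le> measure M {w \<in> space M. \<forall>i<n. 0 < (\<Sum>l<n. (dot p (x l w) (full r w (x i w)))\<^sup>2) \<and>
           (r * dot p (x i w) (full r w \<beta>))\<^sup>2
             \<le> K L r t bb k * (\<Sum>l<n. (dot p (x l w) (full r w (x i w)))\<^sup>2)}"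
    (is "1 - ?e \<le> measure M ?G")
proof -
  define unit :: "nat \<Rightarrow> nat \<Rightarrow> real" where "unit = (\<lambda>c i. if i = c then 1 else 0)"
  have dot_unit: "dot p (unit c) y = y c" if "c < p" for c y
    using that by (simp add: dot_def unit_def if_distrib[of "\<lambda>t. t * _"] cong: if_cong)
  have quad_unit: "quad p S (unit c) = S c c" if "c < p" for c
    using that by (simp add: quad_def unit_def if_distrib[of "\<lambda>t. t * _"] if_distrib[of "\<lambda>t. _ * t"] cong: if_cong)
  define Q where "Q = (\<lambda>i w c. \<Sum>j<k. dot p (v j) (x i w) * v j c)"
  \<comment> \<open>Untypical are a large coordinate of a row (E1), a large projection on a leave-one-out solution (E2) or on
    the direction Q i of another row (E3), a small whitened energy (E4), and a large average for \<beta> (E5) or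
    for the vectors v j (E6).\<close>
  define E1 where "E1 = (\<lambda>(i,c). {w \<in> space M. L\<^sup>2 * quad p S (unit c) < (dot p (unit c) (x i w))\<^sup>2})"
  define E2 where "E2 = (\<lambda>b i. {w \<in> space M. L\<^sup>2 * quad p S (loo r i w b) < (dot p (loo r i w b) (x i w))\<^sup>2})"
  define E3 where "E3 = (\<lambda>(i,l). {w \<in> space M. l \<noteq> i \<and> L\<^sup>2 * quad p S (Q i w) < (dot p (Q i w) (x l w))\<^sup>2})"
  define E4 where "E4 = (\<lambda>i. {w \<in> space M. (\<Sum>j<k. (dot p (v j) (x i w))\<^sup>2) < real k / 4})"
  define E5 where "E5 = {w \<in> space M. t * bb / r < (\<Sum>i<n. \<Sum>j\<in>{0::nat}. quad p S (loo r i w \<beta>))}"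
  define E6 where "E6 = {w \<in> space M. t * bv / r < (\<Sum>i<n. \<Sum>j<k. quad p S (loo r i w (v j)))}"
  have C0: "0 \<le> Cm m L" using L by (simp add: Cm_def)
  have 1: "measure M (E1 ic) \<le> Cm m L" "E1 ic \<in> events" if "ic \<in> {..<n} \<times> {..<p}" for ic
  proof -
    obtain i c where ic: "ic = (i,c)" "i < n" "c < p" using \<open>ic \<in> {..<n} \<times> {..<p}\<close> by auto
    note * = independent_projection_tail[OF ic(2) L, where a = "\<lambda>_. unit c" and A = "\<lambda>_. unit c"]
    show "measure M (E1 ic) \<le> Cm m L" "E1 ic \<in> events"
      unfolding E1_def Cm_def ic using *(1)[of m] *(2) by simp_all
  qed
  have 2: "measure M (E2 b i) \<le> Cm m L" "E2 b i \<in> events" if "i < n" for b i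
    unfolding E2_def Cm_def
    by (rule independent_projection_tail[OF that L, where a = "\<lambda>z. resolvent p r z (others n i) b"]; simp add: loo_othersM loo_eq)+
  have 3: "measure M (E3 il) \<le> Cm m L \<and> E3 il \<in> events" if "il \<in> {..<n} \<times> {..<n}" for il
  proof -
    obtain i l where il: "il = (i,l)" "i < n" "l < n" using \<open>il \<in> {..<n} \<times> {..<n}\<close> by auto
    show ?thesis
    proof (cases "l = i")
      case False
      define a where "a = (\<lambda>z :: nat \<Rightarrow> nat \<Rightarrow> real. \<lambda>c. \<Sum>j<k. dot p (v j) (z i) * v j c)"
      have a: "(\<lambda>z. a z c) \<in> borel_measurable (othersM l)" for c
        unfolding a_def using il False
        by (intro borel_measurable_sum borel_measurable_times measurable_dot entry_othersM) auto
      have aQ: "a (other_rows l w) c = Q i w c" for w c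
        using il False by (simp add: a_def Q_def)
      show ?thesis
        using independent_projection_tail[OF \<open>l < n\<close> L a aQ] False unfolding E3_def il Cm_def by simp
    qed (simp add: E3_def il C0)
  qed
  have 4: "measure M (E4 i) \<le> (9/10) ^ k" "E4 i \<in> events" if i: "i < n" for i
  proof -
    interpret G: gaussian_law "distr M (vecM p) (x i)" p S by (rule row_law[OF i])
    have B: "{y \<in> space (vecM p). (\<Sum>j<k. (dot p (v j) y)\<^sup>2) < real k / 4} \<in> sets (vecM p)"
    proof -
      have [measurable]: "(\<lambda>y. dot p (v j) y) \<in> borel_measurable (vecM p)" for j
        by (rule measurable_dot) (auto intro: measurable_component_singleton)
      show ?thesis by measurable
    qed
    have X: "x i \<in> measurable M (vecM p)" by (rule row_measurable[OF i])
    have eq: "x i -` {y \<in> space (vecM p). (\<Sum>j<k. (dot p (v j) y)\<^sup>2) < real k / 4} \<inter> space M = E4 i"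
      using measurable_space[OF X] by (auto simp: E4_def)
    show "E4 i \<in> events" using measurable_sets[OF X B] unfolding eq .
    show "measure M (E4 i) \<le> (9/10) ^ k"
      using G.chi_square_lower_tail[OF v] measure_distr[OF X B] unfolding eq by simp
  qed
  have 5: "measure M E5 \<le> 1 / t" "E5 \<in> events"
    unfolding E5_def using loo_average_tail[OF r t, where J = "{0::nat}" and b = "\<lambda>_. \<beta>" and B = bb] bb by simp_all
  have 6: "measure M E6 \<le> 1 / t" "E6 \<in> events"
    unfolding E6_def using loo_average_tail[OF r t, where J = "{..<k}" and b = v and B = bv] bv by simp_all
  let ?U1 = "\<Union>ic\<in>{..<n}\<times>{..<p}. E1 ic" and ?U2 = "\<Union>i\<in>{..<n}. E2 \<beta> i"
    and ?U2' = "\<Union>ij\<in>{..<n}\<times>{..<k}. E2 (v (snd ij)) (fst ij)" and ?U3 = "\<Union>il\<in>{..<n}\<times>{..<n}. E3 il"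
    and ?U4 = "\<Union>i\<in>{..<n}. E4 i"
  have ev: "?U1 \<in> events" "?U2 \<in> events" "?U2' \<in> events" "?U3 \<in> events" "?U4 \<in> events"
    using 1 2 3 4 by (auto intro!: sets.finite_UN)
  note ub = finite_union_bound[OF prob_space_axioms]
  have m1: "measure M ?U1 \<le> real (n * p) * Cm m L"
    using ub[of "{..<n}\<times>{..<p}" E1 "Cm m L"] 1 by (simp add: card_cartesian_product)
  have m2: "measure M ?U2 \<le> real n * Cm m L"
    using ub[of "{..<n}" "E2 \<beta>" "Cm m L"] 2 by simp
  have m2': "measure M ?U2' \<le> real (n * k) * Cm m L"
    using ub[of "{..<n}\<times>{..<k}" "\<lambda>ij. E2 (v (snd ij)) (fst ij)" "Cm m L"] 2 by (auto simp: card_cartesian_product)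
  have m3: "measure M ?U3 \<le> real (n * n) * Cm m L"
    using ub[of "{..<n}\<times>{..<n}" E3 "Cm m L"] 3 by (simp add: card_cartesian_product)
  have m4: "measure M ?U4 \<le> real n * (9/10)^k"
    using ub[of "{..<n}" E4 "(9/10)^k"] 4 by simp
  define U where "U = ?U1 \<union> (?U2 \<union> (?U2' \<union> (?U3 \<union> (?U4 \<union> (E5 \<union> E6)))))"
  have U: "U \<in> events" unfolding U_def using ev 5 6 by auto
  have "measure M U \<le> measure M ?U1 + (measure M ?U2 + (measure M ?U2' + (measure M ?U3 + (measure M ?U4 + (measure M E5 + measure M E6)))))"
    unfolding U_def using ev 5 6
    by (intro order_trans[OF measure_Un_le] add_left_mono order_refl sets.Un) auto
  also have "\<dots> \<le> ?e"
    using m1 m2 m2' m3 m4 5(1) 6(1) by (simp add: distrib_right)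
  finally have mU: "measure M U \<le> ?e" .
  have G: "?G \<in> events"
  proof -
    have m: "(\<lambda>w. \<Sum>l<n. (dot p (x l w) (full r w (x i w)))\<^sup>2) \<in> borel_measurable M" if "i < n" for i
      using that by (intro borel_measurable_sum borel_measurable_power measurable_dot entry_measurable full_row_measurable) auto
    have m': "(\<lambda>w. dot p (x i w) (full r w \<beta>)) \<in> borel_measurable M" if "i < n" for i
      using that by (intro measurable_dot entry_measurable full_measurable) auto
    have "?G = {w \<in> space M. \<forall>i\<in>{..<n}. 0 < (\<Sum>l<n. (dot p (x l w) (full r w (x i w)))\<^sup>2) \<and>
           (r * dot p (x i w) (full r w \<beta>))\<^sup>2
             \<le> K L r t bb k * (\<Sum>l<n. (dot p (x l w) (full r w (x i w)))\<^sup>2)}" by auto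
    also have "\<dots> \<in> events"
    proof (rule sets.sets_Collect_finite_All)
      fix i assume "i \<in> {..<n}"
      then have i: "i < n" by simp
      note [measurable] = m[OF i] m'[OF i]
      show "{w \<in> space M. 0 < (\<Sum>l<n. (dot p (x l w) (full r w (x i w)))\<^sup>2) \<and>
           (r * dot p (x i w) (full r w \<beta>))\<^sup>2
             \<le> K L r t bb k * (\<Sum>l<n. (dot p (x l w) (full r w (x i w)))\<^sup>2)} \<in> events"
        by measurable
    qed simp
    finally show ?thesis .
  qed
  have "space M - U \<subseteq> ?G"
  proof
    fix w assume "w \<in> space M - U"
    then have w: "w \<in> space M" "w \<notin> U" by auto
    have quadQ: "quad p S (Q i w) = (\<Sum>j<k. (dot p (v j) (x i w))\<^sup>2)" for i
      unfolding Q_def by (rule v)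
    have norm: "dot p (x i w) (x i w) \<le> L\<^sup>2 * (\<Sum>c<p. S c c)" if "i < n" for i
    proof -
      have "dot p (x i w) (x i w) = (\<Sum>c<p. (x i w c)\<^sup>2)" by (simp add: dot_def power2_eq_square)
      also have "\<dots> \<le> (\<Sum>c<p. L\<^sup>2 * S c c)"
      proof (rule sum_mono)
        fix c assume "c \<in> {..<p}"
        then have c: "c < p" by simp
        have "w \<notin> E1 (i,c)" using w(2) that c unfolding U_def by blast
        then show "(x i w c)\<^sup>2 \<le> L\<^sup>2 * S c c" using w(1) c by (simp add: E1_def dot_unit quad_unit not_less)
      qed
      finally show ?thesis by (simp add: sum_distrib_left)
    qed
    have loo: "(dot p (x i w) (loo r i w b))\<^sup>2 \<le> L\<^sup>2 * quad p S (loo r i w b)"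
      if "i < n" "b \<in> insert \<beta> (v ` {..<k})" for i b
    proof -
      have "w \<notin> E2 \<beta> i" using w(2) that unfolding U_def by blast
      moreover have "w \<notin> E2 (v j) i" if "j < k" for j
      proof
        assume "w \<in> E2 (v j) i"
        then have "w \<in> ?U2'" using \<open>i < n\<close> that by (intro UN_I[of "(i,j)"]) auto
        then show False using w(2) unfolding U_def by blast
      qed
      ultimately have "w \<notin> E2 b i" using that by auto
      then show ?thesis using w(1) by (simp add: E2_def not_less dot_commute)
    qed
    have cross: "(dot p (x l w) (Q i w))\<^sup>2 \<le> L\<^sup>2 * (\<Sum>j<k. (dot p (v j) (x i w))\<^sup>2)" if "i < n" "l < n" "l \<noteq> i" for i l
    proof -
      have "w \<notin> E3 (i,l)" using w(2) that unfolding U_def by blast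
      then show ?thesis using w(1) that by (simp add: E3_def not_less dot_commute quadQ)
    qed
    have chi: "real k / 4 \<le> (\<Sum>j<k. (dot p (v j) (x i w))\<^sup>2)" if "i < n" for i
    proof -
      have "w \<notin> E4 i" using w(2) that unfolding U_def by blast
      then show ?thesis using w(1) by (simp add: E4_def not_less)
    qed
    have "w \<notin> E5" "w \<notin> E6" using w(2) unfolding U_def by blast+
    then have avg: "(\<Sum>i<n. quad p S (loo r i w \<beta>)) \<le> real n * (t * bb / r / real n)"
      "(\<Sum>i<n. \<Sum>j<k. quad p S (loo r i w (v j))) \<le> real n * (t * bv / r / real n)"
      using w(1) n by (simp_all add: E5_def E6_def not_less)
    have small2: "48 * L\<^sup>2 * r\<^sup>2 * (t * bv / r / real n) \<le> real k / 4"
      using small(2) r(1) by (simp add: power2_eq_square field_simps)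
    note typical = bias_le_fit_of_typical_design[where S = S and \<beta> = \<beta> and v = v and x = "rows w" and y = "\<lambda>i. loo r i w",
        OF psd sym r(1) L k solves_full[OF r(1)] solves_loo[OF r(1)] norm loo cross[unfolded Q_def] chi avg small(1) small2]
    have K: "192 * real n * L^4 * r\<^sup>2 * (t * bb / r / real n) / real k = K L r t bb k"
      using n r(1) by (simp add: K_def power2_eq_square)
    show "w \<in> ?G" using w(1) typical unfolding K by auto
  qed
  then have "measure M (space M - U) \<le> measure M ?G" by (intro finite_measure_mono G)
  then show ?thesis using mU prob_compl[OF U] by simp
qed

end

section \<open>The Mallows metric on the line\<close>

lemma cdf_distr:
  assumes "prob_space M" "f \<in> borel_measurable M"
  shows "cdf (distr M borel f) t = measure M {x \<in> space M. f x \<le> t}"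
  using assms(2) by (auto simp: cdf_def measure_distr intro!: arg_cong[where f = "measure M"])

text \<open>Polymorphic in the value, because it is integrated as an extended nonnegative number and summed as a
real one.\<close>

abbreviation crosses :: "real \<Rightarrow> real \<Rightarrow> real \<Rightarrow> 'a :: {zero, one}" where
  "crosses a b t \<equiv> if (a \<le> t) = (b \<le> t) then 0 else 1"

lemma nn_integral_between:
  fixes a b :: real
  shows "(\<integral>\<^sup>+t. crosses a b t \<partial>lborel) = ennreal \<bar>a - b\<bar>"
proof -
  have "(\<integral>\<^sup>+t. crosses a b t \<partial>lborel) = (\<integral>\<^sup>+t. indicator {min a b..<max a b} t \<partial>lborel)"
    by (intro nn_integral_cong) (auto simp: indicator_def min_def max_def)
  also have "\<dots> = ennreal (max a b - min a b)" by (subst nn_integral_indicator) auto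
  also have "max a b - min a b = \<bar>a - b\<bar>" by (auto simp: min_def max_def)
  finally show ?thesis .
qed

text \<open>If both quantile functions are evaluated at one uniform variable, then t lies between the two values
with probability equal to the difference of the distribution functions at t; now integrate over t.\<close>

lemma quantile_coupling:
  fixes F G :: "real measure"
  assumes "real_distribution F" "real_distribution G"
  shows "\<exists>\<pi>. sets \<pi> = sets (borel \<Otimes>\<^sub>M borel) \<and> distr \<pi> borel fst = F \<and> distr \<pi> borel snd = G \<and>
    (\<integral>\<^sup>+z. ennreal \<bar>fst z - snd z\<bar> \<partial>\<pi>) \<le> (\<integral>\<^sup>+t. ennreal \<bar>cdf F t - cdf G t\<bar> \<partial>lborel)"
proof -
  interpret F: cdf_distribution F using assms by (simp add: cdf_distribution_def)
  interpret G: cdf_distribution G using assms by (simp add: cdf_distribution_def)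
  \<comment> \<open>The uniform law on the unit interval.\<close>
  define U where "U = restrict_space lborel {0<..<1::real}"
  interpret U: prob_space U
    by (auto simp add: U_def emeasure_restrict_space space_restrict_space intro!: prob_spaceI)
  have spU: "space U = {0<..<1}" by (simp add: U_def space_restrict_space)
  have [measurable_cong]: "sets U = sets (restrict_space borel {0<..<1})"
    unfolding U_def by (intro sets_restrict_space_cong) simp
  have FI[measurable]: "F.I \<in> borel_measurable U" and GI[measurable]: "G.I \<in> borel_measurable U"
    using F.measurable_CI G.measurable_CI by measurable
  define \<pi> where "\<pi> = distr U (borel \<Otimes>\<^sub>M borel) (\<lambda>u. (F.I u, G.I u))"
  have m: "(\<lambda>u. (F.I u, G.I u)) \<in> U \<rightarrow>\<^sub>M borel \<Otimes>\<^sub>M borel" by measurable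
  have 1: "distr \<pi> borel fst = F" unfolding \<pi>_def
    using F.distr_I_eq_M by (subst distr_distr) (auto simp: comp_def U_def)
  have 2: "distr \<pi> borel snd = G" unfolding \<pi>_def
    using G.distr_I_eq_M by (subst distr_distr) (auto simp: comp_def U_def)
  interpret pair_sigma_finite lborel U ..
  have eqF: "F.I u \<le> t \<longleftrightarrow> u \<le> F.C t" and eqG: "G.I u \<le> t \<longleftrightarrow> u \<le> G.C t" if "u \<in> space U" for u t
    using F.pseudoinverse[of u t] G.pseudoinverse[of u t] that by (auto simp: spU)
  have "(\<integral>\<^sup>+z. ennreal \<bar>fst z - snd z\<bar> \<partial>\<pi>) = (\<integral>\<^sup>+u. ennreal \<bar>F.I u - G.I u\<bar> \<partial>U)"
    unfolding \<pi>_def by (subst nn_integral_distr) auto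
  also have "\<dots> = (\<integral>\<^sup>+u. (\<integral>\<^sup>+t. crosses (F.I u) (G.I u) t \<partial>lborel) \<partial>U)"
    by (simp only: nn_integral_between)
  also have "\<dots> = (\<integral>\<^sup>+t. (\<integral>\<^sup>+u. crosses (F.I u) (G.I u) t \<partial>U) \<partial>lborel)"
    by (rule Fubini') measurable
  also have "\<dots> \<le> (\<integral>\<^sup>+t. ennreal \<bar>cdf F t - cdf G t\<bar> \<partial>lborel)"
  proof (rule nn_integral_mono)
    fix t
    let ?A = "{min (F.C t) (G.C t)<..max (F.C t) (G.C t)}"
    have "(\<integral>\<^sup>+u. crosses (F.I u) (G.I u) t \<partial>U) = (\<integral>\<^sup>+u. indicator ?A u \<partial>U)"
      by (intro nn_integral_cong) (auto simp: eqF eqG indicator_def min_def max_def)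
    also have "\<dots> = (\<integral>\<^sup>+u. indicator ?A u * indicator {0<..<1} u \<partial>lborel)"
      unfolding U_def by (rule nn_integral_restrict_space) auto
    also have "\<dots> \<le> (\<integral>\<^sup>+u. indicator ?A u \<partial>lborel)"
      by (intro nn_integral_mono) (auto simp: indicator_def)
    also have "\<dots> = ennreal \<bar>cdf F t - cdf G t\<bar>"
      by (subst nn_integral_indicator) (auto simp: min_def max_def)
    finally show "(\<integral>\<^sup>+u. crosses (F.I u) (G.I u) t \<partial>U) \<le> ennreal \<bar>cdf F t - cdf G t\<bar>" .
  qed
  finally show ?thesis using 1 2 by (intro exI[of _ \<pi>]) (auto simp: \<pi>_def)
qed

text \<open>An increasing bijection of the line under which squared distances become at most twice distances.\<close>

definition signed_square :: "real \<Rightarrow> real" where "signed_square x = x * \<bar>x\<bar>"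

lemma signed_square_measurable [measurable]: "signed_square \<in> borel_measurable borel"
  unfolding signed_square_def by measurable

lemma signed_square_root: "sgn (signed_square x) * sqrt \<bar>signed_square x\<bar> = x"
  by (simp add: signed_square_def abs_mult sgn_mult real_sqrt_abs2 mult_sgn_abs flip: power2_eq_square)

text \<open>If x and y have the same sign, the right-hand side is 2 \<bar>x - y\<bar> \<bar>x + y\<bar>; otherwise
it is 2 x^2 + 2 y^2.\<close>

lemma sq_diff_le_signed_square: "(x - y)\<^sup>2 \<le> 2 * \<bar>signed_square x - signed_square y\<bar>"
proof -
  have *: "(x - y)\<^sup>2 \<le> 2 * \<bar>signed_square x - signed_square y\<bar>" if "y \<le> x" for x y :: real
  proof -
    consider "0 \<le> y" | "x \<le> 0" | "y \<le> 0" "0 \<le> x" by linarith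
    then show ?thesis
    proof cases
      case 1
      have "(x - y) * (x - y) \<le> (x - y) * (x + y)" using 1 that by (intro mult_left_mono) auto
      moreover have "0 \<le> (x - y) * (x + y)" using 1 that by simp
      ultimately show ?thesis using 1 that by (simp add: signed_square_def power2_eq_square algebra_simps)
    next
      case 2
      have "(x - y) * (x - y) \<le> (x - y) * (- x - y)" using 2 that by (intro mult_left_mono) auto
      moreover have "0 \<le> (x - y) * (- x - y)" using 2 that by simp
      ultimately show ?thesis using 2 that by (simp add: signed_square_def power2_eq_square algebra_simps)
    next
      case 3
      have "0 \<le> (x + y)\<^sup>2" "0 \<le> x * x" "0 \<le> y * y" by auto
      then show ?thesis using 3 by (simp add: signed_square_def power2_eq_square algebra_simps)
    qed
  qed
  show ?thesis using *[of x y] *[of y x] by (cases "y \<le> x") (auto simp: power2_commute abs_minus_commute)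
qed

lemma signed_square_diff_le: "\<bar>signed_square x - signed_square y\<bar> \<le> \<bar>y - x\<bar> * (2 * \<bar>x\<bar> + \<bar>y - x\<bar>)"
proof -
  have "signed_square x - signed_square y = (x - y) * \<bar>x\<bar> + y * (\<bar>x\<bar> - \<bar>y\<bar>)"
    by (simp add: signed_square_def algebra_simps)
  then have "\<bar>signed_square x - signed_square y\<bar> \<le> \<bar>x - y\<bar> * \<bar>x\<bar> + \<bar>y\<bar> * \<bar>\<bar>x\<bar> - \<bar>y\<bar>\<bar>"
    by (metis abs_abs abs_mult abs_triangle_ineq)
  also have "\<dots> \<le> \<bar>x - y\<bar> * \<bar>x\<bar> + (\<bar>x\<bar> + \<bar>y - x\<bar>) * \<bar>y - x\<bar>"
    by (intro add_left_mono mult_mono) auto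
  finally show ?thesis by (simp add: algebra_simps abs_minus_commute)
qed

text \<open>The quantile coupling of the image laws under \<open>signed_square\<close>, pulled back along the
inverse map.\<close>

lemma d2_sq_le_cdf:
  fixes F G :: "real measure"
  assumes "real_distribution F" "real_distribution G"
  shows "d2_sq F G \<le> 2 * (\<integral>\<^sup>+t. ennreal \<bar>cdf (distr F borel signed_square) t - cdf (distr G borel signed_square) t\<bar> \<partial>lborel)"
proof -
  interpret F: real_distribution F by fact
  interpret G: real_distribution G by fact
  define r :: "real \<Rightarrow> real" where "r = (\<lambda>y. sgn y * sqrt \<bar>y\<bar>)"
  have [measurable]: "r \<in> borel_measurable borel" unfolding r_def by measurable
  have r: "r (signed_square x) = x" for x using signed_square_root by (simp add: r_def)
  have r': "signed_square (r x) = x" for x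
    by (simp add: r_def signed_square_def abs_mult sgn_if)
  obtain \<pi> where \<pi>: "sets \<pi> = sets (borel \<Otimes>\<^sub>M borel)" "distr \<pi> borel fst = distr F borel signed_square"
     "distr \<pi> borel snd = distr G borel signed_square"
     "(\<integral>\<^sup>+z. ennreal \<bar>fst z - snd z\<bar> \<partial>\<pi>) \<le> (\<integral>\<^sup>+t. ennreal \<bar>cdf (distr F borel signed_square) t - cdf (distr G borel signed_square) t\<bar> \<partial>lborel)"
    using quantile_coupling[of "distr F borel signed_square" "distr G borel signed_square"] by auto
  have [measurable_cong]: "sets \<pi> = sets (borel \<Otimes>\<^sub>M borel)" by (rule \<pi>(1))
  define \<pi>' where "\<pi>' = distr \<pi> (borel \<Otimes>\<^sub>M borel) (\<lambda>z. (r (fst z), r (snd z)))"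
  have inv_root: "distr (distr H borel signed_square) borel r = H" if "real_distribution H" for H
  proof -
    interpret H: real_distribution H by fact
    have "distr (distr H borel signed_square) borel r = distr H borel (r \<circ> signed_square)"
      by (rule distr_distr) auto
    also have "\<dots> = H" by (auto simp: comp_def r intro: distr_id2)
    finally show ?thesis .
  qed
  have "distr \<pi>' borel fst = distr (distr \<pi> borel fst) borel r"
    unfolding \<pi>'_def by (subst (1 2) distr_distr) (auto simp: comp_def)
  then have 1: "distr \<pi>' borel fst = F" using \<pi>(2) inv_root[OF assms(1)] by simp
  have "distr \<pi>' borel snd = distr (distr \<pi> borel snd) borel r"
    unfolding \<pi>'_def by (subst (1 2) distr_distr) (auto simp: comp_def)
  then have 2: "distr \<pi>' borel snd = G" using \<pi>(3) inv_root[OF assms(2)] by simp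
  have "d2_sq F G \<le> (\<integral>\<^sup>+z. ennreal ((norm (fst z - snd z))\<^sup>2) \<partial>\<pi>')"
    unfolding d2_sq_def by (intro INF_lower) (use 1 2 in \<open>auto simp: \<pi>'_def\<close>)
  also have "\<dots> = (\<integral>\<^sup>+z. ennreal ((r (fst z) - r (snd z))\<^sup>2) \<partial>\<pi>)"
    unfolding \<pi>'_def by (subst nn_integral_distr) auto
  also have "\<dots> \<le> (\<integral>\<^sup>+z. 2 * ennreal \<bar>fst z - snd z\<bar> \<partial>\<pi>)"
  proof (rule nn_integral_mono)
    fix z
    have "ennreal ((r (fst z) - r (snd z))\<^sup>2) \<le> ennreal (2 * \<bar>fst z - snd z\<bar>)"
      using sq_diff_le_signed_square[of "r (fst z)" "r (snd z)"] by (intro ennreal_leI) (simp add: r')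
    then show "ennreal ((r (fst z) - r (snd z))\<^sup>2) \<le> 2 * ennreal \<bar>fst z - snd z\<bar>"
      by (simp add: ennreal_mult')
  qed
  also have "\<dots> = 2 * (\<integral>\<^sup>+z. ennreal \<bar>fst z - snd z\<bar> \<partial>\<pi>)" by (rule nn_integral_cmult) measurable
  finally show ?thesis using \<pi>(4) by (meson mult_left_mono order_trans zero_le)
qed

abbreviation emp :: "nat \<Rightarrow> (nat \<Rightarrow> real) \<Rightarrow> real measure" where
  "emp n a \<equiv> distr (uniform_count_measure {..<n}) borel a"

text \<open>The distribution function of the image of the empirical law under \<open>signed_square\<close>, written
as a sum so that its mean and variance can be read off.\<close>

definition emp_cdf :: "nat \<Rightarrow> (nat \<Rightarrow> real) \<Rightarrow> real \<Rightarrow> real" where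
  "emp_cdf n a t = (\<Sum>i<n. if signed_square (a i) \<le> t then 1 else 0) / real n"

lemma real_distribution_emp: "0 < n \<Longrightarrow> real_distribution (emp n a)"
  by (intro prob_space.real_distribution_distr prob_space_uniform_count_measure) auto

lemma cdf_emp:
  assumes "0 < n"
  shows "cdf (distr (emp n a) borel signed_square) t = emp_cdf n a t"
proof -
  interpret U: prob_space "uniform_count_measure {..<n}"
    using assms by (intro prob_space_uniform_count_measure) auto
  have "distr (emp n a) borel signed_square = distr (uniform_count_measure {..<n}) borel (\<lambda>i. signed_square (a i))"
    by (subst distr_distr) (auto simp: comp_def)
  then have "cdf (distr (emp n a) borel signed_square) t
      = measure (uniform_count_measure {..<n}) {i \<in> {..<n}. signed_square (a i) \<le> t}"
    by (simp add: cdf_distr[OF U.prob_space_axioms] space_uniform_count_measure)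
  also have "\<dots> = real (card {i \<in> {..<n}. signed_square (a i) \<le> t}) / real n"
    by (subst measure_uniform_count_measure) auto
  also have "real (card {i \<in> {..<n}. signed_square (a i) \<le> t}) = (\<Sum>i<n. if signed_square (a i) \<le> t then 1 else 0)"
    by (subst sum.inter_filter[symmetric]) auto
  finally show ?thesis by (simp add: emp_cdf_def)
qed

lemma emp_cdf_measurable:
  assumes "\<And>i. i < n \<Longrightarrow> (\<lambda>z. a z i) \<in> borel_measurable N" "\<tau> \<in> borel_measurable N"
  shows "(\<lambda>z. emp_cdf n (a z) (\<tau> z)) \<in> borel_measurable N"
proof -
  have [measurable]: "(\<lambda>z. signed_square (a z i)) \<in> borel_measurable N" if "i < n" for i
    by (rule measurable_compose[OF assms(1)[OF that] signed_square_measurable])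
  note assms(2)[measurable]
  show ?thesis unfolding emp_cdf_def
    by (intro borel_measurable_divide borel_measurable_sum measurable_If borel_measurable_const borel_measurable_le
        borel_measurable_const) auto
qed

lemma emp_cdf_diff:
  assumes n: "0 < n"
  shows "(\<integral>\<^sup>+t. ennreal \<bar>emp_cdf n a t - emp_cdf n e t\<bar> \<partial>lborel)
    \<le> ennreal ((\<Sum>i<n. \<bar>signed_square (a i) - signed_square (e i)\<bar>) / real n)"
proof -
  have "(\<integral>\<^sup>+t. ennreal \<bar>emp_cdf n a t - emp_cdf n e t\<bar> \<partial>lborel)
    \<le> (\<integral>\<^sup>+t. ennreal (1 / real n) * (\<Sum>i<n. crosses (signed_square (a i)) (signed_square (e i)) t) \<partial>lborel)"
  proof (rule nn_integral_mono)
    fix t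
    have "\<bar>emp_cdf n a t - emp_cdf n e t\<bar>
       = \<bar>\<Sum>i<n. (if signed_square (a i) \<le> t then 1 else 0) - (if signed_square (e i) \<le> t then 1 else 0)\<bar> / real n"
      by (simp add: emp_cdf_def sum_subtractf abs_divide flip: diff_divide_distrib)
    also have "\<dots> \<le> (\<Sum>i<n. \<bar>(if signed_square (a i) \<le> t then 1 else 0) - (if signed_square (e i) \<le> t then 1 else (0::real))\<bar>) / real n"
      by (intro divide_right_mono sum_abs) auto
    also have "\<dots> = 1 / real n * (\<Sum>i<n. crosses (signed_square (a i)) (signed_square (e i)) t)"
    proof -
      have "(\<Sum>i<n. \<bar>(if signed_square (a i) \<le> t then 1 else 0) - (if signed_square (e i) \<le> t then 1 else (0::real))\<bar>)
        = (\<Sum>i<n. crosses (signed_square (a i)) (signed_square (e i)) t)"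
        by (intro sum.cong) auto
      then show ?thesis by simp
    qed
    finally have "ennreal \<bar>emp_cdf n a t - emp_cdf n e t\<bar>
       \<le> ennreal (1 / real n * (\<Sum>i<n. crosses (signed_square (a i)) (signed_square (e i)) t))"
      by (rule ennreal_leI)
    also have "\<dots> = ennreal (1 / real n) * ennreal (\<Sum>i<n. crosses (signed_square (a i)) (signed_square (e i)) t)"
      by (intro ennreal_mult sum_nonneg) auto
    also have "ennreal (\<Sum>i<n. crosses (signed_square (a i)) (signed_square (e i)) t)
      = (\<Sum>i<n. crosses (signed_square (a i)) (signed_square (e i)) t)"
      by (subst sum_ennreal[symmetric]) (auto intro!: sum.cong simp del: sum_ennreal)
    finally show "ennreal \<bar>emp_cdf n a t - emp_cdf n e t\<bar> \<le> ennreal (1 / real n) * (\<Sum>i<n. crosses (signed_square (a i)) (signed_square (e i)) t)" .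
  qed
  also have "\<dots> = ennreal (1 / real n) * (\<Sum>i<n. ennreal \<bar>signed_square (a i) - signed_square (e i)\<bar>)"
    by (subst nn_integral_cmult, measurable) (subst nn_integral_sum, measurable, simp add: nn_integral_between)
  also have "\<dots> = ennreal ((\<Sum>i<n. \<bar>signed_square (a i) - signed_square (e i)\<bar>) / real n)"
    by (simp add: sum_ennreal ennreal_mult[symmetric] sum_nonneg)
  finally show ?thesis .
qed

lemma d2_sq_empirical:
  assumes F: "real_distribution F" and n: "0 < n"
  shows "d2_sq F (emp n e) \<le> 2 * (\<integral>\<^sup>+t. ennreal \<bar>cdf (distr F borel signed_square) t - emp_cdf n a t\<bar> \<partial>lborel)
     + ennreal (2 / real n * (\<Sum>i<n. \<bar>signed_square (a i) - signed_square (e i)\<bar>))"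
proof -
  interpret F: real_distribution F by fact
  interpret F': real_distribution "distr F borel signed_square" by simp
  have [measurable]: "cdf (distr F borel signed_square) \<in> borel_measurable borel"
    by (intro borel_measurable_mono monoI F'.cdf_nondecreasing)
  have [measurable]: "(\<lambda>t. emp_cdf n b t) \<in> borel_measurable borel" for b
    by (rule emp_cdf_measurable) auto
  have "d2_sq F (emp n e) \<le> 2 * (\<integral>\<^sup>+t. ennreal \<bar>cdf (distr F borel signed_square) t - emp_cdf n e t\<bar> \<partial>lborel)"
    using d2_sq_le_cdf[OF F real_distribution_emp[OF n]] by (simp add: cdf_emp[OF n])
  also have "\<dots> \<le> 2 * (\<integral>\<^sup>+t. ennreal \<bar>cdf (distr F borel signed_square) t - emp_cdf n a t\<bar> + ennreal \<bar>emp_cdf n a t - emp_cdf n e t\<bar> \<partial>lborel)"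
    by (intro mult_left_mono nn_integral_mono) (auto simp flip: ennreal_plus intro!: ennreal_leI)
  also have "\<dots> = 2 * ((\<integral>\<^sup>+t. ennreal \<bar>cdf (distr F borel signed_square) t - emp_cdf n a t\<bar> \<partial>lborel) + (\<integral>\<^sup>+t. ennreal \<bar>emp_cdf n a t - emp_cdf n e t\<bar> \<partial>lborel))"
    by (subst nn_integral_add) auto
  also have "\<dots> \<le> 2 * ((\<integral>\<^sup>+t. ennreal \<bar>cdf (distr F borel signed_square) t - emp_cdf n a t\<bar> \<partial>lborel)
     + ennreal ((\<Sum>i<n. \<bar>signed_square (a i) - signed_square (e i)\<bar>) / real n))"
    by (intro mult_left_mono add_left_mono emp_cdf_diff n) auto
  also have "\<dots> = 2 * (\<integral>\<^sup>+t. ennreal \<bar>cdf (distr F borel signed_square) t - emp_cdf n a t\<bar> \<partial>lborel)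
     + ennreal 2 * ennreal ((\<Sum>i<n. \<bar>signed_square (a i) - signed_square (e i)\<bar>) / real n)"
    by (simp add: distrib_left)
  also have "ennreal 2 * ennreal ((\<Sum>i<n. \<bar>signed_square (a i) - signed_square (e i)\<bar>) / real n)
     = ennreal (2 / real n * (\<Sum>i<n. \<bar>signed_square (a i) - signed_square (e i)\<bar>))"
    by (subst ennreal_mult'[symmetric]) auto
  finally show ?thesis .
qed

lemma square_integrable_mult:
  fixes f g :: "'a \<Rightarrow> real"
  assumes "f \<in> borel_measurable M" "g \<in> borel_measurable M"
    and "integrable M (\<lambda>w. (f w)\<^sup>2)" "integrable M (\<lambda>w. (g w)\<^sup>2)"
  shows "integrable M (\<lambda>w. f w * g w)"
proof (rule Bochner_Integration.integrable_bound)
  show "integrable M (\<lambda>w. (f w)\<^sup>2 + (g w)\<^sup>2)" using assms by auto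
  show "AE w in M. norm (f w * g w) \<le> norm ((f w)\<^sup>2 + (g w)\<^sup>2)"
  proof (intro AE_I2)
    fix w
    have "2 * (\<bar>f w\<bar> * \<bar>g w\<bar>) \<le> (f w)\<^sup>2 + (g w)\<^sup>2"
      using sum_squares_bound[of "\<bar>f w\<bar>" "\<bar>g w\<bar>"] by simp
    moreover have "0 \<le> \<bar>f w\<bar> * \<bar>g w\<bar>" by simp
    ultimately have "\<bar>f w\<bar> * \<bar>g w\<bar> \<le> (f w)\<^sup>2 + (g w)\<^sup>2" by linarith
    then show "norm (f w * g w) \<le> norm ((f w)\<^sup>2 + (g w)\<^sup>2)" by (simp add: abs_mult)
  qed
qed (use assms in measurable)

text \<open>Stated for uncorrelated summands: for the sums of \<epsilon>_j X_jc below this follows from the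
independence of X and \<epsilon>, with no need to discuss the joint law of the products.\<close>

lemma (in prob_space) second_moment_uncorrelated:
  fixes D :: "'i \<Rightarrow> 'a \<Rightarrow> real"
  assumes fin: "finite I" and m: "\<And>i. i \<in> I \<Longrightarrow> D i \<in> borel_measurable M"
    and sq: "\<And>i. i \<in> I \<Longrightarrow> integrable M (\<lambda>w. (D i w)\<^sup>2)"
    and mean: "\<And>i. i \<in> I \<Longrightarrow> expectation (D i) = 0"
    and unc: "\<And>i j. i \<in> I \<Longrightarrow> j \<in> I \<Longrightarrow> i \<noteq> j \<Longrightarrow> expectation (\<lambda>w. D i w * D j w) = 0"
  shows "expectation (\<lambda>w. (b + (\<Sum>i\<in>I. D i w))\<^sup>2) = b\<^sup>2 + (\<Sum>i\<in>I. expectation (\<lambda>w. (D i w)\<^sup>2))"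
    and "integrable M (\<lambda>w. (b + (\<Sum>i\<in>I. D i w))\<^sup>2)"
proof -
  have i1: "integrable M (D i)" if "i \<in> I" for i
    by (rule square_integrable_imp_integrable[OF m[OF that] sq[OF that]])
  have i2: "integrable M (\<lambda>w. D i w * D j w)" if "i \<in> I" "j \<in> I" for i j
    by (rule square_integrable_mult) (use m sq that in auto)
  have expand: "(b + (\<Sum>i\<in>I. D i w))\<^sup>2 = b\<^sup>2 + 2 * b * (\<Sum>i\<in>I. D i w) + (\<Sum>i\<in>I. \<Sum>j\<in>I. D i w * D j w)" for w
    by (simp add: power2_sum power2_eq_square[of "\<Sum>i\<in>I. D i w"] sum_product)
  show "integrable M (\<lambda>w. (b + (\<Sum>i\<in>I. D i w))\<^sup>2)"
    unfolding expand by (intro Bochner_Integration.integrable_add integrable_mult_right Bochner_Integration.integrable_sum i1 i2) auto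
  have "expectation (\<lambda>w. (b + (\<Sum>i\<in>I. D i w))\<^sup>2)
      = b\<^sup>2 + 2 * b * (\<Sum>i\<in>I. expectation (D i)) + (\<Sum>i\<in>I. \<Sum>j\<in>I. expectation (\<lambda>w. D i w * D j w))"
    unfolding expand using i1 i2 by (simp add: prob_space)
  also have "(\<Sum>i\<in>I. \<Sum>j\<in>I. expectation (\<lambda>w. D i w * D j w)) = (\<Sum>i\<in>I. \<Sum>j\<in>I. if i = j then expectation (\<lambda>w. (D i w)\<^sup>2) else 0)"
    using unc by (intro sum.cong refl) (auto simp: power2_eq_square)
  finally show "expectation (\<lambda>w. (b + (\<Sum>i\<in>I. D i w))\<^sup>2) = b\<^sup>2 + (\<Sum>i\<in>I. expectation (\<lambda>w. (D i w)\<^sup>2))"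
    using mean fin by simp
qed

lemma (in prob_space) expectation_mult_indep:
  fixes D :: "'i \<Rightarrow> 'a \<Rightarrow> real"
  assumes "indep_vars (\<lambda>_. borel) D I" "i \<in> I" "j \<in> I" "i \<noteq> j" "integrable M (D i)" "integrable M (D j)"
  shows "expectation (\<lambda>w. D i w * D j w) = expectation (D i) * expectation (D j)"
  using indep_vars_lebesgue_integral[of "{i,j}" D] assms indep_vars_subset[OF assms(1), of "{i,j}"] by auto

lemma (in prob_space) second_moment_indep:
  fixes D :: "'i \<Rightarrow> 'a \<Rightarrow> real"
  assumes fin: "finite I" and ind: "indep_vars (\<lambda>_. borel) D I"
    and sq: "\<And>i. i \<in> I \<Longrightarrow> integrable M (\<lambda>w. (D i w)\<^sup>2)"
    and mean: "\<And>i. i \<in> I \<Longrightarrow> expectation (D i) = 0"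
  shows "expectation (\<lambda>w. (b + (\<Sum>i\<in>I. D i w))\<^sup>2) = b\<^sup>2 + (\<Sum>i\<in>I. expectation (\<lambda>w. (D i w)\<^sup>2))"
    and "integrable M (\<lambda>w. (b + (\<Sum>i\<in>I. D i w))\<^sup>2)"
proof -
  have m: "D i \<in> borel_measurable M" if "i \<in> I" for i using ind that by (auto simp: indep_vars_def)
  have i1: "integrable M (D i)" if "i \<in> I" for i
    by (rule square_integrable_imp_integrable[OF m[OF that] sq[OF that]])
  have unc: "expectation (\<lambda>w. D i w * D j w) = 0" if "i \<in> I" "j \<in> I" "i \<noteq> j" for i j
    using expectation_mult_indep[OF ind that i1[OF that(1)] i1[OF that(2)]] mean that by simp
  show "expectation (\<lambda>w. (b + (\<Sum>i\<in>I. D i w))\<^sup>2) = b\<^sup>2 + (\<Sum>i\<in>I. expectation (\<lambda>w. (D i w)\<^sup>2))"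
    and "integrable M (\<lambda>w. (b + (\<Sum>i\<in>I. D i w))\<^sup>2)"
    using second_moment_uncorrelated[OF fin m sq mean unc] by auto
qed

lemma indep_vars_PiM_coordinates:
  assumes "\<And>i. i \<in> I \<Longrightarrow> prob_space (N i)" "I \<noteq> {}"
  shows "prob_space.indep_vars (PiM I N) N (\<lambda>i z. z i) I"
proof -
  interpret P: prob_space "PiM I N" by (rule prob_space_PiM) (rule assms)
  have "distr (PiM I N) (PiM I N) (\<lambda>z. \<lambda>i\<in>I. z i) = PiM I N"
    by (rule trans[OF distr_cong distr_id]) (auto simp: space_PiM PiE_def extensional_restrict)
  also have "\<dots> = PiM I (\<lambda>i. distr (PiM I N) (N i) (\<lambda>z. z i))"
    by (intro PiM_cong refl) (simp add: distr_PiM_component assms)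
  finally show ?thesis using assms(2)
    by (subst P.indep_vars_iff_distr_eq_PiM') (auto intro: measurable_component_singleton)
qed

text \<open>Take independent copies of one coupling of F0 and F, one for each coordinate. The differences are
centred and independent, so their weighted squares add up to the cost of the coupling times the squared
length of w; the constant b is added by itself, since the cross term has mean zero.\<close>

lemma d2_sq_linear_statistic:
  fixes F0 F :: "real measure" and w :: "nat \<Rightarrow> real"
  assumes F0: "real_distribution F0" "integrable F0 (\<lambda>x. x\<^sup>2)" "(\<integral>x. x \<partial>F0) = 0"
    and F: "real_distribution F" "integrable F (\<lambda>x. x\<^sup>2)" "(\<integral>x. x \<partial>F) = 0"
    and W: "0 < (\<Sum>j<n. (w j)\<^sup>2)"
  shows "d2_sq (distr (PiM {..<n} (\<lambda>_. F0)) borel (\<lambda>e. b + (\<Sum>j<n. w j * e j)))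
               (distr (PiM {..<n} (\<lambda>_. F)) borel (\<lambda>e. \<Sum>j<n. w j * e j))
    \<le> ennreal (\<Sum>j<n. (w j)\<^sup>2) * d2_sq F0 F + ennreal (b\<^sup>2)" (is "?d \<le> ennreal ?W * _ + _")
proof -
  interpret F0: real_distribution F0 by (rule F0(1))
  interpret F: real_distribution F by (rule F(1))
  have n: "{..<n} \<noteq> {}" using W by (intro notI) simp
  have key: "?d \<le> ennreal ?W * (\<integral>\<^sup>+ z. ennreal ((norm (fst z - snd z))\<^sup>2) \<partial>\<pi>) + ennreal (b\<^sup>2)"
    if \<pi>: "sets \<pi> = sets (borel \<Otimes>\<^sub>M borel)" "distr \<pi> borel fst = F0" "distr \<pi> borel snd = F" for \<pi>
  proof -
    note [measurable_cong] = \<pi>(1)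
    have mfst: "fst \<in> borel_measurable \<pi>" and msnd: "snd \<in> borel_measurable \<pi>" by measurable
    interpret \<pi>: prob_space \<pi>
    proof
      have "emeasure F0 UNIV = emeasure \<pi> (space \<pi>)" unfolding \<pi>(2)[symmetric] using mfst by (subst emeasure_distr) auto
      then show "emeasure \<pi> (space \<pi>) = 1" using F0.emeasure_space_1 by simp
    qed
    interpret P: prob_space "PiM {..<n} (\<lambda>_. \<pi>)" by (rule prob_space_PiM) (rule \<pi>.prob_space_axioms)
    have xi: "integrable \<pi> (\<lambda>z. (fst z)\<^sup>2)" "integrable \<pi> (\<lambda>z. (snd z)\<^sup>2)"
      using F0(2) F(2) mfst msnd unfolding \<pi>(2,3)[symmetric] by (simp_all add: integrable_distr_eq)
    have x1: "integrable \<pi> fst" "integrable \<pi> snd"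
      using \<pi>.square_integrable_imp_integrable[OF mfst xi(1)] \<pi>.square_integrable_imp_integrable[OF msnd xi(2)] by auto
    have mean: "\<pi>.expectation (\<lambda>z. fst z - snd z) = 0"
    proof -
      have "\<pi>.expectation fst = 0" "\<pi>.expectation snd = 0"
        using F0(3) F(3) mfst msnd unfolding \<pi>(2,3)[symmetric] by (simp_all add: integral_distr)
      then show ?thesis using x1 by simp
    qed
    have dd: "integrable \<pi> (\<lambda>z. (fst z - snd z)\<^sup>2)"
    proof (rule Bochner_Integration.integrable_bound)
      show "integrable \<pi> (\<lambda>z. 2 * (fst z)\<^sup>2 + 2 * (snd z)\<^sup>2)" using xi by auto
      show "AE z in \<pi>. norm ((fst z - snd z)\<^sup>2) \<le> norm (2 * (fst z)\<^sup>2 + 2 * (snd z)\<^sup>2)"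
      proof (intro AE_I2)
        fix z :: "real \<times> real"
        have "(fst z - snd z)\<^sup>2 + (fst z + snd z)\<^sup>2 = 2 * (fst z)\<^sup>2 + 2 * (snd z)\<^sup>2"
          by (simp add: power2_eq_square algebra_simps)
        then have "(fst z - snd z)\<^sup>2 \<le> 2 * (fst z)\<^sup>2 + 2 * (snd z)\<^sup>2"
          using zero_le_power2[of "fst z + snd z"] by linarith
        then show "norm ((fst z - snd z)\<^sup>2) \<le> norm (2 * (fst z)\<^sup>2 + 2 * (snd z)\<^sup>2)" by simp
      qed
    qed measurable
    define c where "c = \<pi>.expectation (\<lambda>z. (fst z - snd z)\<^sup>2)"
    have cc: "(\<integral>\<^sup>+ z. ennreal ((norm (fst z - snd z))\<^sup>2) \<partial>\<pi>) = ennreal c"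
      unfolding c_def using dd by (simp add: nn_integral_eq_integral)
    have c0: "0 \<le> c" unfolding c_def by (rule integral_nonneg_AE) auto
    define D where "D = (\<lambda>j (z :: nat \<Rightarrow> real \<times> real). w j * (fst (z j) - snd (z j)))"
    have comp: "(\<lambda>z. z j) \<in> measurable (PiM {..<n} (\<lambda>_. \<pi>)) \<pi>" if "j < n" for j
      using that by (intro measurable_component_singleton) auto
    have Dm: "(\<lambda>y. w j * (fst y - snd y)) \<in> borel_measurable \<pi>" for j by measurable
    have ind: "P.indep_vars (\<lambda>_. borel) D {..<n}"
      using P.indep_vars_compose2[OF indep_vars_PiM_coordinates[OF \<pi>.prob_space_axioms n], of "\<lambda>j y. w j * (fst y - snd y)" "\<lambda>_. borel"] Dm
      by (simp add: D_def)
    have push: "integrable (PiM {..<n} (\<lambda>_. \<pi>)) (\<lambda>z. f (z j)) \<longleftrightarrow> integrable \<pi> f"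
      "P.expectation (\<lambda>z. f (z j)) = \<pi>.expectation f"
      if "j < n" "f \<in> borel_measurable \<pi>" for j and f :: "real \<times> real \<Rightarrow> real"
    proof -
      have eq: "distr (PiM {..<n} (\<lambda>_. \<pi>)) \<pi> (\<lambda>z. z j) = \<pi>"
        using distr_PiM_component[of "{..<n}" "\<lambda>_. \<pi>" j] \<pi>.prob_space_axioms that by simp
      show "integrable (PiM {..<n} (\<lambda>_. \<pi>)) (\<lambda>z. f (z j)) \<longleftrightarrow> integrable \<pi> f"
        using integrable_distr_eq[OF comp[OF that(1)] that(2)] unfolding eq by simp
      show "P.expectation (\<lambda>z. f (z j)) = \<pi>.expectation f"
        using integral_distr[OF comp[OF that(1)] that(2)] unfolding eq by simp
    qed
    have D2: "integrable (PiM {..<n} (\<lambda>_. \<pi>)) (\<lambda>z. (D j z)\<^sup>2)" "P.expectation (\<lambda>z. (D j z)\<^sup>2) = (w j)\<^sup>2 * c" "P.expectation (D j) = 0"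
      if "j < n" for j
    proof -
      have mm: "(\<lambda>y. (w j * (fst y - snd y))\<^sup>2) \<in> borel_measurable \<pi>" by measurable
      show "integrable (PiM {..<n} (\<lambda>_. \<pi>)) (\<lambda>z. (D j z)\<^sup>2)"
        unfolding D_def using push(1)[OF that mm] dd by (simp add: power_mult_distrib)
      show "P.expectation (\<lambda>z. (D j z)\<^sup>2) = (w j)\<^sup>2 * c"
        unfolding D_def c_def using push(2)[OF that mm] dd by (simp add: power_mult_distrib)
      show "P.expectation (D j) = 0"
        unfolding D_def using push(2)[OF that Dm] mean by simp
    qed
    define g1 where "g1 = (\<lambda>z :: nat \<Rightarrow> real \<times> real. b + (\<Sum>j<n. w j * fst (z j)))"
    define g2 where "g2 = (\<lambda>z :: nat \<Rightarrow> real \<times> real. \<Sum>j<n. w j * snd (z j))"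
    have g[measurable]: "g1 \<in> borel_measurable (PiM {..<n} (\<lambda>_. \<pi>))" "g2 \<in> borel_measurable (PiM {..<n} (\<lambda>_. \<pi>))"
      unfolding g1_def g2_def
      by (auto intro!: borel_measurable_add borel_measurable_sum borel_measurable_times measurable_compose[OF comp mfst] measurable_compose[OF comp msnd])
    define \<theta> where "\<theta> = distr (PiM {..<n} (\<lambda>_. \<pi>)) (borel \<Otimes>\<^sub>M borel) (\<lambda>z. (g1 z, g2 z))"
    have marg: "distr (PiM {..<n} (\<lambda>_. \<pi>)) (PiM {..<n} (\<lambda>_. borel)) (compose {..<n} h) = PiM {..<n} (\<lambda>_. H)"
      if "h \<in> borel_measurable \<pi>" "distr \<pi> borel h = H" "real_distribution H" for h :: "real \<times> real \<Rightarrow> real" and H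
    proof -
      have "distr (PiM {..<n} (\<lambda>_. \<pi>)) (PiM {..<n} (\<lambda>_. H)) (compose {..<n} h) = PiM {..<n} (\<lambda>_. distr \<pi> H h)"
        using that \<pi>.prob_space_axioms
        by (intro distr_PiM_finite_prob_space') (auto simp: real_distribution_def real_distribution_axioms_def cong: measurable_cong_sets)
      also have "distr \<pi> H h = H"
        using that by (subst that(2)[symmetric]) (auto intro!: distr_cong simp: real_distribution_def real_distribution_axioms_def)
      also have "distr (PiM {..<n} (\<lambda>_. \<pi>)) (PiM {..<n} (\<lambda>_. H)) (compose {..<n} h) = distr (PiM {..<n} (\<lambda>_. \<pi>)) (PiM {..<n} (\<lambda>_. borel)) (compose {..<n} h)"
        using that by (intro distr_cong sets_PiM_cong) (auto simp: real_distribution_def real_distribution_axioms_def)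
      finally show ?thesis .
    qed
    have cm: "compose {..<n} h \<in> measurable (PiM {..<n} (\<lambda>_. \<pi>)) (PiM {..<n} (\<lambda>_. borel))" if "h \<in> borel_measurable \<pi>" for h :: "real \<times> real \<Rightarrow> real"
      unfolding compose_def by (intro measurable_restrict measurable_compose[OF comp that]) auto
    have lin: "(\<lambda>e. b' + (\<Sum>j<n. w j * e j)) \<in> borel_measurable (PiM {..<n} (\<lambda>_. borel))" for b'
      by measurable
    have "distr \<theta> borel fst = distr (PiM {..<n} (\<lambda>_. \<pi>)) borel g1"
      unfolding \<theta>_def by (subst distr_distr) (auto simp: comp_def)
    also have "\<dots> = distr (distr (PiM {..<n} (\<lambda>_. \<pi>)) (PiM {..<n} (\<lambda>_. borel)) (compose {..<n} fst)) borel (\<lambda>e. b + (\<Sum>j<n. w j * e j))"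
      using cm[OF mfst] by (subst distr_distr[OF lin]) (auto simp: g1_def comp_def compose_def)
    also have "\<dots> = distr (PiM {..<n} (\<lambda>_. F0)) borel (\<lambda>e. b + (\<Sum>j<n. w j * e j))"
      unfolding marg[OF mfst \<pi>(2) F0(1)] ..
    finally have 1: "distr \<theta> borel fst = \<dots>" .
    have "distr \<theta> borel snd = distr (PiM {..<n} (\<lambda>_. \<pi>)) borel g2"
      unfolding \<theta>_def by (subst distr_distr) (auto simp: comp_def)
    also have "\<dots> = distr (distr (PiM {..<n} (\<lambda>_. \<pi>)) (PiM {..<n} (\<lambda>_. borel)) (compose {..<n} snd)) borel (\<lambda>e. \<Sum>j<n. w j * e j)"
      using cm[OF msnd] lin[of 0] by (subst distr_distr) (auto simp: g2_def comp_def compose_def)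
    also have "\<dots> = distr (PiM {..<n} (\<lambda>_. F)) borel (\<lambda>e. \<Sum>j<n. w j * e j)"
      unfolding marg[OF msnd \<pi>(3) F(1)] ..
    finally have 2: "distr \<theta> borel snd = \<dots>" .
    have "?d \<le> (\<integral>\<^sup>+ z. ennreal ((norm (fst z - snd z))\<^sup>2) \<partial>\<theta>)"
      unfolding d2_sq_def by (intro INF_lower) (use 1 2 in \<open>auto simp: \<theta>_def\<close>)
    also have "\<dots> = (\<integral>\<^sup>+ z. ennreal ((g1 z - g2 z)\<^sup>2) \<partial>PiM {..<n} (\<lambda>_. \<pi>))"
      unfolding \<theta>_def by (subst nn_integral_distr) auto
    also have "\<dots> = (\<integral>\<^sup>+ z. ennreal ((b + (\<Sum>j<n. D j z))\<^sup>2) \<partial>PiM {..<n} (\<lambda>_. \<pi>))"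
      by (simp add: g1_def g2_def D_def sum_subtractf right_diff_distrib add_diff_eq)
    also have "\<dots> = ennreal (P.expectation (\<lambda>z. (b + (\<Sum>j<n. D j z))\<^sup>2))"
      using P.second_moment_indep(2)[OF _ ind, of b] D2 by (intro nn_integral_eq_integral) auto
    also have "P.expectation (\<lambda>z. (b + (\<Sum>j<n. D j z))\<^sup>2) = ?W * c + b\<^sup>2"
      using P.second_moment_indep(1)[OF _ ind, of b] D2 by (simp add: sum_distrib_right)
    also have "ennreal (?W * c + b\<^sup>2) = ennreal ?W * ennreal c + ennreal (b\<^sup>2)"
      using c0 W by (simp add: ennreal_mult' ennreal_plus)
    finally show ?thesis unfolding cc .
  qed
  \<comment> \<open>The infimum need not be attained; a violation would be witnessed by a coupling of nearly minimal cost.\<close>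
  have "?d \<le> ennreal ?W * d2_sq F0 F + ennreal (b\<^sup>2)"
  proof (rule ccontr)
    assume "\<not> ?thesis"
    then have lt: "ennreal ?W * d2_sq F0 F + ennreal (b\<^sup>2) < ?d" by simp
    have fin: "d2_sq F0 F < Orderings.top"
    proof (rule ccontr)
      assume "\<not> d2_sq F0 F < Orderings.top"
      then have "d2_sq F0 F = Orderings.top" using top.not_eq_extremum by blast
      then show False using lt W by (simp add: ennreal_mult_top)
    qed
    obtain q where q: "d2_sq F0 F = ennreal q" "0 \<le> q" using fin by (cases "d2_sq F0 F") auto
    define d0 where "d0 = min ?d (ennreal (?W * q + b\<^sup>2 + 1))"
    have lt0: "ennreal (?W * q + b\<^sup>2) < d0"
      using lt W q by (auto simp: d0_def ennreal_mult ennreal_plus intro!: ennreal_lessI)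
    have "d0 \<le> ennreal (?W * q + b\<^sup>2 + 1)" by (simp add: d0_def)
    then have "d0 < Orderings.top" by (rule le_less_trans) simp
    then obtain d1 where d1: "d0 = ennreal d1" "0 \<le> d1" by (cases d0) auto
    have l: "?W * q + b\<^sup>2 < d1"
      using lt0[unfolded d1(1)] by (subst (asm) ennreal_less_iff) (use q W in auto)
    define e where "e = (d1 - ?W * q - b\<^sup>2) / ?W"
    have e: "0 < e" using l W by (simp add: e_def)
    have "d2_sq F0 F < ennreal (q + e)" using q e by (simp add: ennreal_lessI)
    then obtain \<pi> where \<pi>: "sets \<pi> = sets (borel \<Otimes>\<^sub>M borel)" "distr \<pi> borel fst = F0" "distr \<pi> borel snd = F"
        "(\<integral>\<^sup>+ z. ennreal ((norm (fst z - snd z))\<^sup>2) \<partial>\<pi>) < ennreal (q + e)"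
      unfolding d2_sq_def INF_less_iff by auto
    have "?d \<le> ennreal ?W * (\<integral>\<^sup>+ z. ennreal ((norm (fst z - snd z))\<^sup>2) \<partial>\<pi>) + ennreal (b\<^sup>2)"
      by (rule key) (use \<pi> in auto)
    also have "\<dots> < ennreal ?W * ennreal (q + e) + ennreal (b\<^sup>2)"
      using \<pi>(4) W by (simp add: ennreal_mult_strict_left_mono ennreal_add_left_cancel_less add.commute)
    also have "\<dots> = ennreal (?W * (q + e) + b\<^sup>2)"
      using q e W by (simp add: ennreal_mult ennreal_plus)
    also have "?W * (q + e) + b\<^sup>2 = d1" using W by (simp add: e_def distrib_left)
    finally have "?d < d0" using d1 by simp
    then show False by (simp add: d0_def)
  qed
  then show ?thesis .
qed

text \<open>The left-hand side is at most \<bar>a\<bar>, and it vanishes unless \<bar>a\<bar> > T.\<close>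

lemma nn_integral_between_tail:
  fixes a T :: real
  assumes T: "0 < T"
  shows "(\<integral>\<^sup>+t. crosses a 0 t * indicator {t. T < \<bar>t\<bar>} t \<partial>lborel) \<le> ennreal (a\<^sup>2 / T)"
proof (cases "\<bar>a\<bar> \<le> T")
  case True
  have "(\<integral>\<^sup>+t. crosses a 0 t * indicator {t. T < \<bar>t\<bar>} t \<partial>lborel) = (\<integral>\<^sup>+(t::real). 0 \<partial>lborel)"
    using True by (intro nn_integral_cong) (auto simp: indicator_def)
  then show ?thesis by simp
next
  case False
  have "(\<integral>\<^sup>+t. crosses a 0 t * indicator {t. T < \<bar>t\<bar>} t \<partial>lborel)
      \<le> (\<integral>\<^sup>+t. crosses a 0 t \<partial>lborel)"
    by (intro nn_integral_mono) (auto simp: indicator_def)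
  also have "\<dots> = ennreal \<bar>a\<bar>" using nn_integral_between[of a 0] by simp
  also have "\<dots> \<le> ennreal (a\<^sup>2 / T)"
  proof (rule ennreal_leI)
    have "\<bar>a\<bar> * T \<le> \<bar>a\<bar> * \<bar>a\<bar>" using False by (intro mult_left_mono) auto
    then show "\<bar>a\<bar> \<le> a\<^sup>2 / T" using T by (simp add: le_divide_eq power2_eq_square)
  qed
  finally show ?thesis .
qed

text \<open>For \<bar>t\<bar> \<le> T the variance of the empirical distribution function gives a mean deviation of
n^{-1/2}. For larger \<bar>t\<bar> both functions are close to that of the point mass at 0, and the area
between them is bounded by the fourth moment, which is the second moment of the image law under
\<open>signed_square\<close>.\<close>

lemma expected_cdf_distance:
  fixes a :: "'w \<Rightarrow> nat \<Rightarrow> real"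
  assumes M: "prob_space M" and F0: "real_distribution F0" "integrable F0 (\<lambda>x. x ^ 4)"
    and ind: "prob_space.indep_vars M (\<lambda>_. borel) (\<lambda>i w. a w i) {..<n}"
    and law: "\<And>i. i < n \<Longrightarrow> distr M borel (\<lambda>w. a w i) = F0"
    and n: "0 < n" and T: "0 < T"
  shows "(\<integral>\<^sup>+w. (\<integral>\<^sup>+t. ennreal \<bar>cdf (distr F0 borel signed_square) t - emp_cdf n (a w) t\<bar> \<partial>lborel) \<partial>M)
     \<le> ennreal (2 * T / sqrt (real n) + 2 * (\<integral>x. x ^ 4 \<partial>F0) / T)"
proof -
  interpret M: prob_space M by fact
  interpret F0: real_distribution F0 by fact
  interpret F': real_distribution "distr F0 borel signed_square" by simp
  define C where "C = cdf (distr F0 borel signed_square)"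
  define m4 where "m4 = (\<integral>x. x ^ 4 \<partial>F0)"
  have [measurable]: "C \<in> borel_measurable borel"
    unfolding C_def by (intro borel_measurable_mono monoI F'.cdf_nondecreasing)
  have am[measurable]: "(\<lambda>w. a w i) \<in> borel_measurable M" if "i < n" for i
    using ind that by (auto simp: M.indep_vars_def)
  interpret pair_sigma_finite M lborel ..
  have joint[measurable]: "(\<lambda>z. emp_cdf n (a (fst z)) (snd z)) \<in> borel_measurable (M \<Otimes>\<^sub>M lborel)"
    by (rule emp_cdf_measurable) (auto intro: measurable_compose[OF measurable_fst am])
  have em[measurable]: "(\<lambda>w. emp_cdf n (a w) t) \<in> borel_measurable M" for t
    by (rule emp_cdf_measurable) auto
  define Z where "Z = (\<lambda>t i w. (if signed_square (a w i) \<le> t then 1 else 0) - C t :: real)"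
  have Zi: "M.indep_vars (\<lambda>_. borel) (Z t) {..<n}" for t
    using M.indep_vars_compose2[OF ind, of "\<lambda>i x. (if signed_square x \<le> t then 1 else 0) - C t" "\<lambda>_. borel"]
    by (simp add: Z_def)
  have C01: "0 \<le> C t" "C t \<le> 1" for t unfolding C_def using F'.cdf_nonneg F'.cdf_bounded_prob by auto
  have Zm: "Z t i \<in> borel_measurable M" if "i < n" for t i
    using am[OF that] unfolding Z_def by measurable
  have Z1: "\<bar>Z t i w\<bar> \<le> 1" for t i w using C01[of t] by (auto simp: Z_def)
  have prob: "M.prob {w \<in> space M. signed_square (a w i) \<le> t} = C t" if i: "i < n" for i t
  proof -
    have "C t = cdf (distr M borel (\<lambda>w. signed_square (a w i))) t"
      unfolding C_def law[OF i, symmetric] by (subst distr_distr) (auto simp: comp_def am[OF i])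
    then show ?thesis using cdf_distr[OF M, of "\<lambda>w. signed_square (a w i)" t] am[OF i] by simp
  qed
  have mean: "M.expectation (Z t i) = 0" if i: "i < n" for t i
  proof -
    have E: "{w \<in> space M. signed_square (a w i) \<le> t} \<in> sets M" using am[OF i] by measurable
    have "M.expectation (Z t i) = M.expectation (\<lambda>w. indicator {w \<in> space M. signed_square (a w i) \<le> t} w - C t)"
      by (intro Bochner_Integration.integral_cong) (auto simp: Z_def indicator_def)
    also have "\<dots> = M.prob {w \<in> space M. signed_square (a w i) \<le> t} - C t"
      using E M.emeasure_finite[of "{w \<in> space M. signed_square (a w i) \<le> t}"]
      by (subst Bochner_Integration.integral_diff) (auto simp: M.prob_space less_top[symmetric])
    finally show ?thesis using prob[OF i] by simp
  qed
  have sqi: "integrable M (\<lambda>w. (Z t i w)\<^sup>2)" if "i < n" for t i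
    using Zm[OF that, of t] Z1
    by (intro M.integrable_const_bound[of _ 1]) (auto intro!: AE_I2 simp: abs_square_le_1)
  have sq1: "M.expectation (\<lambda>w. (Z t i w)\<^sup>2) \<le> 1" if "i < n" for t i
    using M.integral_le_const[OF sqi[OF that, of t], of 1] Z1 by (simp add: abs_square_le_1)
  have emp: "emp_cdf n (a w) t - C t = (0 + (\<Sum>i<n. Z t i w)) / real n" for w t
    using n by (simp add: emp_cdf_def Z_def sum_subtractf diff_divide_distrib)
  have central: "(\<integral>\<^sup>+w. ennreal \<bar>C t - emp_cdf n (a w) t\<bar> \<partial>M) \<le> ennreal (1 / sqrt (real n))" for t
  proof -
    define s where "s = sqrt (real n)"
    have s: "0 < s" "s * s = real n" using n by (auto simp: s_def)
    note sm = M.second_moment_indep[OF finite_lessThan Zi sqi mean, of 0 t]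
    have sm1: "M.expectation (\<lambda>w. (0 + (\<Sum>i<n. Z t i w))\<^sup>2) \<le> real n"
      using sm(1) sum_mono[of "{..<n}" "\<lambda>i. M.expectation (\<lambda>w. (Z t i w)\<^sup>2)" "\<lambda>_. 1"] sq1 by simp
    \<comment> \<open>The first absolute moment from the second one, by 2 u s \<le> u^2 + s^2 with s^2 = n.\<close>
    have pw: "\<bar>C t - emp_cdf n (a w) t\<bar> \<le> ((0 + (\<Sum>i<n. Z t i w))\<^sup>2 / (s * real n) + 1 / s) / 2" for w
    proof -
      define u where "u = 0 + (\<Sum>i<n. Z t i w)"
      have "2 * (\<bar>u\<bar> * s) \<le> u\<^sup>2 + s\<^sup>2"
        using sum_squares_bound[of "\<bar>u\<bar>" s] by simp
      then have "2 * (\<bar>u\<bar> * s) / (s * s * s) \<le> (u\<^sup>2 + s\<^sup>2) / (s * s * s)"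
        using s by (intro divide_right_mono) auto
      moreover have "2 * (\<bar>u\<bar> * s) / (s * s * s) = 2 * (\<bar>u\<bar> / real n)"
        using s(1) by (simp flip: s(2))
      moreover have "(u\<^sup>2 + s\<^sup>2) / (s * s * s) = u\<^sup>2 / (s * real n) + 1 / s"
        using s(1) by (simp add: add_divide_distrib power2_eq_square mult.assoc flip: s(2))
      ultimately have "2 * (\<bar>u\<bar> / real n) \<le> u\<^sup>2 / (s * real n) + 1 / s" by (simp only:)
      then have "\<bar>u\<bar> / real n \<le> (u\<^sup>2 / (s * real n) + 1 / s) / 2"
        unfolding le_divide_eq_numeral1 by (metis mult.commute)
      moreover have "\<bar>C t - emp_cdf n (a w) t\<bar> = \<bar>u\<bar> / real n"
        using emp[of w t] unfolding u_def[symmetric] by (metis abs_divide abs_minus_commute abs_of_nat)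
      ultimately show ?thesis unfolding u_def by (simp only:)
    qed
    have "(\<integral>\<^sup>+w. ennreal \<bar>C t - emp_cdf n (a w) t\<bar> \<partial>M)
      \<le> (\<integral>\<^sup>+w. ennreal (((0 + (\<Sum>i<n. Z t i w))\<^sup>2 / (s * real n) + 1 / s) / 2) \<partial>M)"
      by (intro nn_integral_mono ennreal_leI pw)
    also have "\<dots> = ennreal (M.expectation (\<lambda>w. ((0 + (\<Sum>i<n. Z t i w))\<^sup>2 / (s * real n) + 1 / s) / 2))"
      using sm(2) s n by (intro nn_integral_eq_integral) (auto intro!: AE_I2)
    also have "M.expectation (\<lambda>w. ((0 + (\<Sum>i<n. Z t i w))\<^sup>2 / (s * real n) + 1 / s) / 2)
       = (M.expectation (\<lambda>w. (0 + (\<Sum>i<n. Z t i w))\<^sup>2) / (s * real n) + 1 / s) / 2"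
      using sm(2) by (simp add: M.prob_space)
    also have "\<dots> \<le> (real n / (s * real n) + 1 / s) / 2"
      using sm1 s n by (intro divide_right_mono add_right_mono) auto
    also have "\<dots> = 1 / s" using n s by simp
    finally show ?thesis by (simp add: s_def ennreal_leI)
  qed
  have tail: "(\<integral>\<^sup>+w. ennreal \<bar>C t - emp_cdf n (a w) t\<bar> \<partial>M)
      \<le> 2 * (\<integral>\<^sup>+x. crosses (signed_square x) 0 t \<partial>F0)" for t
  proof -
    define P where "P = F0.prob {x. \<not> ((signed_square x \<le> t) = (0 \<le> t))}"
    have Pn: "(\<integral>\<^sup>+x. crosses (signed_square x) 0 t \<partial>F0) = ennreal P"
    proof -
      have "(\<integral>\<^sup>+x. crosses (signed_square x) 0 t \<partial>F0)
          = (\<integral>\<^sup>+x. indicator {x. \<not> ((signed_square x \<le> t) = (0 \<le> t))} x \<partial>F0)"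
        by (intro nn_integral_cong) (auto simp: indicator_def)
      also have "\<dots> = emeasure F0 {x. \<not> ((signed_square x \<le> t) = (0 \<le> t))}"
        by (rule nn_integral_indicator) measurable
      finally show ?thesis by (simp add: P_def F0.emeasure_eq_measure)
    qed
    have Ct: "C t = F0.prob {x. signed_square x \<le> t}"
      unfolding C_def using cdf_distr[OF F0.prob_space_axioms, of signed_square t] by simp
    \<comment> \<open>P is the distance at t between the distribution function of the image law and that of the point mass at 0.\<close>
    have CP: "\<bar>C t - (if 0 \<le> t then 1 else 0)\<bar> = P"
    proof (cases "0 \<le> t")
      case True
      have "P = F0.prob (space F0 - {x. signed_square x \<le> t})"
        unfolding P_def using True by (intro arg_cong[where f = F0.prob]) auto
      also have "\<dots> = 1 - C t" unfolding Ct by (rule F0.prob_compl) measurable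
      finally show ?thesis using True C01[of t] by simp
    next
      case False
      then show ?thesis using C01[of t] by (simp add: P_def Ct)
    qed
    have pw: "ennreal \<bar>C t - emp_cdf n (a w) t\<bar> \<le> ennreal P + ennreal (1 / real n) * (\<Sum>i<n. crosses (signed_square (a w i)) 0 t)" for w
    proof -
      have "emp_cdf n (a w) t - (if 0 \<le> t then 1 else 0)
          = (\<Sum>i<n. (if signed_square (a w i) \<le> t then 1 else 0) - (if 0 \<le> t then 1 else 0)) / real n"
        using n by (simp add: emp_cdf_def sum_subtractf diff_divide_distrib)
      then have "\<bar>emp_cdf n (a w) t - (if 0 \<le> t then 1 else 0)\<bar>
         \<le> (\<Sum>i<n. \<bar>(if signed_square (a w i) \<le> t then 1 else 0) - (if 0 \<le> t then 1 else (0::real))\<bar>) / real n"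
        by (simp only: abs_divide abs_of_nat) (intro divide_right_mono sum_abs, simp)
      also have "(\<Sum>i<n. \<bar>(if signed_square (a w i) \<le> t then 1 else 0) - (if 0 \<le> t then 1 else (0::real))\<bar>)
         = (\<Sum>i<n. crosses (signed_square (a w i)) 0 t)"
        by (intro sum.cong) auto
      finally have "\<bar>C t - emp_cdf n (a w) t\<bar> \<le> P + 1 / real n * (\<Sum>i<n. crosses (signed_square (a w i)) 0 t)"
        using CP by simp
      then have "ennreal \<bar>C t - emp_cdf n (a w) t\<bar> \<le> ennreal (P + 1 / real n * (\<Sum>i<n. crosses (signed_square (a w i)) 0 t))"
        by (rule ennreal_leI)
      also have "\<dots> = ennreal P + ennreal (1 / real n) * ennreal (\<Sum>i<n. crosses (signed_square (a w i)) 0 t)"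
      proof -
        have s0: "0 \<le> (\<Sum>i<n. crosses (signed_square (a w i)) 0 t :: real)" (is "0 \<le> ?s")
          by (intro sum_nonneg) auto
        have "0 \<le> P" "0 \<le> 1 / real n" by (auto simp: P_def)
        then show ?thesis using s0 by (simp only: ennreal_plus ennreal_mult mult_nonneg_nonneg)
      qed
      also have "ennreal (\<Sum>i<n. crosses (signed_square (a w i)) 0 t)
         = (\<Sum>i<n. crosses (signed_square (a w i)) 0 t)"
        by (subst sum_ennreal[symmetric]) (auto intro!: sum.cong simp del: sum_ennreal)
      finally show ?thesis .
    qed
    have one: "(\<integral>\<^sup>+w. crosses (signed_square (a w i)) 0 t \<partial>M) = ennreal P" if i: "i < n" for i
    proof -
      have "(\<integral>\<^sup>+x. crosses (signed_square x) 0 t \<partial>F0)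
        = (\<integral>\<^sup>+w. crosses (signed_square (a w i)) 0 t \<partial>M)"
        unfolding law[OF i, symmetric] using am[OF i] by (subst nn_integral_distr) auto
      then show ?thesis using Pn by simp
    qed
    have "(\<integral>\<^sup>+w. ennreal \<bar>C t - emp_cdf n (a w) t\<bar> \<partial>M)
       \<le> (\<integral>\<^sup>+w. ennreal P + ennreal (1 / real n) * (\<Sum>i<n. crosses (signed_square (a w i)) 0 t) \<partial>M)"
      by (intro nn_integral_mono pw)
    also have "\<dots> = ennreal P + ennreal (1 / real n) * (\<Sum>i<n. \<integral>\<^sup>+w. crosses (signed_square (a w i)) 0 t \<partial>M)"
    proof -
      have [measurable]: "(\<lambda>w. crosses (signed_square (a w i)) 0 t :: ennreal) \<in> borel_measurable M" if "i < n" for i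
        using am[OF that] by measurable
      have sm: "(\<lambda>w. (\<Sum>i<n. crosses (signed_square (a w i)) 0 t) :: ennreal) \<in> borel_measurable M"
        by (intro borel_measurable_sum) auto
      show ?thesis
        by (subst nn_integral_add, simp, use sm in simp, subst nn_integral_cmult[OF sm], subst nn_integral_sum)
           (auto simp: M.emeasure_space_1)
    qed
    also have "\<dots> = ennreal P + ennreal (1 / real n) * (of_nat n * ennreal P)" by (simp add: one)
    also have "ennreal (1 / real n) * (of_nat n * ennreal P) = ennreal P"
      using n by (simp add: P_def ennreal_of_nat_eq_real_of_nat ennreal_mult[symmetric])
    finally show ?thesis unfolding Pn by (simp add: mult_2)
  qed
  define I where "I = {t::real. \<bar>t\<bar> \<le> T}"
  define O' where "O' = {t::real. T < \<bar>t\<bar>}"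
  have [measurable]: "I \<in> sets borel" "O' \<in> sets borel" unfolding I_def O'_def by measurable
  have eI: "emeasure lborel I = ennreal (2 * T)"
  proof -
    have "I = {-T..T}" by (auto simp: I_def)
    then show ?thesis using T by simp
  qed
  interpret F0L: pair_sigma_finite F0 lborel ..
  have "(\<integral>\<^sup>+w. (\<integral>\<^sup>+t. ennreal \<bar>C t - emp_cdf n (a w) t\<bar> \<partial>lborel) \<partial>M)
     = (\<integral>\<^sup>+t. (\<integral>\<^sup>+w. ennreal \<bar>C t - emp_cdf n (a w) t\<bar> \<partial>M) \<partial>lborel)"
    by (rule Fubini'[symmetric]) (use joint in measurable)
  also have "\<dots> \<le> (\<integral>\<^sup>+t. ennreal (1 / sqrt (real n)) * indicator I t
       + 2 * ((\<integral>\<^sup>+x. crosses (signed_square x) 0 t \<partial>F0) * indicator O' t) \<partial>lborel)"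
  proof (rule nn_integral_mono)
    fix t
    show "(\<integral>\<^sup>+w. ennreal \<bar>C t - emp_cdf n (a w) t\<bar> \<partial>M) \<le> ennreal (1 / sqrt (real n)) * indicator I t
       + 2 * ((\<integral>\<^sup>+x. crosses (signed_square x) 0 t \<partial>F0) * indicator O' t)"
    proof (cases "t \<in> I")
      case True
      then show ?thesis using central[of t] by (auto simp: I_def O'_def)
    next
      case False
      then show ?thesis using tail[of t] by (auto simp: I_def O'_def)
    qed
  qed
  also have "\<dots> = ennreal (1 / sqrt (real n)) * emeasure lborel I
       + 2 * (\<integral>\<^sup>+t. (\<integral>\<^sup>+x. crosses (signed_square x) 0 t * indicator O' t \<partial>F0) \<partial>lborel)"
    by (subst nn_integral_add, measurable, subst nn_integral_cmult, measurable, simp add: nn_integral_multc nn_integral_cmult)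
  also have "(\<integral>\<^sup>+t. (\<integral>\<^sup>+x. crosses (signed_square x) 0 t * indicator O' t \<partial>F0) \<partial>lborel)
     = (\<integral>\<^sup>+x. (\<integral>\<^sup>+t. crosses (signed_square x) 0 t * indicator O' t \<partial>lborel) \<partial>F0)"
    by (rule F0L.Fubini') measurable
  also have "\<dots> \<le> (\<integral>\<^sup>+x. ennreal (x ^ 4 / T) \<partial>F0)"
  proof (rule nn_integral_mono)
    fix x
    have "(signed_square x)\<^sup>2 = x ^ 4" by (simp add: signed_square_def power_mult_distrib power2_eq_square power4_eq_xxxx)
    then show "(\<integral>\<^sup>+t. crosses (signed_square x) 0 t * indicator O' t \<partial>lborel) \<le> ennreal (x ^ 4 / T)"
      using nn_integral_between_tail[OF T, of "signed_square x"] by (simp add: O'_def)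
  qed
  also have "(\<integral>\<^sup>+x. ennreal (x ^ 4 / T) \<partial>F0) = ennreal (m4 / T)"
    using F0(2) T by (subst nn_integral_eq_integral) (auto simp: m4_def)
  also have "ennreal (1 / sqrt (real n)) * emeasure lborel I + 2 * ennreal (m4 / T)
      = ennreal (2 * T / sqrt (real n) + 2 * m4 / T)"
  proof -
    have m4: "0 \<le> m4" unfolding m4_def by (rule integral_nonneg_AE) auto
    have "ennreal (1 / sqrt (real n)) * ennreal (2 * T) = ennreal (2 * T / sqrt (real n))"
      using T by (subst ennreal_mult[symmetric]) auto
    moreover have "2 * ennreal (m4 / T) = ennreal (2 * m4 / T)"
      using m4 T ennreal_mult[of 2 "m4 / T"] by simp
    ultimately show ?thesis using m4 T by (simp add: eI ennreal_plus)
  qed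
  finally show ?thesis unfolding C_def m4_def
    by (simp add: add_left_mono mult_left_mono)
qed

section \<open>Ridge regression in coordinates\<close>

abbreviation entries :: "real mat \<Rightarrow> nat \<Rightarrow> nat \<Rightarrow> real" where
  "entries X \<equiv> \<lambda>j c. X $$ (j, c)"

lemma scalar_prod_dot: "dim_vec b = p \<Longrightarrow> a \<bullet> b = dot p (vec_index a) (vec_index b)"
  by (simp add: scalar_prod_def dot_def lessThan_atLeast0)

lemma mult_mat_vec_dot: "X \<in> carrier_mat n p \<Longrightarrow> v \<in> carrier_vec p \<Longrightarrow> j < n \<Longrightarrow> (X *\<^sub>v v) $ j = dot p (entries X j) (vec_index v)"
  by (auto simp: scalar_prod_def dot_def lessThan_atLeast0 intro!: sum.cong)

lemma l2_norm_sq: "v \<in> carrier_vec n \<Longrightarrow> (l2_norm v)\<^sup>2 = (\<Sum>j<n. (v $ j)\<^sup>2)"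
  by (auto simp: l2_norm_def scalar_prod_def lessThan_atLeast0 power2_eq_square intro!: abs_of_nonneg sum_nonneg)

lemma ridge_gram_weak:
  fixes X :: "real mat"
  assumes X: "X \<in> carrier_mat n p" and y: "y \<in> carrier_vec p" and a: "a \<in> carrier_vec p"
  shows "((transpose_mat X * X + r \<cdot>\<^sub>m 1\<^sub>m p) *\<^sub>v y) \<bullet> a
     = (\<Sum>j<n. dot p (entries X j) (vec_index y) * dot p (entries X j) (vec_index a)) + r * dot p (vec_index y) (vec_index a)"
proof -
  have Xt: "transpose_mat X \<in> carrier_mat p n" using X by simp
  have e: "(transpose_mat X * X + r \<cdot>\<^sub>m 1\<^sub>m p) *\<^sub>v y = transpose_mat X *\<^sub>v (X *\<^sub>v y) + r \<cdot>\<^sub>v y"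
  proof -
    have "(r \<cdot>\<^sub>m 1\<^sub>m p) *\<^sub>v y = r \<cdot>\<^sub>v y" using y by (intro eq_vecI) auto
    then show ?thesis
      using X Xt y by (subst add_mult_distrib_mat_vec[of _ p p]) auto
  qed
  have Xy: "X *\<^sub>v y \<in> carrier_vec n" and Xa: "X *\<^sub>v a \<in> carrier_vec n" using X y a by auto
  have "(transpose_mat X *\<^sub>v (X *\<^sub>v y)) \<bullet> a = (X *\<^sub>v y) \<bullet> (X *\<^sub>v a)"
    by (rule transpose_vec_mult_scalar[OF X a Xy])
  also have "\<dots> = (\<Sum>j<n. dot p (entries X j) (vec_index y) * dot p (entries X j) (vec_index a))"
    using X y a Xy Xa by (simp add: scalar_prod_dot[OF carrier_vecD[OF Xa]] dot_def[of n] mult_mat_vec_dot del: index_mult_mat_vec)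
  finally have 1: "(transpose_mat X *\<^sub>v (X *\<^sub>v y)) \<bullet> a = \<dots>" .
  have 2: "(r \<cdot>\<^sub>v y) \<bullet> a = r * dot p (vec_index y) (vec_index a)"
    using smult_scalar_prod_distrib[OF y a, of r] by (simp add: scalar_prod_dot[OF carrier_vecD[OF a]])
  have "(transpose_mat X *\<^sub>v (X *\<^sub>v y) + r \<cdot>\<^sub>v y) \<bullet> a
      = (transpose_mat X *\<^sub>v (X *\<^sub>v y)) \<bullet> a + (r \<cdot>\<^sub>v y) \<bullet> a"
    by (rule add_scalar_prod_distrib[of _ p]) (use X Xt Xy y a in auto)
  then show ?thesis unfolding e 1 2 .
qed

lemma ridge_inverse:
  fixes X :: "real mat"
  assumes X: "X \<in> carrier_mat n p" and r: "0 < r"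
  defines "A \<equiv> transpose_mat X * X + r \<cdot>\<^sub>m 1\<^sub>m p"
  obtains B where "mat_inverse A = Some B" "A * B = 1\<^sub>m p" "B * A = 1\<^sub>m p" "B \<in> carrier_mat p p"
proof -
  have A: "A \<in> carrier_mat p p" unfolding A_def using X by simp
  have "det A \<noteq> 0"
  proof
    assume "det A = 0"
    then obtain v where v: "v \<in> carrier_vec p" "v \<noteq> 0\<^sub>v p" "A *\<^sub>v v = 0\<^sub>v p"
      using det_0_iff_vec_prod_zero[OF A] by auto
    have "(\<Sum>j<n. (dot p (entries X j) (vec_index v))\<^sup>2) + r * dot p (vec_index v) (vec_index v) = 0"
      using ridge_gram_weak[OF X v(1) v(1), of r] v unfolding A_def[symmetric] by (simp add: power2_eq_square)
    moreover have "0 \<le> (\<Sum>j<n. (dot p (entries X j) (vec_index v))\<^sup>2)" by (intro sum_nonneg) auto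
    moreover have "0 \<le> r * dot p (vec_index v) (vec_index v)" using r dot_self_nonneg[of p "vec_index v"] by simp
    ultimately have "r * dot p (vec_index v) (vec_index v) = 0" by linarith
    then have "dot p (vec_index v) (vec_index v) = 0" using r by simp
    then have "\<And>c. c < p \<Longrightarrow> v $ c = 0" unfolding dot_def by (subst (asm) sum_nonneg_eq_0_iff) auto
    then have "v = 0\<^sub>v p" using v(1) by (intro eq_vecI) auto
    with v(2) show False by simp
  qed
  then have "A \<in> Units (ring_mat TYPE(real) p ())" by (rule det_non_zero_imp_unit[OF A])
  then obtain B where B: "mat_inverse A = Some B" using mat_inverse(1)[OF A, of "()"] by (cases "mat_inverse A") auto
  with mat_inverse(2)[OF A B] show ?thesis by (intro that[of B]) auto
qed

lemma ridge_mat_carrier: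
  assumes "X \<in> carrier_mat n p" "0 < r" shows "ridge_mat r X \<in> carrier_mat p n"
  using ridge_inverse[OF assms] assms by (metis carrier_matD(2) mult_carrier_mat option.sel ridge_mat_def transpose_carrier_mat)

text \<open>The bridge from the matrix inverse to weak equations: y = R X^T e solves them with right-hand side
X^T e.\<close>

lemma ridge_mat_solves:
  assumes X: "X \<in> carrier_mat n p" and r: "0 < r" and e: "e \<in> carrier_vec n"
  shows "solves p r (entries X) {..<n} (\<lambda>c. \<Sum>j<n. e $ j * entries X j c) (vec_index (ridge_mat r X *\<^sub>v e))"
proof -
  obtain B where B: "mat_inverse (transpose_mat X * X + r \<cdot>\<^sub>m 1\<^sub>m p) = Some B"
      "(transpose_mat X * X + r \<cdot>\<^sub>m 1\<^sub>m p) * B = 1\<^sub>m p" "B \<in> carrier_mat p p"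
    using ridge_inverse[OF X r] by blast
  have Xt: "transpose_mat X \<in> carrier_mat p n" using X by simp
  define y where "y = ridge_mat r X *\<^sub>v e"
  have yB: "y = B *\<^sub>v (transpose_mat X *\<^sub>v e)"
    using X Xt e B by (simp add: y_def ridge_mat_def assoc_mult_mat_vec[of _ p p _ n])
  have y: "y \<in> carrier_vec p" unfolding yB using B Xt e by simp
  have "(transpose_mat X * X + r \<cdot>\<^sub>m 1\<^sub>m p) *\<^sub>v y = ((transpose_mat X * X + r \<cdot>\<^sub>m 1\<^sub>m p) * B) *\<^sub>v (transpose_mat X *\<^sub>v e)"
    unfolding yB using B(3) Xt X e by (subst assoc_mult_mat_vec[of _ p p]) auto
  then have Ay: "(transpose_mat X * X + r \<cdot>\<^sub>m 1\<^sub>m p) *\<^sub>v y = transpose_mat X *\<^sub>v e"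
    using B(2) Xt e by simp
  show ?thesis unfolding solves_def y_def[symmetric]
  proof
    fix a :: "nat \<Rightarrow> real"
    define v where "v = Matrix.vec p a"
    have v: "v \<in> carrier_vec p" by (simp add: v_def)
    have va: "dot p b (vec_index v) = dot p b a" for b by (rule dot_cong) (auto simp: v_def)
    have "(\<Sum>j<n. dot p (entries X j) (vec_index y) * dot p (entries X j) a) + r * dot p (vec_index y) a = (transpose_mat X *\<^sub>v e) \<bullet> v"
      using ridge_gram_weak[OF X y v, of r] unfolding Ay va by simp
    also have "\<dots> = e \<bullet> (X *\<^sub>v v)" by (rule transpose_vec_mult_scalar[OF X v e])
    also have "\<dots> = (\<Sum>j<n. e $ j * dot p (entries X j) a)"
      using X v e by (simp add: scalar_prod_dot[of _ n] dot_def[of n] mult_mat_vec_dot va del: index_mult_mat_vec)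
    also have "\<dots> = dot p (\<lambda>c. \<Sum>j<n. e $ j * entries X j c) a" by (simp add: dot_sum)
    finally show "(\<Sum>j<n. dot p (entries X j) (vec_index y) * dot p (entries X j) a) + r * dot p (vec_index y) a
      = dot p (\<lambda>c. \<Sum>j<n. e $ j * entries X j c) a" .
  qed
qed

abbreviation ridge_resolvent :: "real \<Rightarrow> real mat \<Rightarrow> (nat \<Rightarrow> real) \<Rightarrow> nat \<Rightarrow> real" where
  "ridge_resolvent r X b \<equiv> resolvent (dim_col X) r (entries X) [0..<dim_row X] b"

lemma ridge_resolvent_solves:
  assumes "X \<in> carrier_mat n p" "0 < r"
  shows "solves p r (entries X) {..<n} b (ridge_resolvent r X b)"
  using resolvent_solves[of "[0..<n]" r p "entries X" b] assms by (simp add: lessThan_atLeast0)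

text \<open>R is symmetric, so the transpose of R X^T applied to c is X R c.\<close>

lemma transpose_ridge_mat:
  assumes X: "X \<in> carrier_mat n p" and r: "0 < r" and c: "c \<in> carrier_vec p" and j: "j < n"
  shows "(transpose_mat (ridge_mat r X) *\<^sub>v c) $ j = dot p (entries X j) (ridge_resolvent r X (vec_index c))"
proof -
  note R = ridge_mat_carrier[OF X r]
  have "(transpose_mat (ridge_mat r X) *\<^sub>v c) $ j = col (ridge_mat r X) j \<bullet> c"
    using R c j by simp
  also have "col (ridge_mat r X) j = ridge_mat r X *\<^sub>v unit_vec n j"
    using R j by (intro eq_vecI) (auto simp: scalar_prod_right_unit)
  also have "\<dots> \<bullet> c = dot p (vec_index c) (vec_index (ridge_mat r X *\<^sub>v unit_vec n j))"
    using c by (simp add: scalar_prod_dot[of c p] dot_commute)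
  also have "\<dots> = dot p (\<lambda>c. \<Sum>i<n. unit_vec n j $ i * entries X i c) (ridge_resolvent r X (vec_index c))"
    by (rule solves_sym[OF ridge_resolvent_solves[OF X r] ridge_mat_solves[OF X r]]) simp
  also have "\<dots> = dot p (entries X j) (ridge_resolvent r X (vec_index c))"
    using j by (intro dot_cong) (auto simp: unit_vec_def if_distrib[of "\<lambda>t. t * _"] cong: if_cong)
  finally show ?thesis .
qed

lemma ridge_linear_form:
  assumes X: "X \<in> carrier_mat n p" and r: "0 < r" and c: "c \<in> carrier_vec p" and e: "e \<in> carrier_vec n"
  shows "c \<bullet> (ridge_mat r X *\<^sub>v e) = (\<Sum>j<n. dot p (entries X j) (ridge_resolvent r X (vec_index c)) * e $ j)"
proof -
  note R = ridge_mat_carrier[OF X r]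
  have "c \<bullet> (ridge_mat r X *\<^sub>v e) = (transpose_mat (ridge_mat r X) *\<^sub>v c) \<bullet> e"
    by (rule transpose_vec_mult_scalar[OF R e c, symmetric])
  also have "\<dots> = (\<Sum>j<n. dot p (entries X j) (ridge_resolvent r X (vec_index c)) * e $ j)"
    using e by (simp add: scalar_prod_dot[of e n] dot_def[of n] transpose_ridge_mat[OF X r c] del: index_mult_mat_vec)
  finally show ?thesis .
qed

lemma ridge_var_eq:
  assumes X: "X \<in> carrier_mat n p" and r: "0 < r" and c: "c \<in> carrier_vec p"
  shows "ridge_var s2 r X c = s2 * (\<Sum>j<n. (dot p (entries X j) (ridge_resolvent r X (vec_index c)))\<^sup>2)"
proof -
  have "transpose_mat (ridge_mat r X) *\<^sub>v c \<in> carrier_vec n" using ridge_mat_carrier[OF X r] c by simp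
  then show ?thesis by (simp add: ridge_var_def l2_norm_sq transpose_ridge_mat[OF X r c] del: index_mult_mat_vec)
qed

text \<open>The estimate is R X^T X \<beta> + R X^T e. Testing the equations of R c against \<beta> gives
c \<bullet> R X^T X \<beta> = c \<bullet> \<beta> - r (c \<bullet> R \<beta>), and the last term is the
bias.\<close>

lemma ridge_error:
  assumes X: "X \<in> carrier_mat n p" and r: "0 < r" and b: "\<beta> \<in> carrier_vec p" and e: "e \<in> carrier_vec n" and c: "c \<in> carrier_vec p"
  shows "c \<bullet> (ridge_est r X (X *\<^sub>v \<beta> + e) - \<beta>)
    = - (r * dot p (vec_index c) (ridge_resolvent r X (vec_index \<beta>)))
      + (\<Sum>j<n. dot p (entries X j) (ridge_resolvent r X (vec_index c)) * e $ j)"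
proof -
  note R = ridge_mat_carrier[OF X r]
  let ?z = "ridge_resolvent r X (vec_index c)"
  have Xb: "X *\<^sub>v \<beta> \<in> carrier_vec n" using X b by simp
  have "c \<bullet> (ridge_est r X (X *\<^sub>v \<beta> + e) - \<beta>) = c \<bullet> (ridge_mat r X *\<^sub>v (X *\<^sub>v \<beta> + e)) - c \<bullet> \<beta>"
    unfolding ridge_est_def using R Xb e b c by (intro scalar_prod_minus_distrib[of _ p]) auto
  also have "\<dots> = (\<Sum>j<n. dot p (entries X j) ?z * (X *\<^sub>v \<beta> + e) $ j) - dot p (vec_index c) (vec_index \<beta>)"
    using ridge_linear_form[OF X r c, of "X *\<^sub>v \<beta> + e"] Xb e b by (simp add: scalar_prod_dot[of \<beta> p])
  also have "(\<Sum>j<n. dot p (entries X j) ?z * (X *\<^sub>v \<beta> + e) $ j)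
     = (\<Sum>j<n. dot p (entries X j) ?z * dot p (entries X j) (vec_index \<beta>)) + (\<Sum>j<n. dot p (entries X j) ?z * e $ j)"
    using Xb e b X by (simp add: mult_mat_vec_dot[OF X b] distrib_left sum.distrib del: index_mult_mat_vec)
  also have "(\<Sum>j<n. dot p (entries X j) ?z * dot p (entries X j) (vec_index \<beta>)) = dot p (vec_index c) (vec_index \<beta>) - r * dot p ?z (vec_index \<beta>)"
    using solvesD[OF ridge_resolvent_solves[OF X r], of "vec_index c" "vec_index \<beta>"] by simp
  also have "dot p ?z (vec_index \<beta>) = dot p (vec_index c) (ridge_resolvent r X (vec_index \<beta>))"
    using solves_sym[OF ridge_resolvent_solves[OF X r] ridge_resolvent_solves[OF X r], of "vec_index \<beta>" "vec_index c"]
    by (simp add: dot_commute)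
  finally show ?thesis by simp
qed

text \<open>The estimation error h solves the normal equations with the right-hand side X^T e - r \<beta>, so the
energy bound \<open>solves_fit_le\<close> applies to it.\<close>

lemma ridge_fit_error:
  assumes X: "X \<in> carrier_mat n p" and r: "0 < r" and b: "\<beta> \<in> carrier_vec p" and e: "e \<in> carrier_vec n"
  defines "h \<equiv> ridge_est r X (X *\<^sub>v \<beta> + e) - \<beta>"
  shows "(\<Sum>j<n. (dot p (entries X j) (vec_index h))\<^sup>2)
     \<le> (\<Sum>c<p. (\<Sum>j<n. e $ j * entries X j c)\<^sup>2) / r + r * dot p (vec_index \<beta>) (vec_index \<beta>)"
    and "\<And>j. j < n \<Longrightarrow> ridge_resid r X (X *\<^sub>v \<beta> + e) $ j = e $ j - dot p (entries X j) (vec_index h)"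
proof -
  note R = ridge_mat_carrier[OF X r]
  have Xb: "X *\<^sub>v \<beta> \<in> carrier_vec n" using X b by simp
  define u where "u = (\<lambda>c. \<Sum>j<n. e $ j * entries X j c)"
  define y where "y = ridge_est r X (X *\<^sub>v \<beta> + e)"
  have y: "y \<in> carrier_vec p" unfolding y_def ridge_est_def using R Xb e by simp
  have hc: "h \<in> carrier_vec p" unfolding h_def using y b by (simp add: y_def)
  have hd: "dot p a (vec_index h) = dot p a (vec_index y) - dot p a (vec_index \<beta>)" for a
  proof -
    have "dot p a (vec_index h) = dot p a (\<lambda>c. y $ c - 1 * \<beta> $ c)"
      using y b by (intro dot_cong) (auto simp: h_def y_def)
    then show ?thesis using dot_diff_scaled[of p a "vec_index y" 1 "vec_index \<beta>"] by simp
  qed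
  have ys: "solves p r (entries X) {..<n} (\<lambda>c. \<Sum>j<n. (X *\<^sub>v \<beta> + e) $ j * entries X j c) (vec_index y)"
    unfolding y_def ridge_est_def by (rule ridge_mat_solves[OF X r]) (use Xb e in auto)
  have "solves p r (entries X) {..<n} (\<lambda>c. u c - r * \<beta> $ c) (vec_index h)"
    unfolding solves_def
  proof
    fix a
    have "(\<Sum>j<n. dot p (entries X j) (vec_index y) * dot p (entries X j) a) + r * dot p (vec_index y) a
        = (\<Sum>j<n. (X *\<^sub>v \<beta> + e) $ j * dot p (entries X j) a)"
      using solvesD[OF ys, of a] by (simp add: dot_sum)
    also have "\<dots> = (\<Sum>j<n. dot p (entries X j) (vec_index \<beta>) * dot p (entries X j) a) + (\<Sum>j<n. e $ j * dot p (entries X j) a)"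
      using Xb e by (simp add: mult_mat_vec_dot[OF X b] distrib_right sum.distrib del: index_mult_mat_vec)
    also have "(\<Sum>j<n. e $ j * dot p (entries X j) a) = dot p u a" by (simp add: u_def dot_sum)
    finally have "(\<Sum>j<n. dot p (entries X j) (vec_index y) * dot p (entries X j) a) + r * dot p (vec_index y) a
        = (\<Sum>j<n. dot p (entries X j) (vec_index \<beta>) * dot p (entries X j) a) + dot p u a" .
    moreover have "dot p (vec_index h) a = dot p (vec_index y) a - dot p (vec_index \<beta>) a"
      using hd[of a] by (simp add: dot_commute)
    ultimately show "(\<Sum>j<n. dot p (entries X j) (vec_index h) * dot p (entries X j) a) + r * dot p (vec_index h) a
        = dot p (\<lambda>c. u c - r * \<beta> $ c) a"
      by (simp add: hd dot_diff_scaled' left_diff_distrib right_diff_distrib sum_subtractf)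
  qed
  from solves_fit_le[OF this r]
  have "(\<Sum>j<n. (dot p (entries X j) (vec_index h))\<^sup>2) \<le> dot p (\<lambda>c. u c - r * \<beta> $ c) (\<lambda>c. u c - r * \<beta> $ c) / (2 * r)" .
  also have "\<dots> \<le> (2 * dot p u u + 2 * r\<^sup>2 * dot p (vec_index \<beta>) (vec_index \<beta>)) / (2 * r)"
  proof (intro divide_right_mono)
    have "dot p (\<lambda>c. u c - r * \<beta> $ c) (\<lambda>c. u c - r * \<beta> $ c) \<le> (\<Sum>c<p. 2 * (u c * u c) + 2 * r\<^sup>2 * (\<beta> $ c * \<beta> $ c))"
      unfolding dot_def
    proof (rule sum_mono)
      fix c
      have "0 \<le> (u c + r * \<beta> $ c)\<^sup>2" by simp
      then show "(u c - r * \<beta> $ c) * (u c - r * \<beta> $ c) \<le> 2 * (u c * u c) + 2 * r\<^sup>2 * (\<beta> $ c * \<beta> $ c)"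
        by (simp add: power2_eq_square algebra_simps)
    qed
    then show "dot p (\<lambda>c. u c - r * \<beta> $ c) (\<lambda>c. u c - r * \<beta> $ c) \<le> 2 * dot p u u + 2 * r\<^sup>2 * dot p (vec_index \<beta>) (vec_index \<beta>)"
      by (simp add: dot_def sum.distrib sum_distrib_left)
  qed (use r in auto)
  also have "\<dots> = (\<Sum>c<p. (u c)\<^sup>2) / r + r * dot p (vec_index \<beta>) (vec_index \<beta>)"
    using r by (simp add: dot_def[of p u] power2_eq_square add_divide_distrib)
  finally show "(\<Sum>j<n. (dot p (entries X j) (vec_index h))\<^sup>2)
     \<le> (\<Sum>c<p. (\<Sum>j<n. e $ j * entries X j c)\<^sup>2) / r + r * dot p (vec_index \<beta>) (vec_index \<beta>)"
    by (simp add: u_def)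
  fix j assume j: "j < n"
  have "ridge_resid r X (X *\<^sub>v \<beta> + e) $ j = (X *\<^sub>v \<beta>) $ j + e $ j - (X *\<^sub>v y) $ j"
    using X y b e Xb j unfolding ridge_resid_def y_def[symmetric] by (simp del: index_mult_mat_vec)
  then show "ridge_resid r X (X *\<^sub>v \<beta> + e) $ j = e $ j - dot p (entries X j) (vec_index h)"
    using j by (simp add: hd mult_mat_vec_dot[OF X b] mult_mat_vec_dot[OF X y] del: index_mult_mat_vec)
qed

section \<open>Conditional laws and conditional expectations\<close>

lemma (in prob_space) indep_set_joint_law:
  assumes X: "X \<in> measurable M N" and Z: "Z \<in> measurable M P"
    and ind: "indep_set (sets (sigma_gen M N X)) (sets (sigma_gen M P Z))"
  shows "distr M (N \<Otimes>\<^sub>M P) (\<lambda>w. (X w, Z w)) = distr M N X \<Otimes>\<^sub>M distr M P Z"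
proof (rule pair_measure_eqI[symmetric])
  interpret DX: prob_space "distr M N X" by (rule prob_space_distr[OF X])
  interpret DZ: prob_space "distr M P Z" by (rule prob_space_distr[OF Z])
  show "sigma_finite_measure (distr M N X)" "sigma_finite_measure (distr M P Z)" by unfold_locales
  show "sets (distr M N X \<Otimes>\<^sub>M distr M P Z) = sets (distr M (N \<Otimes>\<^sub>M P) (\<lambda>w. (X w, Z w)))"
    by (simp cong: sets_pair_measure_cong)
  fix A B assume "A \<in> sets (distr M N X)" "B \<in> sets (distr M P Z)"
  then have A: "A \<in> sets N" and B: "B \<in> sets P" by auto
  have XZ: "(\<lambda>w. (X w, Z w)) \<in> measurable M (N \<Otimes>\<^sub>M P)" using X Z by measurable
  have A': "X -` A \<inter> space M \<in> sets (sigma_gen M N X)" and B': "Z -` B \<inter> space M \<in> sets (sigma_gen M P Z)"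
    using A B unfolding sigma_gen_def by (auto intro: in_vimage_algebra)
  have "prob ((X -` A \<inter> space M) \<inter> (Z -` B \<inter> space M)) = prob (X -` A \<inter> space M) * prob (Z -` B \<inter> space M)"
    by (rule indep_setD[OF ind A' B'])
  moreover have "(\<lambda>w. (X w, Z w)) -` (A \<times> B) \<inter> space M = (X -` A \<inter> space M) \<inter> (Z -` B \<inter> space M)" by auto
  ultimately show "emeasure (distr M N X) A * emeasure (distr M P Z) B = emeasure (distr M (N \<Otimes>\<^sub>M P) (\<lambda>w. (X w, Z w))) (A \<times> B)"
    using A B X Z XZ by (simp add: emeasure_distr emeasure_eq_measure ennreal_mult)
qed

lemma sigma_sets_preimage_subset:
  fixes u :: "_ \<Rightarrow> real"
  assumes X: "X \<in> measurable M N" and u: "u \<in> borel_measurable N"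
  shows "sigma_sets (space M) {(\<lambda>w. u (X w)) -` A \<inter> space M | A. A \<in> sets borel} \<subseteq> sets (sigma_gen M N X)"
proof -
  have "(\<lambda>w. u (X w)) -` A \<inter> space M \<in> sets (sigma_gen M N X)" if "A \<in> sets borel" for A
  proof -
    have "(\<lambda>w. u (X w)) -` A \<inter> space M = X -` (u -` A \<inter> space N) \<inter> space M"
      using measurable_space[OF X] by auto
    moreover have "X -` (u -` A \<inter> space N) \<inter> space M \<in> sets (sigma_gen M N X)"
      unfolding sigma_gen_def by (rule in_vimage_algebra[OF measurable_sets[OF u that]])
    ultimately show ?thesis by (simp only:)
  qed
  moreover have "space M = space (sigma_gen M N X)" by (simp add: sigma_gen_def)
  ultimately show ?thesis by (auto intro!: sets.sigma_sets_subset simp del: space_vimage_algebra)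
qed

lemma (in prob_space) indep_set_expectation_mult:
  fixes u v :: "_ \<Rightarrow> real"
  assumes X: "X \<in> measurable M N" and Z: "Z \<in> measurable M P"
    and ind: "indep_set (sets (sigma_gen M N X)) (sets (sigma_gen M P Z))"
    and u: "u \<in> borel_measurable N" "integrable M (\<lambda>w. u (X w))"
    and v: "v \<in> borel_measurable P" "integrable M (\<lambda>w. v (Z w))"
  shows "expectation (\<lambda>w. u (X w) * v (Z w)) = expectation (\<lambda>w. u (X w)) * expectation (\<lambda>w. v (Z w))"
    and "integrable M (\<lambda>w. u (X w) * v (Z w))"
proof -
  have uX: "(\<lambda>w. u (X w)) \<in> borel_measurable M" and vZ: "(\<lambda>w. v (Z w)) \<in> borel_measurable M"
    using X Z u v by (auto intro: measurable_compose)
  have "indep_set (sigma_sets (space M) {(\<lambda>w. u (X w)) -` A \<inter> space M | A. A \<in> sets borel})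
      (sigma_sets (space M) {(\<lambda>w. v (Z w)) -` A \<inter> space M | A. A \<in> sets borel})"
  proof (rule indep_setI)
    note sX = sigma_sets_preimage_subset[OF X u(1)] and sZ = sigma_sets_preimage_subset[OF Z v(1)]
    have ev: "sets (sigma_gen M N X) \<subseteq> events" "sets (sigma_gen M P Z) \<subseteq> events"
      using ind by (auto simp: indep_set_def indep_sets_def split: bool.splits)
    show "sigma_sets (space M) {(\<lambda>w. u (X w)) -` A \<inter> space M | A. A \<in> sets borel} \<subseteq> events"
      "sigma_sets (space M) {(\<lambda>w. v (Z w)) -` A \<inter> space M | A. A \<in> sets borel} \<subseteq> events"
      using sX sZ ev by auto
    fix a b assume "a \<in> sigma_sets (space M) {(\<lambda>w. u (X w)) -` A \<inter> space M | A. A \<in> sets borel}"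
      "b \<in> sigma_sets (space M) {(\<lambda>w. v (Z w)) -` A \<inter> space M | A. A \<in> sets borel}"
    then show "prob (a \<inter> b) = prob a * prob b"
      using sX sZ by (intro indep_setD[OF ind]) auto
  qed
  then have "indep_var borel (\<lambda>w. u (X w)) borel (\<lambda>w. v (Z w))"
    using uX vZ by (simp add: indep_var_eq)
  from indep_var_lebesgue_integral[OF this u(2) v(2)] indep_var_integrable[OF this u(2) v(2)]
  show "expectation (\<lambda>w. u (X w) * v (Z w)) = expectation (\<lambda>w. u (X w)) * expectation (\<lambda>w. v (Z w))"
    and "integrable M (\<lambda>w. u (X w) * v (Z w))" by auto
qed

text \<open>Distribution functions are right-continuous, so their values at rational points determine them.
Countably many values can be handled under one exceptional null set.\<close>

lemma real_distribution_eqI_rat: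
  fixes F G :: "real measure"
  assumes "real_distribution F" "real_distribution G"
    and eq: "\<And>q :: rat. emeasure F {..real_of_rat q} = emeasure G {..real_of_rat q}"
  shows "F = G"
proof (rule cdf_unique[OF assms(1,2)], rule ext, rule ccontr)
  interpret F: real_distribution F by fact
  interpret G: real_distribution G by fact
  fix x assume "cdf F x \<noteq> cdf G x"
  then have ne: "cdf F x - cdf G x \<noteq> 0" by simp
  have "((\<lambda>y. cdf F y - cdf G y) \<longlongrightarrow> cdf F x - cdf G x) (at_right x)"
    using F.cdf_is_right_cont[of x] G.cdf_is_right_cont[of x]
    by (intro tendsto_diff) (simp_all add: continuous_within)
  then have "eventually (\<lambda>y. cdf F y - cdf G y \<noteq> 0) (at_right x)"
    using ne by (rule tendsto_imp_eventually_ne)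
  then obtain b where b: "x < b" "\<And>y. x < y \<Longrightarrow> y < b \<Longrightarrow> cdf F y - cdf G y \<noteq> 0"
    unfolding eventually_at_right_field by blast
  obtain q where q: "x < real_of_rat q" "real_of_rat q < b" using of_rat_dense[OF b(1)] by blast
  have "cdf F (real_of_rat q) = cdf G (real_of_rat q)" using eq[of q] by (simp add: cdf_def measure_def)
  then show False using b(2)[OF q] by simp
qed

lemma (in prob_space) subalgebra_sigma_gen:
  assumes "X \<in> measurable M N" shows "subalgebra M (sigma_gen M N X)"
  using assms by (auto simp: subalgebra_def sigma_gen_def sets_vimage_algebra2 measurable_space intro!: measurable_sets)

text \<open>By independence, freezing X = x and averaging over Z is a version of the conditional law, and two
versions of a conditional probability agree almost surely for each event.\<close>

lemma (in prob_space) cond_law_eq: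
  fixes h :: "'b \<Rightarrow> 'c \<Rightarrow> real"
  assumes X: "X \<in> measurable M N" and Z: "Z \<in> measurable M P"
    and ind: "indep_set (sets (sigma_gen M N X)) (sets (sigma_gen M P Z))"
    and h: "(\<lambda>z. h (fst z) (snd z)) \<in> borel_measurable (N \<Otimes>\<^sub>M P)"
    and U: "\<And>w. w \<in> space M \<Longrightarrow> U w = h (X w) (Z w)"
    and K: "cond_law M (sigma_gen M N X) U K"
  shows "AE w in M. K w = distr (distr M P Z) borel (h (X w))"
proof -
  let ?F = "sigma_gen M N X" and ?Q = "distr M P Z"
  interpret Q: prob_space ?Q by (rule prob_space_distr[OF Z])
  have sub: "subalgebra M ?F" by (rule subalgebra_sigma_gen[OF X])
  interpret F: finite_measure_subalgebra M ?F by unfold_locales (rule sub)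
  have spF: "space ?F = space M" by (simp add: sigma_gen_def)
  have XF: "X \<in> measurable ?F N"
    unfolding sigma_gen_def by (rule measurable_vimage_algebra1) (use measurable_space[OF X] in auto)
  have hx: "h x \<in> borel_measurable ?Q" if "x \<in> space N" for x
    using measurable_compose[OF measurable_Pair1'[OF that] h] by simp
  have joint: "distr M (N \<Otimes>\<^sub>M P) (\<lambda>w. (X w, Z w)) = distr M N X \<Otimes>\<^sub>M ?Q" by (rule indep_set_joint_law[OF X Z ind])
  have XZ: "(\<lambda>w. (X w, Z w)) \<in> measurable M (N \<Otimes>\<^sub>M P)" using X Z by measurable
  have eq: "AE w in M. emeasure (K w) A = emeasure (distr ?Q borel (h (X w))) A" if A: "A \<in> sets borel" for A
  proof -
    define k where "k = (\<lambda>x. \<integral>\<^sup>+z. indicator A (h x z) \<partial>?Q)"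
    have ind_h: "(\<lambda>z. indicator A (h (fst z) (snd z)) :: ennreal) \<in> borel_measurable (N \<Otimes>\<^sub>M ?Q)"
      using h A by measurable
    have k[measurable]: "k \<in> borel_measurable N"
      unfolding k_def using Q.borel_measurable_nn_integral_fst[OF ind_h] by simp
    have kX: "k (X w) = emeasure (distr ?Q borel (h (X w))) A" if w: "w \<in> space M" for w
    proof -
      have x: "X w \<in> space N" using measurable_space[OF X w] .
      have "k (X w) = (\<integral>\<^sup>+t. indicator A t \<partial>distr ?Q borel (h (X w)))"
        unfolding k_def using hx[OF x] A by (subst nn_integral_distr) auto
      then show ?thesis using A by simp
    qed
    have Um: "U \<in> borel_measurable M"
    proof -
      have "(\<lambda>w. h (X w) (Z w)) \<in> borel_measurable M" using measurable_compose[OF XZ h] by simp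
      then show ?thesis using U by (simp cong: measurable_cong)
    qed
    have UA: "U -` A \<inter> space M \<in> sets M" using Um A by (rule measurable_sets)
    have "AE w in M. k (X w) = nn_cond_exp M ?F (indicator (U -` A \<inter> space M)) w"
    proof (rule F.nn_cond_exp_charact)
      fix B assume "B \<in> sets ?F"
      then obtain B' where B': "B' \<in> sets N" "B = X -` B' \<inter> space M"
        unfolding sigma_gen_def using X by (auto simp: sets_vimage_algebra2 measurable_space)
      have "(\<integral>\<^sup>+w\<in>B. indicator (U -` A \<inter> space M) w \<partial>M) = (\<integral>\<^sup>+w. indicator B' (X w) * indicator A (h (X w) (Z w)) \<partial>M)"
        using B' U by (intro nn_integral_cong) (auto simp: indicator_def)
      also have "\<dots> = (\<integral>\<^sup>+z. indicator B' (fst z) * indicator A (h (fst z) (snd z)) \<partial>distr M (N \<Otimes>\<^sub>M P) (\<lambda>w. (X w, Z w)))"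
        using h A B' XZ by (subst nn_integral_distr) auto
      also have "\<dots> = (\<integral>\<^sup>+z. indicator B' (fst z) * indicator A (h (fst z) (snd z)) \<partial>(distr M N X \<Otimes>\<^sub>M ?Q))"
        unfolding joint ..
      also have "\<dots> = (\<integral>\<^sup>+x. (\<integral>\<^sup>+z. indicator B' x * indicator A (h x z) \<partial>?Q) \<partial>distr M N X)"
        using h A B' by (subst Q.nn_integral_fst[symmetric]) auto
      also have "\<dots> = (\<integral>\<^sup>+x. indicator B' x * k x \<partial>distr M N X)"
        unfolding k_def using hx A by (intro nn_integral_cong nn_integral_cmult) (auto intro!: measurable_compose[OF hx])
      also have "\<dots> = (\<integral>\<^sup>+w. indicator B' (X w) * k (X w) \<partial>M)"
        using X B' by (subst nn_integral_distr) auto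
      also have "\<dots> = (\<integral>\<^sup>+w\<in>B. k (X w) \<partial>M)"
        using B' by (intro nn_integral_cong) (auto simp: indicator_def)
      finally show "(\<integral>\<^sup>+w\<in>B. indicator (U -` A \<inter> space M) w \<partial>M) = (\<integral>\<^sup>+w\<in>B. k (X w) \<partial>M)" .
    qed (use UA XF in \<open>auto intro: measurable_compose[OF _ k]\<close>)
    moreover have "AE w in M. emeasure (K w) A = nn_cond_exp M ?F (indicator (U -` A \<inter> space M)) w"
      using K A unfolding cond_law_def by blast
    ultimately show ?thesis using AE_space by eventually_elim (simp add: kX)
  qed
  have "AE w in M. \<forall>q::rat. emeasure (K w) {..real_of_rat q} = emeasure (distr ?Q borel (h (X w))) {..real_of_rat q}"
    unfolding AE_all_countable using eq by auto
  then show ?thesis using AE_space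
  proof eventually_elim
    case (elim w)
    have "K w \<in> space (prob_algebra borel)"
      using K elim(2) unfolding cond_law_def by (auto dest!: measurable_space simp: spF)
    then have 1: "real_distribution (K w)"
      by (simp add: space_prob_algebra real_distribution_def real_distribution_axioms_def)
    have 2: "real_distribution (distr ?Q borel (h (X w)))"
      using measurable_space[OF X elim(2)] by (intro Q.real_distribution_distr hx)
    show ?case by (rule real_distribution_eqI_rat[OF 1 2]) (use elim(1) in auto)
  qed
qed

text \<open>Markov's inequality on the event G. Since G belongs to the conditioning \<sigma>-algebra, the
conditional expectation has the same integral over G as f.\<close>

lemma (in prob_space) nn_cond_exp_le_prob:
  assumes sub: "subalgebra M F" and G: "G \<in> sets F" and \<eta>: "(\<integral>\<^sup>+w. f w * indicator G w \<partial>M) \<le> ennreal \<eta>" "0 \<le> \<eta>" and d: "0 < d"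
  shows "prob G - \<eta> / d \<le> prob {w \<in> space M. nn_cond_exp M F f w \<le> ennreal d}"
proof (cases "f \<in> borel_measurable M")
  case False
  \<comment> \<open>The conditional expectation of a non-measurable function is 0 by convention.\<close>
  then have "{w \<in> space M. nn_cond_exp M F f w \<le> ennreal d} = space M" by (auto simp: nn_cond_exp_def)
  then have "prob {w \<in> space M. nn_cond_exp M F f w \<le> ennreal d} = 1" by (simp only: prob_space)
  moreover have "0 \<le> \<eta> / d" using \<eta> d by simp
  ultimately show ?thesis using prob_le_1[of G] by linarith
next
  case f: True
  interpret F: finite_measure_subalgebra M F by unfold_locales (rule sub)
  define q where "q = nn_cond_exp M F f"
  have qF: "q \<in> borel_measurable F" unfolding q_def by simp
  have qM[measurable]: "q \<in> borel_measurable M" unfolding q_def by simp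
  have GM[measurable]: "G \<in> sets M" using G sub by (auto simp: subalgebra_def)
  have "(\<integral>\<^sup>+w. indicator G w * f w \<partial>M) = (\<integral>\<^sup>+w. indicator G w * q w \<partial>M)"
    unfolding q_def using G f by (intro F.nn_cond_exp_intg[symmetric]) auto
  then have qG: "(\<integral>\<^sup>+w. q w * indicator G w \<partial>M) \<le> ennreal \<eta>" using \<eta>(1) by (simp add: mult.commute)
  define B where "B = {w \<in> space M. \<not> q w \<le> ennreal d} \<inter> G"
  have B[measurable]: "B \<in> events" unfolding B_def by measurable
  have "ennreal d * emeasure M B = (\<integral>\<^sup>+w. ennreal d * indicator B w \<partial>M)" by (simp add: nn_integral_cmult_indicator)
  also have "\<dots> \<le> (\<integral>\<^sup>+w. q w * indicator G w \<partial>M)"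
    by (intro nn_integral_mono) (auto simp: B_def indicator_def)
  also have "\<dots> \<le> ennreal \<eta>" by (rule qG)
  finally have "ennreal (d * prob B) \<le> ennreal \<eta>" using d by (simp add: emeasure_eq_measure ennreal_mult)
  then have "d * prob B \<le> \<eta>" using \<eta>(2) by (simp add: ennreal_le_iff)
  then have pB: "prob B \<le> \<eta> / d" using d by (simp add: le_divide_eq mult.commute)
  have S: "{w \<in> space M. q w \<le> ennreal d} \<in> events" by measurable
  have "G \<subseteq> {w \<in> space M. q w \<le> ennreal d} \<union> B" using sets.sets_into_space[OF GM] by (auto simp: B_def)
  then have "prob G \<le> prob ({w \<in> space M. q w \<le> ennreal d} \<union> B)" using S B by (intro finite_measure_mono) auto
  also have "\<dots> \<le> prob {w \<in> space M. q w \<le> ennreal d} + prob B" using S B by (intro measure_Un_le)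
  finally show ?thesis using pB unfolding q_def by simp
qed

section \<open>The ridge model at a fixed sample size\<close>

lemma space_vec_borel: "space (vec_borel d) = carrier_vec d"
  by (simp add: vec_borel_def)

lemma space_mat_borel: "space (mat_borel n d) = carrier_mat n d"
  by (simp add: mat_borel_def)

lemma vec_borel_coords: "(\<lambda>v. \<lambda>i\<in>{..<d}. vec_index v i) \<in> measurable (vec_borel d) (vecM d)"
  unfolding vec_borel_def by (rule measurable_vimage_algebra1) (auto simp: space_PiM)

lemma vec_borel_index: "i < d \<Longrightarrow> (\<lambda>v. vec_index v i) \<in> borel_measurable (vec_borel d)"
  using measurable_compose[OF vec_borel_coords measurable_component_singleton[of i "{..<d}" "\<lambda>_. borel"]] by simp

lemma mat_borel_index: "i < n \<Longrightarrow> c < d \<Longrightarrow> (\<lambda>A. A $$ (i, c)) \<in> borel_measurable (mat_borel n d)"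
proof -
  assume ic: "i < n" "c < d"
  have "(\<lambda>A. \<lambda>ij\<in>{..<n} \<times> {..<d}. A $$ ij) \<in> measurable (mat_borel n d) (PiM ({..<n} \<times> {..<d}) (\<lambda>_. borel))"
    unfolding mat_borel_def by (rule measurable_vimage_algebra1) (auto simp: space_PiM)
  from measurable_compose[OF this measurable_component_singleton[of "(i,c)"]] ic show ?thesis by simp
qed

locale ridge_model = prob_space M for M :: "'w measure" +
  fixes n p :: nat and X :: "'w \<Rightarrow> real mat" and eps :: "'w \<Rightarrow> real Matrix.vec"
    and \<beta> :: "real Matrix.vec" and \<Sigma> :: "real mat" and F0 :: "real measure" and s2 :: real
  assumes n: "0 < n" and beta: "\<beta> \<in> carrier_vec p"
    and X_rv: "X \<in> measurable M (mat_borel n p)"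
    and X_rows_indep: "indep_vars (\<lambda>_. vec_borel p) (\<lambda>i w. row (X w) i) {..<n}"
    and X_rows_gaussian: "\<And>i. i < n \<Longrightarrow> centered_gaussian p \<Sigma> (distr M (vec_borel p) (\<lambda>w. row (X w) i))"
    and eps_rv: "eps \<in> measurable M (vec_borel n)"
    and eps_indep: "indep_vars (\<lambda>_. borel) (\<lambda>i w. vec_index (eps w) i) {..<n}"
    and eps_law: "\<And>i. i < n \<Longrightarrow> distr M borel (\<lambda>w. vec_index (eps w) i) = F0"
    and X_eps_indep: "indep_set (sets (sigma_gen M (mat_borel n p) X)) (sets (sigma_gen M (vec_borel n) eps))"
    and F0: "real_distribution F0" "integrable F0 (\<lambda>x. x\<^sup>2)" "integrable F0 (\<lambda>x. x ^ 4)"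
      "(\<integral>x. x \<partial>F0) = 0" "(\<integral>x. x\<^sup>2 \<partial>F0) = s2" "0 < s2"
begin

abbreviation cov :: "nat \<Rightarrow> nat \<Rightarrow> real" where "cov \<equiv> \<lambda>c d. \<Sigma> $$ (c, d)"

text \<open>Made undefined outside the coordinates below p, so that its values are points of the product space.\<close>

definition xrow :: "nat \<Rightarrow> 'w \<Rightarrow> nat \<Rightarrow> real" where
  "xrow i w = (\<lambda>c\<in>{..<p}. row (X w) i $ c)"

lemma X_carrier: "w \<in> space M \<Longrightarrow> X w \<in> carrier_mat n p"
  using measurable_space[OF X_rv] by (simp add: space_mat_borel)

lemma eps_carrier: "w \<in> space M \<Longrightarrow> eps w \<in> carrier_vec n"
  using measurable_space[OF eps_rv] by (simp add: space_vec_borel)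

lemma xrow_eq: "w \<in> space M \<Longrightarrow> i < n \<Longrightarrow> c < p \<Longrightarrow> xrow i w c = X w $$ (i, c)"
  using X_carrier[of w] by (simp add: xrow_def)

lemma cov_mat: "\<Sigma> \<in> carrier_mat p p" "transpose_mat \<Sigma> = \<Sigma>"
  using X_rows_gaussian[OF n] by (auto simp: centered_gaussian_def covariance_mat_def)

lemma cov_sym: "c < p \<Longrightarrow> d < p \<Longrightarrow> cov c d = cov d c"
  using cov_mat by (metis carrier_matD index_transpose_mat(1))

lemma quad_scalar_prod: "quad p cov a = Matrix.vec p a \<bullet> (\<Sigma> *\<^sub>v Matrix.vec p a)"
proof -
  have "\<Sigma> *\<^sub>v Matrix.vec p a \<in> carrier_vec p" using cov_mat by simp
  then show ?thesis
    using cov_mat by (simp add: quad_def scalar_prod_def lessThan_atLeast0 sum_distrib_left mult.assoc)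
qed

lemma row_gaussian_law:
  assumes i: "i < n" shows "gaussian_law (distr M (vecM p) (xrow i)) p cov"
proof -
  let ?\<mu> = "distr M (vec_borel p) (\<lambda>w. row (X w) i)"
  have g: "centered_gaussian p \<Sigma> ?\<mu>" by (rule X_rows_gaussian[OF i])
  have row: "(\<lambda>w. row (X w) i) \<in> measurable M (vec_borel p)"
    using X_rows_indep i by (auto simp: indep_vars_def)
  have xr: "xrow i \<in> measurable M (vecM p)"
    unfolding xrow_def[abs_def] using measurable_compose[OF row vec_borel_coords] by simp
  have law: "distr (distr M (vecM p) (xrow i)) borel (dot p a) = univ_normal 0 (quad p cov a)" for a
  proof -
    have d: "dot p a \<in> borel_measurable (vecM p)"
      by (intro measurable_dot[of p "\<lambda>_. a" _ "\<lambda>y. y"]) (auto intro: measurable_component_singleton)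
    have sp: "(\<lambda>v. Matrix.vec p a \<bullet> v) \<in> borel_measurable (vec_borel p)"
    proof -
      have "(\<lambda>v. dot p a (vec_index v)) \<in> borel_measurable (vec_borel p)"
        by (intro measurable_dot vec_borel_index) auto
      moreover have "dot p a (vec_index v) = Matrix.vec p a \<bullet> v" if "v \<in> space (vec_borel p)" for v
        using that by (simp add: space_vec_borel scalar_prod_dot[OF carrier_vecD] dot_def)
      ultimately show ?thesis by (simp cong: measurable_cong)
    qed
    have "distr (distr M (vecM p) (xrow i)) borel (dot p a) = distr M borel (\<lambda>w. dot p a (xrow i w))"
      using xr d by (subst distr_distr) (auto simp: comp_def)
    also have "\<dots> = distr M borel (\<lambda>w. Matrix.vec p a \<bullet> row (X w) i)"
    proof (intro distr_cong refl)
      fix w assume w: "w \<in> space M"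
      have "dim_vec (row (X w) i) = p" using X_carrier[OF w] by simp
      then have "Matrix.vec p a \<bullet> row (X w) i = dot p (vec_index (Matrix.vec p a)) (vec_index (row (X w) i))" by (rule scalar_prod_dot)
      also have "\<dots> = dot p a (xrow i w)" by (rule dot_cong) (auto simp: xrow_def)
      finally show "dot p a (xrow i w) = Matrix.vec p a \<bullet> row (X w) i" ..
    qed
    also have "\<dots> = distr ?\<mu> borel (\<lambda>v. Matrix.vec p a \<bullet> v)"
      using row sp by (subst distr_distr) (auto simp: comp_def)
    also have "\<dots> = univ_normal 0 (quad p cov a)"
      using g unfolding centered_gaussian_def quad_scalar_prod by (metis vec_carrier)
    finally show ?thesis .
  qed
  show ?thesis
  proof (rule gaussian_law.intro)
    show "prob_space (distr M (vecM p) (xrow i))" by (rule prob_space_distr[OF xr])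
    show "gaussian_law_axioms (distr M (vecM p) (xrow i)) p cov"
    proof
      show "0 \<le> quad p cov a" for a
        using g unfolding centered_gaussian_def covariance_mat_def quad_scalar_prod by auto
    qed (simp_all add: law)
  qed
qed

sublocale design: gaussian_design M n p xrow cov
proof (rule gaussian_design.intro, rule prob_space_axioms, rule gaussian_design_axioms.intro)
  show "indep_vars (\<lambda>_. vecM p) xrow {..<n}"
    using indep_vars_compose2[OF X_rows_indep vec_borel_coords] by (simp add: xrow_def[abs_def])
  show "gaussian_law (distr M (vecM p) (xrow i)) p cov" if "i < n" for i by (rule row_gaussian_law[OF that])
  show "cov c d = cov d c" if "c < p" "d < p" for c d by (rule cov_sym[OF that])
  show "0 \<le> quad p cov a" for a using gaussian_law.psd[OF row_gaussian_law[OF n]] .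
qed

lemma eps_measurable: "i < n \<Longrightarrow> (\<lambda>w. eps w $ i) \<in> borel_measurable M"
  by (rule measurable_compose[OF eps_rv vec_borel_index])

lemma X_measurable: "i < n \<Longrightarrow> c < p \<Longrightarrow> (\<lambda>w. X w $$ (i, c)) \<in> borel_measurable M"
  by (rule measurable_compose[OF X_rv mat_borel_index])

lemma eps_moments:
  assumes i: "i < n"
  shows "integrable M (\<lambda>w. (eps w $ i)\<^sup>2)" "expectation (\<lambda>w. (eps w $ i)\<^sup>2) = s2"
    "integrable M (\<lambda>w. eps w $ i)" "expectation (\<lambda>w. eps w $ i) = 0"
proof -
  note m = eps_measurable[OF i]
  show 1: "integrable M (\<lambda>w. (eps w $ i)\<^sup>2)"
    using F0(2) unfolding eps_law[OF i, symmetric] by (subst (asm) integrable_distr_eq[OF m]) auto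
  show "expectation (\<lambda>w. (eps w $ i)\<^sup>2) = s2"
    using F0(5) unfolding eps_law[OF i, symmetric] by (subst (asm) integral_distr[OF m]) auto
  show "integrable M (\<lambda>w. eps w $ i)" by (rule square_integrable_imp_integrable[OF m 1])
  show "expectation (\<lambda>w. eps w $ i) = 0"
    using F0(4) unfolding eps_law[OF i, symmetric] by (subst (asm) integral_distr[OF m]) auto
qed

lemma X_moments:
  assumes i: "i < n" and c: "c < p"
  shows "integrable M (\<lambda>w. (X w $$ (i, c))\<^sup>2)" "expectation (\<lambda>w. (X w $$ (i, c))\<^sup>2) = cov c c"
proof -
  interpret G: gaussian_law "distr M (vecM p) (xrow i)" p cov by (rule row_gaussian_law[OF i])
  define u :: "nat \<Rightarrow> real" where "u = (\<lambda>i. if i = c then 1 else 0)"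
  have du: "dot p u y = y c" for y
    using c by (simp add: dot_def u_def if_distrib[of "\<lambda>t. t * _"] cong: if_cong)
  have qu: "quad p cov u = cov c c"
    using c by (simp add: quad_def u_def if_distrib[of "\<lambda>t. t * _"] if_distrib[of "\<lambda>t. _ * t"] cong: if_cong)
  note xr = design.row_measurable[OF i]
  have m: "(\<lambda>y :: nat \<Rightarrow> real. (y c)\<^sup>2) \<in> borel_measurable (vecM p)"
    using c by (intro borel_measurable_power measurable_component_singleton) auto
  have eq: "(xrow i w c)\<^sup>2 = (X w $$ (i, c))\<^sup>2" if "w \<in> space M" for w using xrow_eq[OF that i c] by simp
  show "integrable M (\<lambda>w. (X w $$ (i, c))\<^sup>2)"
    using G.second_moment(2)[of u] integrable_distr_eq[OF xr m] eq
    by (simp add: du cong: Bochner_Integration.integrable_cong)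
  have "expectation (\<lambda>w. (X w $$ (i, c))\<^sup>2) = expectation (\<lambda>w. (xrow i w c)\<^sup>2)"
    by (intro Bochner_Integration.integral_cong refl) (simp add: eq)
  also have "\<dots> = G.expectation (\<lambda>y. (dot p u y)\<^sup>2)"
    using integral_distr[OF xr m] by (simp add: du)
  finally show "expectation (\<lambda>w. (X w $$ (i, c))\<^sup>2) = cov c c" using G.second_moment(1)[of u] qu by simp
qed

lemma trace_nonneg: "0 \<le> (\<Sum>c<p. cov c c)"
proof (rule sum_nonneg)
  fix c assume "c \<in> {..<p}"
  then show "0 \<le> cov c c"
    using X_moments(2)[OF n, of c] integral_nonneg_AE[where M = M and f = "\<lambda>w. (X w $$ (0, c))\<^sup>2"] by simp
qed

lemma eps_sum_moment:
  "expectation (\<lambda>w. (\<Sum>j<n. eps w $ j)\<^sup>2) = real n * s2" "integrable M (\<lambda>w. (\<Sum>j<n. eps w $ j)\<^sup>2)"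
  using second_moment_indep[OF finite_lessThan eps_indep eps_moments(1) eps_moments(4), of 0]
  by (simp_all add: eps_moments)

text \<open>The terms \<epsilon>_j X_jc are uncorrelated: by independence of X and \<epsilon> the mean of a product
of two of them contains the factor E (\<epsilon>_j \<epsilon>_l) = 0.\<close>

lemma score_moment:
  assumes c: "c < p"
  shows "expectation (\<lambda>w. (\<Sum>j<n. eps w $ j * X w $$ (j, c))\<^sup>2) = real n * s2 * cov c c"
    and "integrable M (\<lambda>w. (\<Sum>j<n. eps w $ j * X w $$ (j, c))\<^sup>2)"
proof -
  define D where "D = (\<lambda>j w. X w $$ (j, c) * eps w $ j)"
  note im = indep_set_expectation_mult[OF X_rv eps_rv X_eps_indep]
  have X1: "integrable M (\<lambda>w. X w $$ (j, c))" if "j < n" for j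
    by (rule square_integrable_imp_integrable[OF X_measurable[OF that c] X_moments(1)[OF that c]])
  have XX: "integrable M (\<lambda>w. X w $$ (j, c) * X w $$ (l, c))" if "j < n" "l < n" for j l
    by (rule square_integrable_mult) (use X_measurable X_moments(1) that c in auto)
  have Xm: "(\<lambda>A. A $$ (j, c)) \<in> borel_measurable (mat_borel n p)" if "j < n" for j by (rule mat_borel_index[OF that c])
  have sq: "integrable M (\<lambda>w. (D j w)\<^sup>2)" "expectation (\<lambda>w. (D j w)\<^sup>2) = s2 * cov c c" if j: "j < n" for j
    using im[of "\<lambda>A. (A $$ (j, c))\<^sup>2" "\<lambda>v. (v $ j)\<^sup>2"] Xm[OF j] vec_borel_index[OF j] X_moments[OF j c] eps_moments[OF j]
    by (simp_all add: D_def power_mult_distrib mult.commute)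
  have mean: "expectation (D j) = 0" if j: "j < n" for j
    using im(1)[of "\<lambda>A. A $$ (j, c)" "\<lambda>v. v $ j"] Xm[OF j] vec_borel_index[OF j] X1[OF j] eps_moments[OF j]
    by (simp add: D_def)
  have unc: "expectation (\<lambda>w. D j w * D l w) = 0" if jl: "j < n" "l < n" "j \<noteq> l" for j l
  proof -
    have e0: "expectation (\<lambda>w. eps w $ j * eps w $ l) = 0"
      using expectation_mult_indep[OF eps_indep, of j l] jl eps_moments by simp
    have ei: "integrable M (\<lambda>w. eps w $ j * eps w $ l)"
      using indep_vars_integrable[of "{j,l}" "\<lambda>i w. eps w $ i"] indep_vars_subset[OF eps_indep, of "{j,l}"] jl eps_moments by auto
    have "expectation (\<lambda>w. (X w $$ (j, c) * X w $$ (l, c)) * (eps w $ j * eps w $ l)) = 0"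
      using im(1)[of "\<lambda>A. A $$ (j, c) * A $$ (l, c)" "\<lambda>v. v $ j * v $ l"] XX[OF jl(1,2)] ei e0
        Xm[OF jl(1)] Xm[OF jl(2)] vec_borel_index[OF jl(1)] vec_borel_index[OF jl(2)] by simp
    moreover have "(\<lambda>w. D j w * D l w) = (\<lambda>w. (X w $$ (j, c) * X w $$ (l, c)) * (eps w $ j * eps w $ l))"
      by (simp add: D_def mult_ac)
    ultimately show ?thesis by simp
  qed
  have Dm: "D j \<in> borel_measurable M" if "j < n" for j
    unfolding D_def by (intro borel_measurable_times X_measurable eps_measurable that c)
  note sm = second_moment_uncorrelated[OF finite_lessThan, of n D 0]
  have eq: "(\<Sum>j<n. eps w $ j * X w $$ (j, c)) = (\<Sum>j<n. D j w)" for w by (simp add: D_def mult.commute)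
  show "expectation (\<lambda>w. (\<Sum>j<n. eps w $ j * X w $$ (j, c))\<^sup>2) = real n * s2 * cov c c"
    unfolding eq using sm(1) Dm sq mean unc by simp
  show "integrable M (\<lambda>w. (\<Sum>j<n. eps w $ j * X w $$ (j, c))\<^sup>2)"
    unfolding eq using sm(2) Dm sq mean unc by simp
qed

end

text \<open>In the application a_i are the errors, g_i the fitted errors, and a_i + \<delta>_i the centred
residuals. The increments of \<open>signed_square\<close> are at most \<bar>\<delta>_i\<bar> (2
\<bar>a_i\<bar> + \<bar>\<delta>_i\<bar>), and the parameter c splits the product.\<close>

lemma residual_discrepancy:
  fixes a g :: "nat \<Rightarrow> real"
  assumes n: "0 < n" and c: "0 < c"
  defines "\<delta> \<equiv> \<lambda>i. (\<Sum>l<n. g l) / real n - g i - (\<Sum>l<n. a l) / real n"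
  shows "(\<Sum>i<n. \<bar>signed_square (a i) - signed_square (a i + \<delta> i)\<bar>)
    \<le> c * (\<Sum>i<n. (a i)\<^sup>2) + (1 + 1 / c) * (2 * (\<Sum>i<n. (g i)\<^sup>2) + 2 * (\<Sum>i<n. a i)\<^sup>2 / real n)"
proof -
  define gm where "gm = (\<Sum>l<n. g l) / real n"
  define am where "am = (\<Sum>l<n. a l) / real n"
  have 1: "\<bar>signed_square (a i) - signed_square (a i + \<delta> i)\<bar> \<le> c * (a i)\<^sup>2 + (1 + 1 / c) * (\<delta> i)\<^sup>2" for i
  proof -
    have "\<bar>signed_square (a i) - signed_square (a i + \<delta> i)\<bar> \<le> \<bar>\<delta> i\<bar> * (2 * \<bar>a i\<bar> + \<bar>\<delta> i\<bar>)"
      using signed_square_diff_le[of "a i" "a i + \<delta> i"] by simp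
    moreover have "2 * (\<bar>a i\<bar> * \<bar>\<delta> i\<bar>) \<le> c * (a i)\<^sup>2 + (\<delta> i)\<^sup>2 / c"
    proof -
      have "0 \<le> (c * \<bar>a i\<bar> - \<bar>\<delta> i\<bar>)\<^sup>2 / c" using c by simp
      also have "\<dots> = c * (a i)\<^sup>2 + (\<delta> i)\<^sup>2 / c - 2 * (\<bar>a i\<bar> * \<bar>\<delta> i\<bar>)"
        using c by (simp add: power2_diff power_mult_distrib field_simps power2_eq_square)
      finally show ?thesis by simp
    qed
    moreover have "\<bar>\<delta> i\<bar> * (2 * \<bar>a i\<bar> + \<bar>\<delta> i\<bar>) = 2 * (\<bar>a i\<bar> * \<bar>\<delta> i\<bar>) + (\<delta> i)\<^sup>2"
      by (simp add: distrib_left power2_eq_square)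
    moreover have "(1 + 1 / c) * (\<delta> i)\<^sup>2 = (\<delta> i)\<^sup>2 + (\<delta> i)\<^sup>2 / c" by (simp add: distrib_right)
    ultimately show ?thesis by linarith
  qed
  have 2: "(\<Sum>i<n. (\<delta> i)\<^sup>2) \<le> 2 * (\<Sum>i<n. (g i)\<^sup>2) + 2 * (\<Sum>i<n. a i)\<^sup>2 / real n"
  proof -
    have pt: "(\<delta> i)\<^sup>2 \<le> 2 * (gm - g i)\<^sup>2 + 2 * am\<^sup>2" for i
    proof -
      have "0 \<le> ((gm - g i) + am)\<^sup>2" by simp
      then show ?thesis by (simp add: \<delta>_def gm_def[symmetric] am_def[symmetric] power2_eq_square algebra_simps)
    qed
    have G: "(\<Sum>i<n. g i) = real n * gm" and A: "(\<Sum>i<n. a i) = real n * am" using n by (simp_all add: gm_def am_def)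
    have "(\<Sum>i<n. (gm - g i)\<^sup>2) = (\<Sum>i<n. gm\<^sup>2 - 2 * gm * g i + (g i)\<^sup>2)"
      by (intro sum.cong refl) (simp add: power2_diff)
    also have "\<dots> = real n * gm\<^sup>2 - 2 * gm * (\<Sum>i<n. g i) + (\<Sum>i<n. (g i)\<^sup>2)"
      by (simp add: sum.distrib sum_subtractf sum_distrib_left)
    also have "\<dots> = (\<Sum>i<n. (g i)\<^sup>2) - real n * gm\<^sup>2" unfolding G by (simp add: power2_eq_square)
    also have "\<dots> \<le> (\<Sum>i<n. (g i)\<^sup>2)" by simp
    finally have gg: "(\<Sum>i<n. (gm - g i)\<^sup>2) \<le> (\<Sum>i<n. (g i)\<^sup>2)" .
    have "(\<Sum>i<n. (\<delta> i)\<^sup>2) \<le> (\<Sum>i<n. 2 * (gm - g i)\<^sup>2 + 2 * am\<^sup>2)" by (intro sum_mono pt)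
    also have "\<dots> = 2 * (\<Sum>i<n. (gm - g i)\<^sup>2) + 2 * (real n * am\<^sup>2)" by (simp add: sum.distrib sum_distrib_left)
    also have "real n * am\<^sup>2 = (\<Sum>i<n. a i)\<^sup>2 / real n" unfolding A using n by (simp add: power2_eq_square)
    finally show ?thesis using gg by simp
  qed
  have "(\<Sum>i<n. \<bar>signed_square (a i) - signed_square (a i + \<delta> i)\<bar>) \<le> (\<Sum>i<n. c * (a i)\<^sup>2 + (1 + 1 / c) * (\<delta> i)\<^sup>2)"
    by (intro sum_mono 1)
  also have "\<dots> = c * (\<Sum>i<n. (a i)\<^sup>2) + (1 + 1 / c) * (\<Sum>i<n. (\<delta> i)\<^sup>2)" by (simp add: sum.distrib sum_distrib_left)
  also have "\<dots> \<le> c * (\<Sum>i<n. (a i)\<^sup>2) + (1 + 1 / c) * (2 * (\<Sum>i<n. (g i)\<^sup>2) + 2 * (\<Sum>i<n. a i)\<^sup>2 / real n)"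
    using c 2 by (intro add_left_mono mult_left_mono) auto
  finally show ?thesis .
qed

lemma emp_integral:
  fixes f :: "real \<Rightarrow> real"
  assumes "f \<in> borel_measurable borel"
  shows "integrable (emp n a) f" "(\<integral>x. f x \<partial>emp n a) = (\<Sum>i<n. f (a i)) / real n"
proof -
  have "integrable (uniform_count_measure {..<n}) (\<lambda>i. f (a i))"
    unfolding uniform_count_measure_def by (rule integrable_point_measure_finite) simp
  then show "integrable (emp n a) f" using assms by (subst integrable_distr_eq) auto
  show "(\<integral>x. f x \<partial>emp n a) = (\<Sum>i<n. f (a i)) / real n"
    using assms by (subst integral_distr) (auto simp: integral_uniform_count_measure)
qed

context ridge_model
begin

abbreviation response :: "'w \<Rightarrow> real Matrix.vec" where "response w \<equiv> X w *\<^sub>v \<beta> + eps w"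

definition centred_resid :: "real \<Rightarrow> 'w \<Rightarrow> nat \<Rightarrow> real" where
  "centred_resid r w i = ridge_resid r (X w) (response w) $ i - (\<Sum>l<n. ridge_resid r (X w) (response w) $ l) / real n"

lemma resid_law_eq:
  assumes "w \<in> space M" shows "resid_law r (X w) (response w) = emp n (centred_resid r w)"
proof -
  have "dim_vec (response w) = n" using eps_carrier[OF assms] by simp
  then show ?thesis by (simp add: resid_law_def Let_def centred_resid_def[abs_def])
qed

lemma centred_resid_sum: "(\<Sum>i<n. centred_resid r w i) = 0"
  using n by (simp add: centred_resid_def sum_subtractf)

text \<open>The measurable majorant H makes it unnecessary to discuss how the distance itself depends on the sample
point. The parameters T and c are free, to be balanced against n.\<close>

lemma resid_law_distance:
  assumes r: "0 < r" and c: "0 < c" and T: "0 < T"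
  shows "\<exists>H\<in>borel_measurable M. (\<forall>w\<in>space M. d2_sq F0 (resid_law r (X w) (response w)) \<le> H w)
    \<and> (\<integral>\<^sup>+w. H w \<partial>M) \<le> ennreal (2 * (2 * T / sqrt (real n) + 2 * (\<integral>x. x ^ 4 \<partial>F0) / T) + 2 * c * s2
        + (1 + 1 / c) * (4 * s2 * (\<Sum>c<p. cov c c) / r + 4 * r * dot p (vec_index \<beta>) (vec_index \<beta>) / real n + 4 * s2 / real n))"
proof -
  interpret F0: real_distribution F0 by (rule F0(1))
  interpret F': real_distribution "distr F0 borel signed_square" by simp
  interpret pair_sigma_finite M lborel ..
  define bb where "bb = dot p (vec_index \<beta>) (vec_index \<beta>)"
  define m4 where "m4 = (\<integral>x. x ^ 4 \<partial>F0)"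
  define tr where "tr = (\<Sum>c<p. cov c c)"
  define a where "a = (\<lambda>w i. eps w $ i)"
  define C where "C = cdf (distr F0 borel signed_square)"
  have [measurable]: "C \<in> borel_measurable borel"
    unfolding C_def by (intro borel_measurable_mono monoI F'.cdf_nondecreasing)
  define J where "J = (\<lambda>w. \<integral>\<^sup>+t. ennreal \<bar>C t - emp_cdf n (a w) t\<bar> \<partial>lborel)"
  define B where "B = (\<lambda>w. 2 / real n * (c * (\<Sum>i<n. (eps w $ i)\<^sup>2)
    + (1 + 1 / c) * (2 * ((\<Sum>c<p. (\<Sum>j<n. eps w $ j * X w $$ (j, c))\<^sup>2) / r + r * bb) + 2 * (\<Sum>i<n. eps w $ i)\<^sup>2 / real n)))"
  have joint[measurable]: "(\<lambda>z. emp_cdf n (a (fst z)) (snd z)) \<in> borel_measurable (M \<Otimes>\<^sub>M lborel)"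
    unfolding a_def by (rule emp_cdf_measurable) (auto intro: measurable_compose[OF measurable_fst eps_measurable])
  have J: "J \<in> borel_measurable M"
    unfolding J_def using joint by (intro lborel.borel_measurable_nn_integral) (simp add: split_beta')
  have B: "integrable M B"
    unfolding B_def
    by (intro integrable_mult_right Bochner_Integration.integrable_add Bochner_Integration.integrable_sum
        Bochner_Integration.integrable_divide eps_moments(1) score_moment(2) eps_sum_moment(2)) auto
  have B0: "0 \<le> B w" for w
    unfolding B_def using c r dot_self_nonneg[of p "vec_index \<beta>"]
    by (intro mult_nonneg_nonneg add_nonneg_nonneg divide_nonneg_nonneg sum_nonneg) (auto simp: bb_def)
  have EB: "expectation B = 2 * c * s2 + (1 + 1 / c) * (4 * s2 * tr / r + 4 * r * bb / real n + 4 * s2 / real n)"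
  proof -
    define A1 where "A1 = (\<lambda>w. \<Sum>i<n. (eps w $ i)\<^sup>2)"
    define A2 where "A2 = (\<lambda>w. \<Sum>c<p. (\<Sum>j<n. eps w $ j * X w $$ (j, c))\<^sup>2)"
    define A3 where "A3 = (\<lambda>w. (\<Sum>i<n. eps w $ i)\<^sup>2)"
    have A: "integrable M A1" "integrable M A2" "integrable M A3"
      "expectation A1 = (\<Sum>i<n. s2)" "expectation A2 = (\<Sum>c<p. real n * s2 * cov c c)" "expectation A3 = real n * s2"
      unfolding A1_def A2_def A3_def using eps_moments score_moment eps_sum_moment
      by (auto simp: Bochner_Integration.integral_sum intro!: Bochner_Integration.integrable_sum)
    have gen: "expectation (\<lambda>w. k * (c * A1 w + d * (2 * (A2 w / r + q) + 2 * A3 w / m)))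
        = k * (c * expectation A1 + d * (2 * (expectation A2 / r + q) + 2 * expectation A3 / m))" for k d q m :: real
      using A(1-3) by (simp add: prob_space)
    have "expectation B = 2 / real n * (c * (\<Sum>i<n. s2)
      + (1 + 1 / c) * (2 * ((\<Sum>c<p. real n * s2 * cov c c) / r + r * bb) + 2 * (real n * s2) / real n))"
      using gen[of "2 / real n" "1 + 1 / c" "r * bb" "real n"] unfolding A(4-6) unfolding B_def A1_def A2_def A3_def .
    also have "\<dots> = 2 * c * s2 + (1 + 1 / c) * (4 * s2 * tr / r + 4 * r * bb / real n + 4 * s2 / real n)"
    proof -
      have "(\<Sum>c<p. real n * s2 * cov c c) = real n * s2 * tr" by (simp add: tr_def sum_distrib_left)
      then have "2 / real n * (c * (\<Sum>i<n. s2)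
      + (1 + 1 / c) * (2 * ((\<Sum>c<p. real n * s2 * cov c c) / r + r * bb) + 2 * (real n * s2) / real n))
       = 2 / real n * (c * (real n * s2)) + (1 + 1 / c) * (2 / real n * (2 * (real n * s2 * tr / r + r * bb) + 2 * (real n * s2) / real n))"
        by (simp only: sum_constant card_lessThan distrib_left mult.left_commute)
      also have "2 / real n * (c * (real n * s2)) = 2 * c * s2" using n by simp
      also have "2 / real n * (2 * (real n * s2 * tr / r + r * bb) + 2 * (real n * s2) / real n) = 4 * s2 * tr / r + 4 * r * bb / real n + 4 * s2 / real n"
        using n r by (simp add: field_simps)
      finally show ?thesis .
    qed
    finally show ?thesis .
  qed
  have dom: "d2_sq F0 (resid_law r (X w) (response w)) \<le> 2 * J w + ennreal (B w)" if w: "w \<in> space M" for w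
  proof -
    note Xc = X_carrier[OF w] and ec = eps_carrier[OF w]
    define h where "h = ridge_est r (X w) (response w) - \<beta>"
    define g where "g = (\<lambda>i. dot p (entries (X w) i) (vec_index h))"
    note fit = ridge_fit_error[OF Xc r beta ec, folded h_def]
    have res: "ridge_resid r (X w) (response w) $ i = a w i - g i" if "i < n" for i
      using fit(2)[OF that] by (simp add: a_def g_def)
    have cr: "centred_resid r w i = a w i + ((\<Sum>l<n. g l) / real n - g i - (\<Sum>l<n. a w l) / real n)" if "i < n" for i
      using that by (simp add: centred_resid_def res sum_subtractf diff_divide_distrib)
    have "(\<Sum>i<n. \<bar>signed_square (a w i) - signed_square (centred_resid r w i)\<bar>)
      = (\<Sum>i<n. \<bar>signed_square (a w i) - signed_square (a w i + ((\<Sum>l<n. g l) / real n - g i - (\<Sum>l<n. a w l) / real n))\<bar>)"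
      by (intro sum.cong refl) (simp add: cr)
    also have "\<dots> \<le> c * (\<Sum>i<n. (a w i)\<^sup>2) + (1 + 1 / c) * (2 * (\<Sum>i<n. (g i)\<^sup>2) + 2 * (\<Sum>i<n. a w i)\<^sup>2 / real n)"
      by (rule residual_discrepancy[OF n c])
    also have "\<dots> \<le> c * (\<Sum>i<n. (eps w $ i)\<^sup>2)
      + (1 + 1 / c) * (2 * ((\<Sum>c<p. (\<Sum>j<n. eps w $ j * X w $$ (j, c))\<^sup>2) / r + r * bb) + 2 * (\<Sum>i<n. eps w $ i)\<^sup>2 / real n)"
      using fit(1) c unfolding a_def g_def bb_def by (intro add_left_mono mult_left_mono add_right_mono) auto
    finally have "2 / real n * (\<Sum>i<n. \<bar>signed_square (a w i) - signed_square (centred_resid r w i)\<bar>) \<le> B w"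
      unfolding B_def by (intro mult_left_mono) auto
    then have "ennreal (2 / real n * (\<Sum>i<n. \<bar>signed_square (a w i) - signed_square (centred_resid r w i)\<bar>)) \<le> ennreal (B w)"
      by (rule ennreal_leI)
    then show ?thesis
      unfolding resid_law_eq[OF w] J_def C_def
      by (rule order_trans[OF d2_sq_empirical[OF F0(1) n, of "centred_resid r w" "a w"] add_left_mono])
  qed
  have EJ: "(\<integral>\<^sup>+w. J w \<partial>M) \<le> ennreal (2 * T / sqrt (real n) + 2 * m4 / T)"
    unfolding J_def C_def m4_def a_def
    by (rule expected_cdf_distance[OF prob_space_axioms F0(1,3) eps_indep eps_law n T])
  have m4: "0 \<le> m4" unfolding m4_def by (rule integral_nonneg_AE) auto
  have "(\<integral>\<^sup>+w. 2 * J w + ennreal (B w) \<partial>M) = 2 * (\<integral>\<^sup>+w. J w \<partial>M) + ennreal (expectation B)"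
    using J B B0 by (subst nn_integral_add) (auto simp: nn_integral_cmult nn_integral_eq_integral)
  also have "\<dots> \<le> 2 * ennreal (2 * T / sqrt (real n) + 2 * m4 / T) + ennreal (expectation B)"
    by (intro add_right_mono mult_left_mono EJ) auto
  also have "\<dots> = ennreal (2 * (2 * T / sqrt (real n) + 2 * m4 / T) + expectation B)"
  proof -
    have "0 \<le> 2 * (2 * T / sqrt (real n) + 2 * m4 / T)" using T m4 by simp
    moreover have "0 \<le> expectation B" by (intro integral_nonneg_AE AE_I2 B0)
    moreover have "2 * ennreal z = ennreal (2 * z)" for z by (metis ennreal_mult' ennreal_numeral zero_le_numeral)
    ultimately show ?thesis by (simp only: ennreal_plus)
  qed
  finally have E: "(\<integral>\<^sup>+w. 2 * J w + ennreal (B w) \<partial>M) \<le> \<dots>" .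
  show ?thesis
  proof (intro bexI[of _ "\<lambda>w. 2 * J w + ennreal (B w)"] conjI ballI dom)
    show "(\<lambda>w. 2 * J w + ennreal (B w)) \<in> borel_measurable M" using J B by measurable
    show "(\<integral>\<^sup>+w. 2 * J w + ennreal (B w) \<partial>M) \<le> ennreal (2 * (2 * T / sqrt (real n) + 2 * (\<integral>x. x ^ 4 \<partial>F0) / T) + 2 * c * s2
        + (1 + 1 / c) * (4 * s2 * (\<Sum>c<p. cov c c) / r + 4 * r * dot p (vec_index \<beta>) (vec_index \<beta>) / real n + 4 * s2 / real n))"
      using E unfolding EB m4_def tr_def bb_def by (simp add: add.assoc)
  qed
qed

end

context ridge_model
begin

abbreviation Res :: "real \<Rightarrow> real mat \<Rightarrow> (nat \<Rightarrow> real) \<Rightarrow> nat \<Rightarrow> real" where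
  "Res r A b \<equiv> resolvent p r (entries A) [0..<n] b"

definition weight :: "real \<Rightarrow> real mat \<Rightarrow> nat \<Rightarrow> nat \<Rightarrow> real" where
  "weight r A i j = dot p (entries A j) (Res r A (entries A i))"

definition bias :: "real \<Rightarrow> real mat \<Rightarrow> nat \<Rightarrow> real" where
  "bias r A i = - (r * dot p (entries A i) (Res r A (vec_index \<beta>)))"

text \<open>The positivity of the sums keeps the scaling by 1 / sqrt v_i away from a division by zero.\<close>

definition good :: "real \<Rightarrow> real \<Rightarrow> 'w set" where
  "good r K = {w \<in> space M. \<forall>i<n. 0 < (\<Sum>j<n. (weight r (X w) i j)\<^sup>2)
      \<and> (bias r (X w) i)\<^sup>2 \<le> K * (\<Sum>j<n. (weight r (X w) i j)\<^sup>2)}"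

lemma entries_measurable: "j < n \<Longrightarrow> c < p \<Longrightarrow> (\<lambda>A. entries A j c) \<in> borel_measurable (mat_borel n p)"
  by (rule mat_borel_index)

lemma weight_measurable: "i < n \<Longrightarrow> j < n \<Longrightarrow> (\<lambda>A. weight r A i j) \<in> borel_measurable (mat_borel n p)"
  unfolding weight_def by (intro measurable_dot measurable_resolvent entries_measurable) auto

lemma bias_measurable: "i < n \<Longrightarrow> (\<lambda>A. bias r A i) \<in> borel_measurable (mat_borel n p)"
  unfolding bias_def
  by (intro borel_measurable_uminus borel_measurable_times borel_measurable_const measurable_dot measurable_resolvent entries_measurable) auto

lemma good_sets: "good r K \<in> sets (sigma_gen M (mat_borel n p) X)"
proof -
  let ?B = "{A \<in> space (mat_borel n p). \<forall>i\<in>{..<n}. 0 < (\<Sum>j<n. (weight r A i j)\<^sup>2)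
      \<and> (bias r A i)\<^sup>2 \<le> K * (\<Sum>j<n. (weight r A i j)\<^sup>2)}"
  have "?B \<in> sets (mat_borel n p)"
  proof (rule sets.sets_Collect_finite_All)
    fix i assume "i \<in> {..<n}"
    then have i: "i < n" by simp
    have [measurable]: "(\<lambda>A. \<Sum>j<n. (weight r A i j)\<^sup>2) \<in> borel_measurable (mat_borel n p)"
      by (intro borel_measurable_sum borel_measurable_power weight_measurable i) auto
    note [measurable] = bias_measurable[OF i]
    show "{A \<in> space (mat_borel n p). 0 < (\<Sum>j<n. (weight r A i j)\<^sup>2)
      \<and> (bias r A i)\<^sup>2 \<le> K * (\<Sum>j<n. (weight r A i j)\<^sup>2)} \<in> sets (mat_borel n p)" by measurable
  qed simp
  then have "X -` ?B \<inter> space M \<in> sets (sigma_gen M (mat_borel n p) X)"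
    unfolding sigma_gen_def by (rule in_vimage_algebra)
  also have "X -` ?B \<inter> space M = good r K"
    using measurable_space[OF X_rv] by (auto simp: good_def)
  finally show ?thesis .
qed

lemma res_row:
  assumes A: "A \<in> carrier_mat n p" and i: "i < n" and c: "c < p"
  shows "ridge_resolvent r A (vec_index (row A i)) c = Res r A (entries A i) c"
proof -
  have "Res r A (vec_index (row A i)) c = Res r A (entries A i) c"
    by (rule resolvent_cong) (use assms in auto)
  then show ?thesis using A by simp
qed

lemma weight_row: "A \<in> carrier_mat n p \<Longrightarrow> i < n \<Longrightarrow> dot p (entries A j) (ridge_resolvent r A (vec_index (row A i))) = weight r A i j"
  unfolding weight_def by (rule dot_cong[OF refl]) (rule res_row)

lemma eps_PiM_law:
  "distr (distr M (vec_borel n) eps) borel (\<lambda>e. b + (\<Sum>j<n. W j * e $ j))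
    = distr (PiM {..<n} (\<lambda>_. F0)) borel (\<lambda>e. b + (\<Sum>j<n. W j * e j))"
proof -
  have lin: "(\<lambda>e. b + (\<Sum>j<n. W j * e j)) \<in> borel_measurable (PiM {..<n} (\<lambda>_. borel))" by measurable
  have lin': "(\<lambda>e. b + (\<Sum>j<n. W j * e $ j)) \<in> borel_measurable (vec_borel n)"
    by (intro borel_measurable_add borel_measurable_sum borel_measurable_times vec_borel_index) auto
  have em: "(\<lambda>w. \<lambda>j\<in>{..<n}. eps w $ j) \<in> measurable M (PiM {..<n} (\<lambda>_. borel))"
    by (intro measurable_restrict eps_measurable) auto
  have ne: "{..<n} \<noteq> {}" using n by auto
  have "PiM {..<n} (\<lambda>_. F0) = PiM {..<n} (\<lambda>j. distr M borel (\<lambda>w. eps w $ j))"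
    by (intro PiM_cong refl) (simp add: eps_law)
  also have "\<dots> = distr M (PiM {..<n} (\<lambda>_. borel)) (\<lambda>w. \<lambda>j\<in>{..<n}. eps w $ j)"
    using eps_indep indep_vars_iff_distr_eq_PiM'[OF ne, of "\<lambda>i w. eps w $ i" "\<lambda>_. borel"] eps_measurable by simp
  finally have "distr (PiM {..<n} (\<lambda>_. F0)) borel (\<lambda>e. b + (\<Sum>j<n. W j * e j))
     = distr M borel (\<lambda>w. b + (\<Sum>j<n. W j * eps w $ j))"
    using em lin by (simp add: distr_distr comp_def)
  moreover have "distr (distr M (vec_borel n) eps) borel (\<lambda>e. b + (\<Sum>j<n. W j * e $ j)) = distr M borel (\<lambda>w. b + (\<Sum>j<n. W j * eps w $ j))"
    using eps_rv lin' by (simp add: distr_distr comp_def)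
  ultimately show ?thesis by simp
qed

lemma cond_law_ridge_error:
  assumes i: "i < n" and r: "0 < r"
    and Psi: "cond_law M (sigma_gen M (mat_borel n p) X) (\<lambda>w. row (X w) i \<bullet> (ridge_est r (X w) (response w) - \<beta>)) \<Psi>"
  shows "AE w in M. \<Psi> w = distr (PiM {..<n} (\<lambda>_. F0)) borel (\<lambda>e. bias r (X w) i + (\<Sum>j<n. weight r (X w) i j * e j))"
proof -
  define h where "h = (\<lambda>A (e :: real Matrix.vec). bias r A i + (\<Sum>j<n. weight r A i j * e $ j))"
  have "AE w in M. \<Psi> w = distr (distr M (vec_borel n) eps) borel (h (X w))"
  proof (rule cond_law_eq[OF X_rv eps_rv X_eps_indep _ _ Psi])
    show "(\<lambda>z. h (fst z) (snd z)) \<in> borel_measurable (mat_borel n p \<Otimes>\<^sub>M vec_borel n)"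
      unfolding h_def
      by (intro borel_measurable_add borel_measurable_sum borel_measurable_times
          measurable_compose[OF measurable_fst bias_measurable] measurable_compose[OF measurable_fst weight_measurable]
          measurable_compose[OF measurable_snd vec_borel_index] i) auto
    fix w assume w: "w \<in> space M"
    note Xc = X_carrier[OF w] and ec = eps_carrier[OF w]
    have rc: "row (X w) i \<in> carrier_vec p" using Xc by auto
    have bd: "dot p (vec_index (row (X w) i)) (ridge_resolvent r (X w) (vec_index \<beta>)) = dot p (entries (X w) i) (Res r (X w) (vec_index \<beta>))"
      using Xc i by (intro dot_cong) auto
    show "row (X w) i \<bullet> (ridge_est r (X w) (response w) - \<beta>) = h (X w) (eps w)"
      unfolding ridge_error[OF Xc r beta ec rc] h_def bias_def using weight_row[OF Xc i] bd by simp
  qed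
  then show ?thesis unfolding h_def eps_PiM_law .
qed

lemma Phi_eq:
  assumes w: "w \<in> space M" and i: "i < n" and r: "0 < r" and F: "real_distribution F"
  shows "Phi r (X w) F (row (X w) i) = distr (PiM {..<n} (\<lambda>_. F)) borel (\<lambda>e. \<Sum>j<n. weight r (X w) i j * e j)"
proof -
  note Xc = X_carrier[OF w]
  have rc: "row (X w) i \<in> carrier_vec p" using Xc by auto
  have "row (X w) i \<bullet> (ridge_mat r (X w) *\<^sub>v Matrix.vec n e) = (\<Sum>j<n. weight r (X w) i j * e j)" for e
    using ridge_linear_form[OF Xc r rc, of "Matrix.vec n e"] weight_row[OF Xc i] by simp
  then show ?thesis using Xc by (simp add: Phi_def)
qed

text \<open>After scaling, the squared weights add up to 1 / \<sigma>^2 and the squared bias is at most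
K / \<sigma>^2.\<close>

lemma scaled_distance_le:
  assumes w: "w \<in> good r K" and i: "i < n" and r: "0 < r" and pil: "0 < pil" and K: "0 \<le> K"
    and Psi: "\<Psi> w = distr (PiM {..<n} (\<lambda>_. F0)) borel (\<lambda>e. bias r (X w) i + (\<Sum>j<n. weight r (X w) i j * e j))"
  defines "s \<equiv> 1 / sqrt (ridge_var s2 r (X w) (row (X w) i))"
  shows "d2_sq (scale_law s (\<Psi> w)) (scale_law s (Phi r (X w) (resid_law pil (X w) (response w)) (row (X w) i)))
     \<le> ennreal (1 / s2) * d2_sq F0 (resid_law pil (X w) (response w)) + ennreal (K / s2)"
proof -
  have wM: "w \<in> space M" using w by (simp add: good_def)
  note Xc = X_carrier[OF wM]
  have rc: "row (X w) i \<in> carrier_vec p" using Xc by auto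
  define V where "V = (\<Sum>j<n. (weight r (X w) i j)\<^sup>2)"
  have V: "0 < V" "(bias r (X w) i)\<^sup>2 \<le> K * V" using w i by (auto simp: good_def V_def)
  have var: "ridge_var s2 r (X w) (row (X w) i) = s2 * V"
    using ridge_var_eq[OF Xc r rc, of s2] weight_row[OF Xc i] by (simp add: V_def)
  have ss: "s\<^sup>2 = 1 / (s2 * V)" unfolding s_def var using V F0(6) by (simp add: power_divide)
  let ?F = "emp n (centred_resid pil w)"
  have F: "real_distribution ?F" by (rule real_distribution_emp[OF n])
  have F2: "integrable ?F (\<lambda>x. x\<^sup>2)" by (rule emp_integral) simp
  have F1: "(\<integral>x. x \<partial>?F) = 0" using emp_integral(2)[of "\<lambda>x. x" n "centred_resid pil w"] centred_resid_sum[of pil w] by simp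
  have lin: "(\<lambda>e. b' + (\<Sum>j<n. W j * e j)) \<in> borel_measurable (PiM {..<n} (\<lambda>_. H))" if "real_distribution H" for b' and W :: "nat \<Rightarrow> real" and H
  proof -
    have "(\<lambda>e. e j) \<in> borel_measurable (PiM {..<n} (\<lambda>_. H))" if "j < n" for j
      using \<open>real_distribution H\<close> that measurable_component_singleton[of j "{..<n}" "\<lambda>_. H"]
      by (simp add: real_distribution_def real_distribution_axioms_def cong: measurable_cong_sets)
    then show ?thesis by (intro borel_measurable_add borel_measurable_sum borel_measurable_times) auto
  qed
  have sc: "scale_law s (distr (PiM {..<n} (\<lambda>_. H)) borel (\<lambda>e. b' + (\<Sum>j<n. weight r (X w) i j * e j)))
     = distr (PiM {..<n} (\<lambda>_. H)) borel (\<lambda>e. s * b' + (\<Sum>j<n. (s * weight r (X w) i j) * e j))"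
    if "real_distribution H" for b' H
    unfolding scale_law_def using lin[OF that]
    by (subst distr_distr) (auto simp: comp_def distrib_left sum_distrib_left mult.assoc)
  have 1: "scale_law s (\<Psi> w) = distr (PiM {..<n} (\<lambda>_. F0)) borel (\<lambda>e. s * bias r (X w) i + (\<Sum>j<n. (s * weight r (X w) i j) * e j))"
    unfolding Psi by (rule sc[OF F0(1)])
  have 2: "scale_law s (Phi r (X w) ?F (row (X w) i)) = distr (PiM {..<n} (\<lambda>_. ?F)) borel (\<lambda>e. \<Sum>j<n. (s * weight r (X w) i j) * e j)"
    unfolding Phi_eq[OF wM i r F] using sc[OF F, of 0] by simp
  have W: "(\<Sum>j<n. (s * weight r (X w) i j)\<^sup>2) = 1 / s2"
  proof -
    have "(\<Sum>j<n. (s * weight r (X w) i j)\<^sup>2) = s\<^sup>2 * V" by (simp add: V_def power_mult_distrib sum_distrib_left)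
    then show ?thesis using V ss by simp
  qed
  have b: "(s * bias r (X w) i)\<^sup>2 \<le> K / s2"
  proof -
    have "(s * bias r (X w) i)\<^sup>2 = s\<^sup>2 * (bias r (X w) i)\<^sup>2" by (simp add: power_mult_distrib)
    also have "\<dots> \<le> s\<^sup>2 * (K * V)" using V(2) by (intro mult_left_mono) auto
    also have "\<dots> = K / s2" using V ss by simp
    finally show ?thesis .
  qed
  have "d2_sq (scale_law s (\<Psi> w)) (scale_law s (Phi r (X w) ?F (row (X w) i))) \<le> ennreal (1 / s2) * d2_sq F0 ?F + ennreal ((s * bias r (X w) i)\<^sup>2)"
    unfolding 1 2 W[symmetric]
    by (rule d2_sq_linear_statistic[OF F0(1,2,4) F F2 F1]) (use W F0(6) in simp)
  also have "\<dots> \<le> ennreal (1 / s2) * d2_sq F0 ?F + ennreal (K / s2)"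
    using b by (intro add_left_mono ennreal_leI)
  finally show ?thesis unfolding resid_law_eq[OF wM] .
qed

text \<open>The given kernel \<Psi> is only determined almost surely; off a null set it is the explicit law of
\<open>cond_law_ridge_error\<close> for all rows at once.\<close>

theorem good_design_distance:
  assumes r: "0 < r" and pil: "0 < pil" and c: "0 < c" and T: "0 < T" and K: "0 \<le> K"
    and Psi: "\<And>i. i < n \<Longrightarrow> cond_law M (sigma_gen M (mat_borel n p) X) (\<lambda>w. row (X w) i \<bullet> (ridge_est r (X w) (Y w) - \<beta>)) (\<Psi> i)"
    and model: "\<And>w. w \<in> space M \<Longrightarrow> Y w = response w"
  shows "(\<integral>\<^sup>+w. (MAX i \<in> {..<n}.
             let c = row (X w) i; s = 1 / sqrt (ridge_var s2 r (X w) c)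
             in d2_sq (scale_law s (\<Psi> i w)) (scale_law s (Phi r (X w) (resid_law pil (X w) (Y w)) c))) * indicator (good r K) w \<partial>M)
    \<le> ennreal ((2 * (2 * T / sqrt (real n) + 2 * (\<integral>x. x ^ 4 \<partial>F0) / T) + 2 * c * s2
        + (1 + 1 / c) * (4 * s2 * (\<Sum>c<p. cov c c) / pil + 4 * pil * dot p (vec_index \<beta>) (vec_index \<beta>) / real n + 4 * s2 / real n)) / s2 + K / s2)"
    (is "(\<integral>\<^sup>+w. ?f w * _ \<partial>M) \<le> ennreal (?D / s2 + _)")
proof -
  let ?g = "\<lambda>w i. let c = row (X w) i; s = 1 / sqrt (ridge_var s2 r (X w) c)
    in d2_sq (scale_law s (\<Psi> i w)) (scale_law s (Phi r (X w) (resid_law pil (X w) (Y w)) c))"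
  obtain H where H: "H \<in> borel_measurable M" "\<And>w. w \<in> space M \<Longrightarrow> d2_sq F0 (resid_law pil (X w) (response w)) \<le> H w"
      "(\<integral>\<^sup>+w. H w \<partial>M) \<le> ennreal ?D"
    using resid_law_distance[OF pil c T] by blast
  have Psi': "AE w in M. \<Psi> i w = distr (PiM {..<n} (\<lambda>_. F0)) borel (\<lambda>e. bias r (X w) i + (\<Sum>j<n. weight r (X w) i j * e j))" if "i < n" for i
  proof -
    have K: "\<Psi> i \<in> measurable (sigma_gen M (mat_borel n p) X) (prob_algebra borel)"
      and L: "\<And>A. A \<in> sets borel \<Longrightarrow> AE w in M. emeasure (\<Psi> i w) A = nn_cond_exp M (sigma_gen M (mat_borel n p) X)
         (indicator ((\<lambda>w. row (X w) i \<bullet> (ridge_est r (X w) (Y w) - \<beta>)) -` A \<inter> space M)) w"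
      using Psi[OF that] by (auto simp: cond_law_def)
    have "(\<lambda>w. row (X w) i \<bullet> (ridge_est r (X w) (Y w) - \<beta>)) -` A \<inter> space M
       = (\<lambda>w. row (X w) i \<bullet> (ridge_est r (X w) (response w) - \<beta>)) -` A \<inter> space M" for A
      by (auto simp: model)
    then have "cond_law M (sigma_gen M (mat_borel n p) X) (\<lambda>w. row (X w) i \<bullet> (ridge_est r (X w) (response w) - \<beta>)) (\<Psi> i)"
      using K L by (simp add: cond_law_def)
    then show ?thesis by (rule cond_law_ridge_error[OF that r])
  qed
  then have "AE w in M. \<forall>i\<in>{..<n}. \<Psi> i w = distr (PiM {..<n} (\<lambda>_. F0)) borel (\<lambda>e. bias r (X w) i + (\<Sum>j<n. weight r (X w) i j * e j))"
    by (intro AE_finite_allI) auto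
  then have "AE w in M. ?f w * indicator (good r K) w \<le> ennreal (1 / s2) * H w + ennreal (K / s2)"
    using AE_space
  proof eventually_elim
    case (elim w)
    show ?case
    proof (cases "w \<in> good r K")
      case True
      have "?f w \<le> ennreal (1 / s2) * H w + ennreal (K / s2)"
      proof (rule Max.boundedI)
        fix a assume "a \<in> ?g w ` {..<n}"
        then obtain i where i: "i < n" "a = ?g w i" by auto
        have "d2_sq (scale_law (1 / sqrt (ridge_var s2 r (X w) (row (X w) i))) (\<Psi> i w))
           (scale_law (1 / sqrt (ridge_var s2 r (X w) (row (X w) i))) (Phi r (X w) (resid_law pil (X w) (response w)) (row (X w) i)))
           \<le> ennreal (1 / s2) * d2_sq F0 (resid_law pil (X w) (response w)) + ennreal (K / s2)"
          by (rule scaled_distance_le[OF True i(1) r pil K]) (use elim(1) i in auto)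
        also have "\<dots> \<le> ennreal (1 / s2) * H w + ennreal (K / s2)"
          using H(2)[OF elim(2)] by (intro add_right_mono mult_left_mono) auto
        finally show "a \<le> ennreal (1 / s2) * H w + ennreal (K / s2)"
          by (simp add: i Let_def model[OF elim(2)])
      qed (use n in auto)
      then show ?thesis using True by simp
    qed simp
  qed
  then have "(\<integral>\<^sup>+w. ?f w * indicator (good r K) w \<partial>M) \<le> (\<integral>\<^sup>+w. ennreal (1 / s2) * H w + ennreal (K / s2) \<partial>M)"
    by (rule nn_integral_mono_AE)
  also have "\<dots> = ennreal (1 / s2) * (\<integral>\<^sup>+w. H w \<partial>M) + ennreal (K / s2)"
    using H(1) by (subst nn_integral_add) (auto simp: nn_integral_cmult emeasure_space_1)
  also have "\<dots> \<le> ennreal (1 / s2) * ennreal ?D + ennreal (K / s2)"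
    by (intro add_right_mono mult_left_mono H(3)) auto
  also have "\<dots> = ennreal (?D / s2 + K / s2)"
  proof -
    have "0 \<le> (\<integral>x. x ^ 4 \<partial>F0)" by (rule integral_nonneg_AE) auto
    moreover note trace_nonneg
    ultimately have D: "0 \<le> ?D" using c T pil F0(6) dot_self_nonneg[of p "vec_index \<beta>"]
      by (intro add_nonneg_nonneg mult_nonneg_nonneg divide_nonneg_nonneg) auto
    have "ennreal (1 / s2) * ennreal ?D = ennreal (?D / s2)"
      using D F0(6) by (subst ennreal_mult[symmetric]) (auto simp: field_simps)
    then show ?thesis using D F0(6) K by (simp only: ennreal_plus divide_nonneg_pos)
  qed
  finally show ?thesis .
qed

end

context ridge_model
begin

text \<open>\<open>bias_le_fit_prob\<close> for the whitening vectors of \<Sigma>, whose squared lengths are at most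
1 / lo, where lo is a lower bound for the k largest eigenvalues.\<close>

lemma good_prob:
  assumes r: "0 < r" "12 * tr \<le> r" and L: "0 < L" and t: "0 < t" and k: "0 < k" "k \<le> p" and l: "0 < lo"
    and tr: "(\<Sum>c<p. cov c c) = tr"
    and low: "\<And>j. j < k \<Longrightarrow> lo \<le> ord_eigenvalue (Suc j) \<Sigma>"
    and small: "L\<^sup>2 * tr / r \<le> 1 / 2" "192 * L\<^sup>2 * r * t \<le> real n * lo"
    and bb: "dot p (vec_index \<beta>) (vec_index \<beta>) \<le> bb" "0 < bb"
  shows "1 - (real (n * p + n + n * k + n * n) * (fact (2 * m) / (2 ^ m * fact m) / L ^ (2 * m)) + real n * (9/10) ^ k + 2 / t)
    \<le> prob (good r (192 * L^4 * r * t * bb / real k))"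
proof -
  obtain v :: "nat \<Rightarrow> nat \<Rightarrow> real" where v: "\<And>g. quad p cov (\<lambda>c. \<Sum>j<k. g j * v j c) = (\<Sum>j<k. (g j)\<^sup>2)"
    "(\<Sum>j<k. dot p (v j) (v j)) \<le> real k / lo"
    using whitening_vectors[OF cov_mat k(2) low l] by blast
  have small2: "48 * L\<^sup>2 * r * t * (real k / lo) / real n \<le> real k / 4"
  proof -
    have "48 * L\<^sup>2 * r * t * (real k / lo) / real n = (192 * L\<^sup>2 * r * t) * (real k / (4 * lo * real n))" by simp
    also have "\<dots> \<le> (real n * lo) * (real k / (4 * lo * real n))" using small(2) l by (intro mult_right_mono) auto
    also have "\<dots> = real k / 4" using l n by simp
    finally show ?thesis .
  qed
  have kl: "0 < real k / lo" using k l by simp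
  let ?G = "{w \<in> space M. \<forall>i<n. 0 < (\<Sum>l<n. (dot p (xrow l w) (design.full r w (xrow i w)))\<^sup>2) \<and>
           (r * dot p (xrow i w) (design.full r w (vec_index \<beta>)))\<^sup>2
             \<le> 192 * L^4 * r * t * bb / real k * (\<Sum>l<n. (dot p (xrow l w) (design.full r w (xrow i w)))\<^sup>2)}"
  have "?G = good r (192 * L^4 * r * t * bb / real k)"
  proof -
    have 1: "dot p (xrow l w) (design.full r w (xrow i w)) = weight r (X w) i l" if "w \<in> space M" "i < n" "l < n" for w i l
      unfolding weight_def using that xrow_eq by (intro dot_cong resolvent_cong) auto
    have 2: "(r * dot p (xrow i w) (design.full r w (vec_index \<beta>)))\<^sup>2 = (bias r (X w) i)\<^sup>2" if "w \<in> space M" "i < n" for w i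
    proof -
      have "dot p (xrow i w) (design.full r w (vec_index \<beta>)) = dot p (entries (X w) i) (Res r (X w) (vec_index \<beta>))"
        using that xrow_eq by (intro dot_cong resolvent_cong) auto
      then show ?thesis by (simp add: bias_def)
    qed
    show ?thesis by (auto simp: good_def 1 2)
  qed
  then show ?thesis
    using design.bias_le_fit_prob[OF n r(1) _ L t k(1) _ small2 v(1) bb v(2) kl, of m] r(2) small(1) unfolding tr by simp
qed

end

section \<open>Rates\<close>

text \<open>Comparison with the integral of x^{- a}, one mean value step at a time.\<close>

lemma sum_powr_le:
  assumes "0 < a" "a < 1"
  shows "(\<Sum>i<p. real (Suc i) powr (- a)) \<le> real p powr (1 - a) / (1 - a)"
proof (induction p)
  case (Suc p)
  have step: "real (Suc p) powr (- a) \<le> (real (Suc p) powr (1 - a) - real p powr (1 - a)) / (1 - a)"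
  proof (cases "p = 0")
    case True
    then show ?thesis using assms by simp
  next
    case False
    have "\<exists>z>real p. z < real (Suc p) \<and> real (Suc p) powr (1 - a) - real p powr (1 - a) = (real (Suc p) - real p) * ((1 - a) * z powr (1 - a - 1))"
      by (intro MVT2 has_real_derivative_powr) (use False in auto)
    then obtain z where z: "real p < z" "z < real (Suc p)" "real (Suc p) powr (1 - a) - real p powr (1 - a) = (1 - a) * z powr (- a)"
      by auto
    have "real (Suc p) powr (- a) \<le> z powr (- a)" using z False assms by (intro powr_mono2') auto
    then show ?thesis using z(3) assms by simp
  qed
  then show ?case using Suc assms by (simp add: diff_divide_distrib)
qed simp

text \<open>The decay exponent \<eta> is replaced by some a < 1 not above it. This costs nothing that matters here,
and it saves the distinction between summable and non-summable eigenvalues.\<close>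

lemma trace_le:
  assumes S: "S \<in> carrier_mat p p" "transpose_mat S = S"
    and up: "\<And>i. i \<in> {1..p} \<Longrightarrow> ord_eigenvalue i S \<le> k2 * real i powr (- \<eta>)"
    and a: "0 < a" "a < 1" "a \<le> \<eta>" and k2: "0 < k2"
  shows "(\<Sum>c<p. S $$ (c, c)) \<le> k2 / (1 - a) * real p powr (1 - a)"
proof (rule spectral_theorem[OF S])
  fix u :: "nat \<Rightarrow> nat \<Rightarrow> real"
  assume "(\<Sum>c<p. S $$ (c, c)) = (\<Sum>j<p. ord_eigenvalue (Suc j) S)"
  also have "\<dots> \<le> (\<Sum>j<p. k2 * real (Suc j) powr (- a))"
  proof (rule sum_mono)
    fix j assume j: "j \<in> {..<p}"
    have "ord_eigenvalue (Suc j) S \<le> k2 * real (Suc j) powr (- \<eta>)" using j by (intro up) auto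
    also have "\<dots> \<le> k2 * real (Suc j) powr (- a)" using a k2 by (intro mult_left_mono powr_mono) auto
    finally show "ord_eigenvalue (Suc j) S \<le> k2 * real (Suc j) powr (- a)" .
  qed
  also have "\<dots> = k2 * (\<Sum>j<p. real (Suc j) powr (- a))" by (simp add: sum_distrib_left)
  also have "\<dots> \<le> k2 * (real p powr (1 - a) / (1 - a))" using sum_powr_le[OF a(1,2)] k2 by (intro mult_left_mono) auto
  finally show ?thesis by simp
qed

lemma powr_neg_tendsto: "c < 0 \<Longrightarrow> (\<lambda>n. real n powr c) \<longlonglongrightarrow> 0"
  by (rule tendsto_neg_powr[OF _ filterlim_real_sequentially])

lemma eventually_powr_le:
  assumes "c < 0" "0 < e" shows "eventually (\<lambda>n. C * real n powr c \<le> e) sequentially"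
proof -
  have "(\<lambda>n. C * real n powr c) \<longlonglongrightarrow> C * 0" by (intro tendsto_intros powr_neg_tendsto assms)
  then have "eventually (\<lambda>n. C * real n powr c < e) sequentially" using assms by (intro order_tendstoD) auto
  then show ?thesis by eventually_elim simp
qed

lemma geometric_powr_tendsto:
  "0 < \<kappa> \<Longrightarrow> (\<lambda>n. real n * (9/10) powr (real n powr \<kappa> - 1)) \<longlonglongrightarrow> 0"
  by real_asymp

text \<open>All quantities are now taken to be powers of n, and the hypotheses on \<gamma> and \<theta> enter
through strict inequalities between exponents only. The trace of \<Sigma> is of the order n^{1 - q} for
any q < min \<eta> 1, and q can be placed above both \<gamma> and \<theta>: then tr \<Sigma> is
negligible against \<rho> = n^{1 - \<gamma>} and against the pilot parameter n^{1 - \<theta>}. The gaps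
between the exponents leave room for a small \<epsilon>, and powers of n^\<epsilon> pay for the
exceptional designs.\<close>

theorem theorem4:
  fixes M :: "nat \<Rightarrow> 'w measure"
    and X :: "nat \<Rightarrow> 'w \<Rightarrow> real mat"
    and eps Y :: "nat \<Rightarrow> 'w \<Rightarrow> real Matrix.vec"
    and p :: "nat \<Rightarrow> nat"
    and \<Sigma> :: "nat \<Rightarrow> real mat"
    and \<beta> :: "nat \<Rightarrow> real Matrix.vec"
    and F0 :: "real measure"
    and sigma2 :: real
    and \<rho> pilot :: "nat \<Rightarrow> real"
    and \<theta> \<gamma> \<eta> k1 k2 k3 k4 :: real
    and \<Psi> :: "nat \<Rightarrow> nat \<Rightarrow> 'w \<Rightarrow> real measure"
  assumes F0: "prob_space F0" "sets F0 = sets borel"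
      "integrable F0 (\<lambda>x. x ^ 2)" "integrable F0 (\<lambda>x. x ^ 4)"
      "prob_space.expectation F0 (\<lambda>x. x) = 0"
      "prob_space.variance F0 (\<lambda>x. x) = sigma2" "0 < sigma2"
    and prob: "\<And>n. 1 \<le> n \<Longrightarrow> prob_space (M n)"
    and beta_dim: "\<And>n. 1 \<le> n \<Longrightarrow> \<beta> n \<in> carrier_vec (p n)"
    and X_rv: "\<And>n. 1 \<le> n \<Longrightarrow> X n \<in> measurable (M n) (mat_borel n (p n))"
    and X_rows_indep: "\<And>n. 1 \<le> n \<Longrightarrow>
        prob_space.indep_vars (M n) (\<lambda>_. vec_borel (p n)) (\<lambda>i w. row (X n w) i) {..<n}"
    and X_rows_gaussian: "\<And>n i. 1 \<le> n \<Longrightarrow> i < n \<Longrightarrow>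
        centered_gaussian (p n) (\<Sigma> n) (distr (M n) (vec_borel (p n)) (\<lambda>w. row (X n w) i))"
    and eps_rv: "\<And>n. 1 \<le> n \<Longrightarrow> eps n \<in> measurable (M n) (vec_borel n)"
    and eps_indep: "\<And>n. 1 \<le> n \<Longrightarrow>
        prob_space.indep_vars (M n) (\<lambda>_. borel) (\<lambda>i w. vec_index (eps n w) i) {..<n}"
    and eps_law: "\<And>n i. 1 \<le> n \<Longrightarrow> i < n \<Longrightarrow>
        distr (M n) borel (\<lambda>w. vec_index (eps n w) i) = F0"
    and X_eps_indep: "\<And>n. 1 \<le> n \<Longrightarrow>
        prob_space.indep_set (M n) (sets (sigma_gen (M n) (mat_borel n (p n)) (X n)))
          (sets (sigma_gen (M n) (vec_borel n) (eps n)))"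
    and model: "\<And>n w. 1 \<le> n \<Longrightarrow> w \<in> space (M n) \<Longrightarrow> Y n w = X n w *\<^sub>v \<beta> n + eps n w"
    and Psi: "\<And>n i. 1 \<le> n \<Longrightarrow> i < n \<Longrightarrow>
        cond_law (M n) (sigma_gen (M n) (mat_borel n (p n)) (X n))
          (\<lambda>w. scalar_prod (row (X n w) i) (ridge_est (\<rho> n) (X n w) (Y n w) - \<beta> n)) (\<Psi> n i)"
    and a: "0 < \<theta>" "0 < \<gamma>"
      "\<And>n. 1 \<le> n \<Longrightarrow> pilot n / real n = real n powr (- \<theta>)"
      "\<And>n. 1 \<le> n \<Longrightarrow> \<rho> n / real n = real n powr (- \<gamma>)"
    and b: "(\<lambda>n. l2_norm (\<beta> n)) \<lesssim> (\<lambda>_. 1)"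
    and c: "(\<lambda>n. op_norm (\<Sigma> n)) \<lesssim> (\<lambda>_. 1)"
    and d: "0 < \<eta>" "0 < k1" "0 < k2"
      "\<And>n i. 1 \<le> n \<Longrightarrow> i \<in> {1..p n} \<Longrightarrow>
         k1 * real i powr (- \<eta>) \<le> ord_eigenvalue i (\<Sigma> n) \<and>
         ord_eigenvalue i (\<Sigma> n) \<le> k2 * real i powr (- \<eta>)"
    and e: "k3 \<in> {0<..<1}" "k4 \<in> {0<..<1}"
      "\<And>n. 3 \<le> n \<Longrightarrow> k3 \<le> real (p n) / real n \<and> real (p n) / real n \<le> k4 \<and> p n \<le> n - 2"
    and gamma: "\<eta> / (1 + \<eta>) < \<gamma>" "\<gamma> < min \<eta> 1"
    and theta: "(\<eta> < 1 / 2 \<and> \<theta> = 2 * \<eta> / 3) \<or> (\<eta> > 1 / 2 \<and> \<theta> = \<eta> / (\<eta> + 1))"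
  shows "\<exists>\<delta> :: nat \<Rightarrow> real. (\<forall>n. 0 < \<delta> n) \<and> \<delta> \<longlonglongrightarrow> 0 \<and>
    (\<lambda>n. measure (M n) {w \<in> space (M n).
        nn_cond_exp (M n) (sigma_gen (M n) (mat_borel n (p n)) (X n))
          (\<lambda>w. MAX i \<in> {..<n}.
             let c = row (X n w) i; s = 1 / sqrt (ridge_var sigma2 (\<rho> n) (X n w) c)
             in d2_sq (scale_law s (\<Psi> n i w))
                  (scale_law s (Phi (\<rho> n) (X n w) (resid_law (pilot n) (X n w) (Y n w)) c))) w
        \<le> ennreal (\<delta> n)}) \<longlonglongrightarrow> 1"
proof -
  interpret F: prob_space F0 by fact
  have F0d: "real_distribution F0" using F0(1,2) F.prob_space_axioms
    by (auto simp: real_distribution_def real_distribution_axioms_def dest: sets_eq_imp_space_eq)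
  have F0s: "(\<integral>x. x\<^sup>2 \<partial>F0) = sigma2" using F0(5,6) by simp
  have M1: "ridge_model (M n) n (p n) (X n) (eps n) (\<beta> n) (\<Sigma> n) F0 sigma2" if n: "1 \<le> n" for n
  proof (rule ridge_model.intro[OF prob[OF n]], rule ridge_model_axioms.intro)
    show "0 < n" using n by simp
  qed (use n F0 F0d F0s beta_dim X_rv X_rows_indep X_rows_gaussian eps_rv eps_indep eps_law X_eps_indep in auto)
  have g1: "\<gamma> < \<eta>" "\<gamma> < 1" using gamma(2) by auto
  \<comment> \<open>This is where the lower bound on \<gamma> is used: it leaves room for the exponent \<kappa> of k.\<close>
  have g2: "1 - \<gamma> < \<gamma> / \<eta>" using gamma(1) d(1) by (simp add: field_simps)
  have "\<eta> / (\<eta> + 1) < \<eta>" "\<eta> / (\<eta> + 1) < 1" "2 * \<eta> / 3 < \<eta>" "\<eta> < 1 / 2 \<Longrightarrow> 2 * \<eta> / 3 < 1"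
    using d(1) by (auto simp: divide_less_eq)
  then have t1: "\<theta> < \<eta>" "\<theta> < 1" using theta by auto
  obtain q where q: "max \<gamma> \<theta> < q" "q < min \<eta> 1"
    using dense[of "max \<gamma> \<theta>" "min \<eta> 1"] g1 t1 by auto
  have q': "\<gamma> < q" "\<theta> < q" "q < \<eta>" "q < 1" "0 < q" using q a by auto
  obtain \<kappa> where \<kappa>: "1 - \<gamma> < \<kappa>" "\<kappa> < \<gamma> / \<eta>" using dense[OF g2] by auto
  have \<kappa>': "0 < \<kappa>" "\<kappa> < 1" "\<kappa> * \<eta> < \<gamma>"
  proof -
    have "\<gamma> / \<eta> < 1" using g1 d(1) by simp
    then show "0 < \<kappa>" "\<kappa> < 1" using \<kappa> g1 by linarith+
    show "\<kappa> * \<eta> < \<gamma>" using \<kappa>(2) d(1) by (simp add: less_divide_eq)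
  qed
  \<comment> \<open>L = t = n^\<epsilon>. The largest power of L that has to be absorbed is the fifth one.\<close>
  define \<epsilon> where "\<epsilon> = min (\<kappa> - (1 - \<gamma>)) (min (\<gamma> - \<kappa> * \<eta>) (q - \<gamma>)) / 6"
  have \<epsilon>0: "0 < min (\<kappa> - (1 - \<gamma>)) (min (\<gamma> - \<kappa> * \<eta>) (q - \<gamma>))" using \<kappa> \<kappa>' q' by simp
  have \<epsilon>6: "6 * \<epsilon> \<le> \<kappa> - (1 - \<gamma>)" "6 * \<epsilon> \<le> \<gamma> - \<kappa> * \<eta>" "6 * \<epsilon> \<le> q - \<gamma>"
    by (simp_all add: \<epsilon>_def)
  have "0 < \<epsilon>" using \<epsilon>0 by (simp add: \<epsilon>_def)
  then have \<epsilon>: "0 < \<epsilon>" "5 * \<epsilon> + 1 - \<gamma> - \<kappa> < 0" "3 * \<epsilon> - \<gamma> + \<kappa> * \<eta> < 0" "2 * \<epsilon> + \<gamma> - q < 0"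
    using \<epsilon>6 by linarith+
  \<comment> \<open>About n^2 Gaussian projections are controlled at level n^\<epsilon> by their moments of order 2m.\<close>
  obtain m :: nat where m: "2 < real m * \<epsilon>" using ex_less_of_nat_mult[OF \<epsilon>(1), of 2] by auto
  \<comment> \<open>The constant c that splits the residual discrepancy is n^{- \<omega>}: it vanishes, and its inverse is affordable.\<close>
  define \<omega> where "\<omega> = min (q - \<theta>) (min \<theta> 1) / 2"
  have \<omega>_le: "2 * \<omega> \<le> q - \<theta>" "2 * \<omega> \<le> \<theta>" "2 * \<omega> \<le> 1" by (simp_all add: \<omega>_def)
  have "0 < \<omega>" using q' a(1) by (simp add: \<omega>_def)
  then have \<omega>: "0 < \<omega>" "\<omega> + \<theta> - q < 0" "\<omega> - \<theta> < 0" "\<omega> - 1 < 0"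
    using \<omega>_le a(1) by linarith+
  obtain B n\<^sub>B where B: "0 < B" "\<And>n. n\<^sub>B \<le> n \<Longrightarrow> l2_norm (\<beta> n) \<le> B"
    using b by (auto simp: lesssim_def)
  define C1 where "C1 = k2 / (1 - q)"
  have C1: "0 < C1" using d(3) q' by (simp add: C1_def)
  define m4 where "m4 = (\<integral>x. x ^ 4 \<partial>F0)"
  have m4: "0 \<le> m4" unfolding m4_def by (rule integral_nonneg_AE) auto
  define Cm :: real where "Cm = fact (2 * m) / (2 ^ m * fact m)"
  have Cm: "0 \<le> Cm" by (simp add: Cm_def)
  define k where "k = (\<lambda>n. nat \<lfloor>real n powr \<kappa>\<rfloor>)"
  \<comment> \<open>U bounds the mean distance over the good designs (with truncation at T = n^{1/4}), E the probability of the others.\<close>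
  define U where "U = (\<lambda>n. (4 * real n powr (- 1 / 4) + 4 * m4 * real n powr (- 1 / 4) + 2 * sigma2 * real n powr (- \<omega>)
      + 2 * (4 * sigma2 * C1 * real n powr (\<omega> + \<theta> - q) + 4 * B\<^sup>2 * real n powr (\<omega> - \<theta>) + 4 * sigma2 * real n powr (\<omega> - 1))) / sigma2
      + 384 * B\<^sup>2 * real n powr (5 * \<epsilon> + 1 - \<gamma> - \<kappa>) / sigma2)"
  define E where "E = (\<lambda>n. 4 * Cm * real n powr (2 - 2 * (real m * \<epsilon>)) + real n * (9/10) powr (real n powr \<kappa> - 1) + 2 * real n powr (- \<epsilon>))"
  have U_lim: "U \<longlonglongrightarrow> 0"
  proof -
    have "U \<longlonglongrightarrow> (4 * 0 + 4 * m4 * 0 + 2 * sigma2 * 0 + 2 * (4 * sigma2 * C1 * 0 + 4 * B\<^sup>2 * 0 + 4 * sigma2 * 0)) / sigma2 + 384 * B\<^sup>2 * 0 / sigma2"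
      unfolding U_def by (intro tendsto_intros powr_neg_tendsto) (use \<omega> \<epsilon> F0(7) in auto)
    then show ?thesis by simp
  qed
  have E_lim: "E \<longlonglongrightarrow> 0"
  proof -
    have "E \<longlonglongrightarrow> 4 * Cm * 0 + 0 + 2 * 0"
      unfolding E_def by (intro tendsto_intros powr_neg_tendsto geometric_powr_tendsto) (use \<epsilon> m \<kappa>' in auto)
    then show ?thesis by simp
  qed
  have U0: "0 \<le> U n" for n
    unfolding U_def using F0(7) m4 C1 by (intro add_nonneg_nonneg divide_nonneg_pos mult_nonneg_nonneg) auto
  \<comment> \<open>The second summand only makes \<delta> positive.\<close>
  define \<delta> where "\<delta> = (\<lambda>n. sqrt (U n) + 1 / real (Suc n))"
  have \<delta>0: "0 < \<delta> n" for n using U0[of n] by (auto simp: \<delta>_def intro!: add_nonneg_pos)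
  have \<delta>_lim: "\<delta> \<longlonglongrightarrow> 0"
  proof -
    have "\<delta> \<longlonglongrightarrow> sqrt 0 + 0" unfolding \<delta>_def by (intro tendsto_intros U_lim LIMSEQ_Suc[OF lim_1_over_n])
    then show ?thesis by simp
  qed
  define f where "f = (\<lambda>n w. MAX i \<in> {..<n}.
             let c = row (X n w) i; s = 1 / sqrt (ridge_var sigma2 (\<rho> n) (X n w) c)
             in d2_sq (scale_law s (\<Psi> n i w))
                  (scale_law s (Phi (\<rho> n) (X n w) (resid_law (pilot n) (X n w) (Y n w)) c)))"
  define P where "P = (\<lambda>n. measure (M n) {w \<in> space (M n). nn_cond_exp (M n) (sigma_gen (M n) (mat_borel n (p n)) (X n)) (f n) w \<le> ennreal (\<delta> n)})"
  have ev1: "eventually (\<lambda>n. 12 * C1 * real n powr (\<gamma> - q) \<le> 1) sequentially"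
    and ev2: "eventually (\<lambda>n. C1 * real n powr (2 * \<epsilon> + \<gamma> - q) \<le> 1 / 2) sequentially"
    and ev3: "eventually (\<lambda>n. 192 / k1 * real n powr (3 * \<epsilon> - \<gamma> + \<kappa> * \<eta>) \<le> 1) sequentially"
    and ev4: "eventually (\<lambda>n. 1 * real n powr (\<kappa> - 1) \<le> k3) sequentially"
    and ev5: "eventually (\<lambda>n. 2 * real n powr (- \<kappa>) \<le> 1) sequentially"
    by (rule eventually_powr_le; use q' \<epsilon> \<kappa>' e(1) in auto)+
  have ev: "eventually (\<lambda>n. 1 - E n - sqrt (U n) \<le> P n) sequentially"
    using eventually_ge_at_top[of "max 3 n\<^sub>B"] ev1 ev2 ev3 ev4 ev5
  proof eventually_elim
    case (elim n)
    have n: "3 \<le> n" "n\<^sub>B \<le> n" "1 \<le> n" using elim(1) by auto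
    interpret R: ridge_model "M n" n "p n" "X n" "eps n" "\<beta> n" "\<Sigma> n" F0 sigma2 by (rule M1[OF n(3)])
    define N where "N = real n"
    have N: "0 < N" "1 \<le> N" using n by (auto simp: N_def)
    have pw: "N powr x * N powr y = N powr (x + y)" "N powr x / N powr y = N powr (x - y)" for x y
      by (simp_all add: powr_add powr_diff)
    have rho: "\<rho> n = N powr (1 - \<gamma>)" using a(4)[OF n(3)] N by (simp add: N_def powr_diff powr_minus field_simps)
    have pil: "pilot n = N powr (1 - \<theta>)" using a(3)[OF n(3)] N by (simp add: N_def powr_diff powr_minus field_simps)
    have N1: "0 < N powr x" for x using N by simp
    have c1: "12 * C1 * N powr (\<gamma> - q) \<le> 1" and c2: "C1 * N powr (2 * \<epsilon> + \<gamma> - q) \<le> 1 / 2"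
      and c3: "192 / k1 * N powr (3 * \<epsilon> - \<gamma> + \<kappa> * \<eta>) \<le> 1" and c4: "N powr (\<kappa> - 1) \<le> k3" and c5: "2 * N powr (- \<kappa>) \<le> 1"
      using elim(2-6) by (simp_all add: N_def)
    have pn: "k3 * N \<le> real (p n)" "p n \<le> n" using e(3)[OF n(1)] N by (auto simp: N_def field_simps)
    have Nk: "2 \<le> N powr \<kappa>" using c5 N1[of \<kappa>] by (simp add: powr_minus field_simps)
    have kn: "real (k n) \<le> N powr \<kappa>" "N powr \<kappa> - 1 \<le> real (k n)"
      using Nk by (auto simp: k_def N_def)
    have k0: "0 < k n" "N powr \<kappa> / 2 \<le> real (k n)" using kn Nk by auto
    have kp: "k n \<le> p n"
    proof -
      have "N powr \<kappa> = N powr (\<kappa> - 1) * N" using N by (simp add: powr_diff)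
      also have "\<dots> \<le> k3 * N" using c4 N by (intro mult_right_mono) auto
      finally have "real (k n) \<le> real (p n)" using kn(1) pn(1) by linarith
      then show ?thesis by simp
    qed
    define tr where "tr = (\<Sum>c<p n. \<Sigma> n $$ (c, c))"
    have tr: "tr \<le> C1 * N powr (1 - q)"
    proof -
      have "tr \<le> C1 * real (p n) powr (1 - q)"
        unfolding tr_def C1_def by (rule trace_le[OF R.cov_mat, where \<eta> = \<eta>]) (use d n q' in auto)
      also have "\<dots> \<le> C1 * N powr (1 - q)"
        using C1 pn(2) q' by (intro mult_left_mono powr_mono2) (auto simp: N_def)
      finally show ?thesis .
    qed
    define lo where "lo = k1 * N powr (- (\<kappa> * \<eta>))"
    have lo: "0 < lo" using d N by (simp add: lo_def)
    have low: "lo \<le> ord_eigenvalue (Suc j) (\<Sigma> n)" if "j < k n" for j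
    proof -
      have "real (Suc j) \<le> N powr \<kappa>" using that kn(1) by linarith
      then have "(N powr \<kappa>) powr (- \<eta>) \<le> real (Suc j) powr (- \<eta>)" using d(1) by (intro powr_mono2') auto
      then have "lo \<le> k1 * real (Suc j) powr (- \<eta>)" using d(2) by (simp add: lo_def powr_powr)
      also have "\<dots> \<le> ord_eigenvalue (Suc j) (\<Sigma> n)" using d(4)[OF n(3), of "Suc j"] that kp by auto
      finally show ?thesis .
    qed
    define L where "L = N powr \<epsilon>"
    have L: "0 < L" "1 \<le> L" using N \<epsilon>(1) by (auto simp: L_def ge_one_powr_ge_zero)
    have Lp: "L ^ j = N powr (real j * \<epsilon>)" for j using N by (simp add: L_def powr_power mult.commute)
    have s1: "12 * tr \<le> N powr (1 - \<gamma>)"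
    proof -
      have "12 * tr \<le> 12 * C1 * N powr (\<gamma> - q) * N powr (1 - \<gamma>)" using tr by (simp add: mult.assoc pw)
      also have "\<dots> \<le> 1 * N powr (1 - \<gamma>)" using c1 by (intro mult_right_mono) auto
      finally show ?thesis by simp
    qed
    have s2: "L\<^sup>2 * tr / N powr (1 - \<gamma>) \<le> 1 / 2"
    proof -
      have "L\<^sup>2 * tr / N powr (1 - \<gamma>) \<le> L\<^sup>2 * (C1 * N powr (1 - q)) / N powr (1 - \<gamma>)"
        using tr by (intro divide_right_mono mult_left_mono) auto
      also have "\<dots> = C1 * (N powr (2 * \<epsilon>) * N powr (1 - q) / N powr (1 - \<gamma>))" using Lp[of 2] by simp
      also have "\<dots> = C1 * N powr (2 * \<epsilon> + \<gamma> - q)" unfolding pw by (simp add: algebra_simps)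
      finally show ?thesis using c2 by linarith
    qed
    have s3: "192 * L\<^sup>2 * N powr (1 - \<gamma>) * L \<le> real n * lo"
    proof -
      have "192 * L\<^sup>2 * N powr (1 - \<gamma>) * L = 192 * (L ^ 3 * N powr (1 - \<gamma>))" by (simp add: power2_eq_square power3_eq_cube)
      also have "\<dots> = 192 * N powr (3 * \<epsilon> + (1 - \<gamma>))" unfolding Lp[of 3] pw by simp
      also have "\<dots> = (192 / k1 * N powr (3 * \<epsilon> - \<gamma> + \<kappa> * \<eta>)) * (k1 * N powr (1 - \<kappa> * \<eta>))"
        using d(2) pw(1)[of "3 * \<epsilon> - \<gamma> + \<kappa> * \<eta>" "1 - \<kappa> * \<eta>"] by (simp add: algebra_simps)
      also have "\<dots> \<le> 1 * (k1 * N powr (1 - \<kappa> * \<eta>))" using c3 d(2) by (intro mult_right_mono) auto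
      also have "\<dots> = real n * lo" using N pw(1)[of 1 "- (\<kappa> * \<eta>)"] by (simp add: lo_def N_def)
      finally show ?thesis .
    qed
    have bb: "dot (p n) (vec_index (\<beta> n)) (vec_index (\<beta> n)) \<le> B\<^sup>2" "0 < B\<^sup>2"
    proof -
      have "dot (p n) (vec_index (\<beta> n)) (vec_index (\<beta> n)) = (l2_norm (\<beta> n))\<^sup>2"
        using l2_norm_sq[OF beta_dim[OF n(3)]] by (simp add: dot_def power2_eq_square)
      also have "\<dots> \<le> B\<^sup>2" using B(2)[OF n(2)] by (intro power_mono) (auto simp: l2_norm_def intro!: real_sqrt_ge_zero sum_nonneg simp: scalar_prod_def)
      finally show "dot (p n) (vec_index (\<beta> n)) (vec_index (\<beta> n)) \<le> B\<^sup>2" .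
    qed (use B(1) in simp)
    define K where "K = 192 * L^4 * N powr (1 - \<gamma>) * L * B\<^sup>2 / real (k n)"
    have K0: "0 \<le> K" unfolding K_def using L by (intro divide_nonneg_nonneg mult_nonneg_nonneg) auto
    have K: "K \<le> 384 * B\<^sup>2 * N powr (5 * \<epsilon> + 1 - \<gamma> - \<kappa>)"
    proof -
      have "K = 192 * B\<^sup>2 * (L ^ 5 * N powr (1 - \<gamma>)) / real (k n)" by (simp add: K_def numeral_eq_Suc)
      also have "\<dots> \<le> 192 * B\<^sup>2 * (L ^ 5 * N powr (1 - \<gamma>)) / (N powr \<kappa> / 2)"
        using k0 L N by (intro divide_left_mono mult_nonneg_nonneg mult_pos_pos) auto
      also have "\<dots> = 384 * B\<^sup>2 * (N powr (5 * \<epsilon>) * N powr (1 - \<gamma>) / N powr \<kappa>)" by (simp add: Lp)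
      also have "\<dots> = 384 * B\<^sup>2 * N powr (5 * \<epsilon> + 1 - \<gamma> - \<kappa>)" unfolding pw by (simp add: algebra_simps)
      finally show ?thesis .
    qed
    define G where "G = R.good (N powr (1 - \<gamma>)) K"
    have pG: "1 - E n \<le> measure (M n) G"
    proof -
      have "1 - (real (n * p n + n + n * k n + n * n) * (Cm / L ^ (2 * m)) + N * (9/10) ^ k n + 2 / L) \<le> measure (M n) G"
        unfolding G_def K_def Cm_def N_def[symmetric]
        using R.good_prob[OF _ s1 L(1) L(1) k0(1) kp lo tr_def[symmetric] low s2 s3 bb, of m] N by (simp add: N_def)
      moreover have "real (n * p n + n + n * k n + n * n) * (Cm / L ^ (2 * m)) \<le> 4 * Cm * N powr (2 - 2 * (real m * \<epsilon>))"
      proof -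
        have "n * p n + n + n * k n + n * n \<le> 4 * (n * n)"
        proof -
          have "n * p n \<le> n * n" "n * k n \<le> n * n" "n \<le> n * n" using pn(2) kp by auto
          then show ?thesis by linarith
        qed
        then have "real (n * p n + n + n * k n + n * n) \<le> real (4 * (n * n))" by (simp only: of_nat_le_iff)
        then have "real (n * p n + n + n * k n + n * n) \<le> 4 * N powr 2" using N by (simp add: N_def power2_eq_square)
        then have "real (n * p n + n + n * k n + n * n) * (Cm / L ^ (2 * m)) \<le> 4 * N powr 2 * (Cm / L ^ (2 * m))"
          using Cm L by (intro mult_right_mono) auto
        also have "\<dots> = 4 * Cm * (N powr 2 / N powr (2 * (real m * \<epsilon>)))" unfolding Lp by (simp add: mult_ac)
        finally show ?thesis unfolding pw .
      qed
      moreover have "N * (9/10) ^ k n \<le> N * (9/10) powr (N powr \<kappa> - 1)"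
      proof -
        have "(9/10 :: real) ^ k n = (9/10) powr real (k n)" by (simp add: powr_realpow)
        also have "\<dots> \<le> (9/10) powr (N powr \<kappa> - 1)" using kn(2) by (intro powr_mono') auto
        finally show ?thesis using N by (intro mult_left_mono) auto
      qed
      moreover have "2 / L = 2 * N powr (- \<epsilon>)" by (simp add: L_def powr_minus field_simps)
      ultimately show ?thesis by (simp add: E_def N_def[symmetric])
    qed
    let ?D = "(2 * (2 * N powr (1/4) / sqrt (real n) + 2 * (\<integral>x. x ^ 4 \<partial>F0) / N powr (1/4)) + 2 * N powr (- \<omega>) * sigma2
        + (1 + 1 / N powr (- \<omega>)) * (4 * sigma2 * (\<Sum>c<p n. \<Sigma> n $$ (c, c)) / N powr (1 - \<theta>)
        + 4 * N powr (1 - \<theta>) * dot (p n) (vec_index (\<beta> n)) (vec_index (\<beta> n)) / real n + 4 * sigma2 / real n)) / sigma2 + K / sigma2"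
    have int: "(\<integral>\<^sup>+w. f n w * indicator G w \<partial>M n) \<le> ennreal ?D"
      unfolding f_def rho pil G_def
      by (rule R.good_design_distance[OF _ _ _ _ K0 Psi[OF n(3), unfolded rho] model[OF n(3)]]) (use N in auto)
    have D: "?D \<le> U n"
    proof -
      have x1: "N powr (1/4) / sqrt (real n) = N powr (- 1 / 4)"
        using N pw(2)[of "1/4" "1/2"] by (simp add: N_def powr_half_sqrt)
      have x2: "1 / N powr (1/4) = N powr (- 1 / 4)" by (simp add: powr_minus field_simps)
      have x3: "1 + 1 / N powr (- \<omega>) \<le> 2 * N powr \<omega>"
      proof -
        have "1 / N powr (- \<omega>) = N powr \<omega>" by (simp add: powr_minus_divide)
        moreover have "1 \<le> N powr \<omega>" by (rule ge_one_powr_ge_zero) (use N \<omega> in auto)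
        ultimately show ?thesis by linarith
      qed
      have x4: "4 * sigma2 * tr / N powr (1 - \<theta>) \<le> 4 * sigma2 * C1 * N powr (\<theta> - q)"
      proof -
        have "4 * sigma2 * tr / N powr (1 - \<theta>) \<le> 4 * sigma2 * (C1 * N powr (1 - q)) / N powr (1 - \<theta>)"
          using tr F0(7) by (intro divide_right_mono mult_left_mono) auto
        also have "\<dots> = 4 * sigma2 * C1 * (N powr (1 - q) / N powr (1 - \<theta>))" by simp
        finally show ?thesis unfolding pw by (simp add: algebra_simps)
      qed
      have x5: "4 * N powr (1 - \<theta>) * dot (p n) (vec_index (\<beta> n)) (vec_index (\<beta> n)) / real n \<le> 4 * B\<^sup>2 * N powr (- \<theta>)"
      proof -
        have "4 * N powr (1 - \<theta>) * dot (p n) (vec_index (\<beta> n)) (vec_index (\<beta> n)) / real n \<le> 4 * N powr (1 - \<theta>) * B\<^sup>2 / real n"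
          using bb(1) by (intro divide_right_mono mult_left_mono) auto
        also have "\<dots> = 4 * B\<^sup>2 * (N powr (1 - \<theta>) / N powr 1)" using N by (simp add: N_def)
        finally show ?thesis unfolding pw by simp
      qed
      have x6: "4 * sigma2 / real n = 4 * sigma2 * N powr (- 1)" using N by (simp add: N_def powr_minus field_simps)
      have tr0: "0 \<le> tr" unfolding tr_def by (rule R.trace_nonneg)
      have "(1 + 1 / N powr (- \<omega>)) * (4 * sigma2 * tr / N powr (1 - \<theta>)
        + 4 * N powr (1 - \<theta>) * dot (p n) (vec_index (\<beta> n)) (vec_index (\<beta> n)) / real n + 4 * sigma2 / real n)
        \<le> (2 * N powr \<omega>) * (4 * sigma2 * C1 * N powr (\<theta> - q) + 4 * B\<^sup>2 * N powr (- \<theta>) + 4 * sigma2 * N powr (- 1))"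
        using x3 x4 x5 x6 tr0 F0(7) N dot_self_nonneg[of "p n" "vec_index (\<beta> n)"]
        by (intro mult_mono add_mono add_nonneg_nonneg mult_nonneg_nonneg divide_nonneg_nonneg) auto
      also have "\<dots> = 2 * (4 * sigma2 * C1 * (N powr \<omega> * N powr (\<theta> - q)) + 4 * B\<^sup>2 * (N powr \<omega> * N powr (- \<theta>)) + 4 * sigma2 * (N powr \<omega> * N powr (- 1)))"
        by (simp add: algebra_simps)
      also have "\<dots> = 2 * (4 * sigma2 * C1 * N powr (\<omega> + \<theta> - q) + 4 * B\<^sup>2 * N powr (\<omega> - \<theta>) + 4 * sigma2 * N powr (\<omega> - 1))"
        unfolding pw by (simp add: add_diff_eq)
      finally have y: "(1 + 1 / N powr (- \<omega>)) * (4 * sigma2 * tr / N powr (1 - \<theta>)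
        + 4 * N powr (1 - \<theta>) * dot (p n) (vec_index (\<beta> n)) (vec_index (\<beta> n)) / real n + 4 * sigma2 / real n) \<le> \<dots>" .
      have z: "2 * (2 * N powr (1/4) / sqrt (real n) + 2 * m4 / N powr (1/4)) + 2 * N powr (- \<omega>) * sigma2
          = 4 * (N powr (1/4) / sqrt (real n)) + 4 * m4 * (1 / N powr (1/4)) + 2 * sigma2 * N powr (- \<omega>)"
        by simp
      note z = z[unfolded x1 x2]
      have "?D \<le> (4 * N powr (- 1 / 4) + 4 * m4 * N powr (- 1 / 4) + 2 * sigma2 * N powr (- \<omega>)
        + 2 * (4 * sigma2 * C1 * N powr (\<omega> + \<theta> - q) + 4 * B\<^sup>2 * N powr (\<omega> - \<theta>) + 4 * sigma2 * N powr (\<omega> - 1))) / sigma2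
        + 384 * B\<^sup>2 * N powr (5 * \<epsilon> + 1 - \<gamma> - \<kappa>) / sigma2"
        using F0(7) y K unfolding tr_def[symmetric] m4_def[symmetric] z by (intro add_mono divide_right_mono add_left_mono) auto
      then show ?thesis unfolding U_def N_def .
    qed
    have "measure (M n) G - U n / \<delta> n \<le> P n"
      unfolding P_def
    proof (rule R.nn_cond_exp_le_prob[OF R.subalgebra_sigma_gen[OF X_rv[OF n(3)]] _ _ U0 \<delta>0])
      show "G \<in> sets (sigma_gen (M n) (mat_borel n (p n)) (X n))" unfolding G_def by (rule R.good_sets)
      show "(\<integral>\<^sup>+w. f n w * indicator G w \<partial>M n) \<le> ennreal (U n)" using int D by (meson ennreal_leI order_trans)
    qed
    moreover have "U n / \<delta> n \<le> sqrt (U n)"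
    proof -
      have "U n = sqrt (U n) * sqrt (U n)" using U0[of n] by simp
      also have "\<dots> \<le> sqrt (U n) * \<delta> n" using U0[of n] by (intro mult_left_mono) (auto simp: \<delta>_def)
      finally show ?thesis using \<delta>0[of n] by (simp add: divide_le_eq)
    qed
    ultimately show ?case using pG by linarith
  qed
  have "P \<longlonglongrightarrow> 1"
  proof (rule tendsto_sandwich[OF ev])
    show "eventually (\<lambda>n. P n \<le> 1) sequentially"
      using eventually_ge_at_top[of 1] unfolding P_def by eventually_elim (intro prob_space.prob_le_1 prob)
    have "(\<lambda>n. 1 - E n - sqrt (U n)) \<longlonglongrightarrow> 1 - 0 - sqrt 0" by (intro tendsto_intros E_lim U_lim)
    then show "(\<lambda>n. 1 - E n - sqrt (U n)) \<longlonglongrightarrow> 1" by simp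
  qed auto
  then show ?thesis using \<delta>0 \<delta>_lim unfolding P_def f_def by blast
qed

end
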